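(* Let $\mathcal F$ be a saturated fusion system on a finite $p$-group $S$, and for $P\le S$ let $\beta_P=\pi([S/P])\in A(\mathcal F)_{(p)}$. The set of elements $\{\beta_P\mid P\le S \text{ up to }\mathcal F\text{-conjugation}\}$ is a $\mathbb Z_{(p)}$-basis for $A(\mathcal F)_{(p)}$.
   Context: Here $p$ is a prime and $p$-groups are finite. A fusion system $\mathcal F$ on a $p$-group $S$ is a category whose objects are the subgroups of $S$, whose morphism sets $\mathcal F(P,Q)=\mathrm{Hom}_{\mathcal F}(P,Q)$ consist of injective group homomorphisms $P\to Q$ (composed as homomorphisms) and contain all homomorphisms $P\to Q$ induced by conjugation by elements of $S$, and such that for each $\varphi\in\mathcal F(P,Q)$ the isomorphism $\varphi\colon P\to\varphi P$ and its inverse are morphisms of $\mathcal F$. Write $\mathrm{Aut}_{\mathcal F}(P)=\mathcal F(P,P)$. Subgroups $P,Q$ are $\mathcal F$-conjugate ($P\sim_{\mathcal F}Q$) if they are isomorphic in $\mathcal F$; $[P]_{\mathcal F}$ is the set of $\mathcal F$-conjugates of $P$. $P$ is fully $\mathcal F$-normalized (resp. fully $\mathcal F$-centralized) if $|N_SP|\ge|N_SQ|$ (resp. $|C_SP|\ge|C_SQ|$) for all $Q\in[P]_{\mathcal F}$. $\mathcal F$ is saturated if for all $P\le S$: (1) if $P$ is fully $\mathcal F$-normalized, then $P$ is fully $\mathcal F$-centralized and $\mathrm{Aut}_S(P)$ is a Sylow $p$-subgroup of $\mathrm{Aut}_{\mathcal F}(P)$; (2) every $\varphi\in\mathcal F(P,S)$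 with $\varphi(P)$ fully $\mathcal F$-centralized extends to a morphism in $\mathcal F(N_\varphi,S)$, where $N_\varphi=\{x\in N_S(P)\mid \exists y\in S:\varphi\circ c_x=c_y\circ\varphi\}$. $A(S)$ is the Burnside ring of $S$, $\Phi_Q\colon A(S)\to\mathbb Z$ is the ring homomorphism counting $Q$-fixed points, and $(p)$ denotes tensoring with $\mathbb Z_{(p)}$. $X\in A(S)_{(p)}$ is $\mathcal F$-stable if for all $P\le S$ and $\varphi\in\mathcal F(P,S)$ the restrictions of $X$ to $A(P)_{(p)}$ along $\varphi$ and along the inclusion agree; equivalently, $\Phi_P(X)=\Phi_Q(X)$ whenever $P\sim_{\mathcal F}Q$. $A(\mathcal F)_{(p)}$ is the subring of $\mathcal F$-stable elements of $A(S)_{(p)}$. The map $\pi\colon A(S)_{(p)}\to A(\mathcal F)_{(p)}$ sends $X$ to the (existing, unique) element with $\Phi_Q(\pi(X))=\frac1{|[Q]_{\mathcal F}|}\sum_{Q'\in[Q]_{\mathcal F}}\Phi_{Q'}(X)$ for all $Q\le S$. One has $\Phi_Q(\beta_P)=\frac{|\mathcal F(Q,P)|\cdot|S|}{|P|\cdot|\mathcal F(Q,S)|}$, so $\beta_P$ depends only on the $\mathcal F$-conjugacy class of $P$. *)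

theory Defs
  imports
    Complex_Main
    "HOL-Computational_Algebra.Primes"
    "HOL-Algebra.Group_Action"
    "HOL-Algebra.Left_Coset"
    "HOL-Algebra.Module"
begin

section \<open>Finite $G$-sets\<close>

text \<open>A $G$-set is a pair of a point set and an action. The action is a homomorphism into
  \<^const>\<open>BijGroup\<close>, so each group element acts by an extensional function on the points.\<close>

type_synonym ('g, 'x) gset = "'x set \<times> ('g \<Rightarrow> 'x \<Rightarrow> 'x)"

definition finite_gset :: "('g, 'm) monoid_scheme \<Rightarrow> ('g, 'x) gset \<Rightarrow> bool" where
  "finite_gset G X \<longleftrightarrow> finite (fst X) \<and> group_action G (fst X) (snd X)"

definition gset_iso :: "('g, 'm) monoid_scheme \<Rightarrow> ('g, 'x) gset \<Rightarrow> ('g, 'y) gset \<Rightarrow> bool" where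
  "gset_iso G X Y \<longleftrightarrow>
     (\<exists>f. bij_betw f (fst X) (fst Y) \<and>
          (\<forall>g\<in>carrier G. \<forall>x\<in>fst X. f (snd X g x) = snd Y g (f x)))"

definition gset_sum :: "('g, 'x) gset \<Rightarrow> ('g, 'y) gset \<Rightarrow> ('g, 'x + 'y) gset" where
  "gset_sum X Y =
     (Sum_Type.Plus (fst X) (fst Y),
      \<lambda>g. restrict (map_sum (snd X g) (snd Y g)) (Sum_Type.Plus (fst X) (fst Y)))"

definition gset_prod :: "('g, 'x) gset \<Rightarrow> ('g, 'y) gset \<Rightarrow> ('g, 'x \<times> 'y) gset" where
  "gset_prod X Y =
     (fst X \<times> fst Y, \<lambda>g. restrict (map_prod (snd X g) (snd Y g)) (fst X \<times> fst Y))"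

definition gset_empty :: "('g, nat) gset" where
  "gset_empty = ({}, \<lambda>g. \<lambda>x\<in>{}. x)"

definition gset_point :: "('g, unit) gset" where
  "gset_point = ({()}, \<lambda>g. \<lambda>x\<in>{()}. x)"

definition gset_cosets :: "('g, 'm) monoid_scheme \<Rightarrow> 'g set \<Rightarrow> ('g, 'g set) gset" where
  "gset_cosets G P = (lcosets\<^bsub>G\<^esub> P, \<lambda>g. \<lambda>C\<in>lcosets\<^bsub>G\<^esub> P. g <#\<^bsub>G\<^esub> C)"

definition gset_res :: "('h \<Rightarrow> 'g) \<Rightarrow> ('g, 'x) gset \<Rightarrow> ('h, 'x) gset" where
  "gset_res \<phi> X = (fst X, \<lambda>h. snd X (\<phi> h))"

definition gset_fix :: "'g set \<Rightarrow> ('g, 'x) gset \<Rightarrow> 'x set" where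
  "gset_fix Q X = {x \<in> fst X. \<forall>q\<in>Q. snd X q x = x}"


section \<open>The Burnside ring\<close>

text \<open>The Grothendieck ring of finite $G$-sets. Its elements are the classes of formal
  differences of finite $G$-sets with points in \<^typ>\<open>nat\<close>; every finite $G$-set is isomorphic to
  one of these. \<open>gset_diff G X Y\<close> is the class $[X] - [Y]$, where $X$ and $Y$ may have points of
  any type. In the operations below, the union over representatives is a union of equal sets.\<close>

type_synonym 'g burnside = "(('g, nat) gset \<times> ('g, nat) gset) set"

definition gset_diff ::
  "('g, 'm) monoid_scheme \<Rightarrow> ('g, 'x) gset \<Rightarrow> ('g, 'y) gset \<Rightarrow> 'g burnside" where
  "gset_diff G X Y =
     {(U, V). finite_gset G U \<and> finite_gset G V \<and>
        (\<exists>Z :: ('g, nat) gset. finite_gset G Z \<and>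
           gset_iso G (gset_sum (gset_sum X V) Z) (gset_sum (gset_sum U Y) Z))}"

definition burnside_ring :: "('g, 'm) monoid_scheme \<Rightarrow> 'g burnside ring" where
  "burnside_ring G =
     \<lparr>carrier = {gset_diff G X Y | (X :: ('g, nat) gset) (Y :: ('g, nat) gset).
                   finite_gset G X \<and> finite_gset G Y},
      mult = \<lambda>a b. \<Union>(X, Y)\<in>a. \<Union>(X', Y')\<in>b.
               gset_diff G (gset_sum (gset_prod X X') (gset_prod Y Y'))
                           (gset_sum (gset_prod X Y') (gset_prod Y X')),
      one = gset_diff G gset_point gset_empty,
      zero = gset_diff G gset_empty gset_empty,
      add = \<lambda>a b. \<Union>(X, Y)\<in>a. \<Union>(X', Y')\<in>b. gset_diff G (gset_sum X X') (gset_sum Y Y')\<rparr>"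

definition burnside_class ::
  "('g, 'm) monoid_scheme \<Rightarrow> ('g, 'x) gset \<Rightarrow> 'g burnside" where
  "burnside_class G X = gset_diff G X gset_empty"

definition burnside_mark :: "'g set \<Rightarrow> 'g burnside \<Rightarrow> int" where
  "burnside_mark Q a =
     the_elem ((\<lambda>(X, Y). int (card (gset_fix Q X)) - int (card (gset_fix Q Y))) ` a)"

text \<open>Restriction to the Burnside ring of \<open>H\<close> along a homomorphism \<open>\<phi>\<close> out of \<open>H\<close>.\<close>

definition burnside_res ::
  "('h, 'm) monoid_scheme \<Rightarrow> ('h \<Rightarrow> 'g) \<Rightarrow> 'g burnside \<Rightarrow> 'h burnside" where
  "burnside_res H \<phi> a = (\<Union>(X, Y)\<in>a. gset_diff H (gset_res \<phi> X) (gset_res \<phi> Y))"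


section \<open>Localization at a prime\<close>

definition Zloc :: "nat \<Rightarrow> rat ring" where
  "Zloc p =
     \<lparr>carrier = {r. \<not> int p dvd snd (quotient_of r)}, mult = (*), one = 1, zero = 0, add = (+)\<rparr>"

text \<open>$R \otimes \mathbb{Z}_{(p)}$ is built as the localization of \<open>R\<close> at the integers prime to
  \<open>p\<close>; \<open>loc_frac p R x m\<close> is the fraction $x/m$, that is $x \otimes \frac{1}{m}$.\<close>

type_synonym 'r loc = "('r \<times> int) set"

definition loc_frac :: "nat \<Rightarrow> ('r, 'm) ring_scheme \<Rightarrow> 'r \<Rightarrow> int \<Rightarrow> 'r loc" where
  "loc_frac p R x m =
     {(y, n). y \<in> carrier R \<and> \<not> int p dvd n \<and>
        (\<exists>k. \<not> int p dvd k \<and> [(k * n)] \<cdot>\<^bsub>R\<^esub> x = [(k * m)] \<cdot>\<^bsub>R\<^esub> y)}"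

definition localization :: "nat \<Rightarrow> ('r, 'm) ring_scheme \<Rightarrow> (rat, 'r loc) module" where
  "localization p R =
     \<lparr>carrier = {loc_frac p R x m | x m. x \<in> carrier R \<and> \<not> int p dvd m},
      mult = \<lambda>a b. \<Union>(x, m)\<in>a. \<Union>(y, n)\<in>b. loc_frac p R (x \<otimes>\<^bsub>R\<^esub> y) (m * n),
      one = loc_frac p R \<one>\<^bsub>R\<^esub> 1,
      zero = loc_frac p R \<zero>\<^bsub>R\<^esub> 1,
      add = \<lambda>a b. \<Union>(x, m)\<in>a. \<Union>(y, n)\<in>b.
              loc_frac p R ([n] \<cdot>\<^bsub>R\<^esub> x \<oplus>\<^bsub>R\<^esub> [m] \<cdot>\<^bsub>R\<^esub> y) (m * n),
      smult = \<lambda>r a. \<Union>(x, m)\<in>a.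
              loc_frac p R ([fst (quotient_of r)] \<cdot>\<^bsub>R\<^esub> x) (snd (quotient_of r) * m)\<rparr>"

abbreviation burnside_loc :: "nat \<Rightarrow> ('g, 'm) monoid_scheme \<Rightarrow> (rat, 'g burnside loc) module" where
  "burnside_loc p G \<equiv> localization p (burnside_ring G)"

definition loc_mark :: "'g set \<Rightarrow> 'g burnside loc \<Rightarrow> rat" where
  "loc_mark Q A = the_elem ((\<lambda>(a, m). of_int (burnside_mark Q a) / of_int m) ` A)"

definition loc_res ::
  "nat \<Rightarrow> ('h, 'm) monoid_scheme \<Rightarrow> ('h \<Rightarrow> 'g) \<Rightarrow> 'g burnside loc \<Rightarrow> 'h burnside loc" where
  "loc_res p H \<phi> A = (\<Union>(a, m)\<in>A. loc_frac p (burnside_ring H) (burnside_res H \<phi> a) m)"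


section \<open>Bases of modules\<close>

text \<open>A basis is an indexed family: over a nonzero ring its members are pairwise
  distinct.\<close>

definition module_basis ::
  "('r, 'm) ring_scheme \<Rightarrow> ('r, 'a, 'n) module_scheme \<Rightarrow> 'i set \<Rightarrow> ('i \<Rightarrow> 'a) \<Rightarrow> bool" where
  "module_basis R M I b \<longleftrightarrow>
     b \<in> I \<rightarrow> carrier M \<and>
     (\<forall>x\<in>carrier M. \<exists>c\<in>I \<rightarrow> carrier R. finite {i\<in>I. c i \<noteq> \<zero>\<^bsub>R\<^esub>} \<and>
        x = (\<Oplus>\<^bsub>M\<^esub>i\<in>{i\<in>I. c i \<noteq> \<zero>\<^bsub>R\<^esub>}. c i \<odot>\<^bsub>M\<^esub> b i)) \<and>
     (\<forall>c\<in>I \<rightarrow> carrier R. finite {i\<in>I. c i \<noteq> \<zero>\<^bsub>R\<^esub>} \<longrightarrow>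
        (\<Oplus>\<^bsub>M\<^esub>i\<in>{i\<in>I. c i \<noteq> \<zero>\<^bsub>R\<^esub>}. c i \<odot>\<^bsub>M\<^esub> b i) = \<zero>\<^bsub>M\<^esub> \<longrightarrow>
        (\<forall>i\<in>I. c i = \<zero>\<^bsub>R\<^esub>))"


section \<open>Saturated fusion systems\<close>

text \<open>A morphism out of \<open>P\<close> is an extensional function on \<open>P\<close>, so that the composition is
  \<^const>\<open>compose\<close> and the identity is \<open>\<lambda>x\<in>P. x\<close>. The values \<open>F P Q\<close> at sets that are not
  subgroups carry no meaning.\<close>

definition conj_map :: "('g, 'm) monoid_scheme \<Rightarrow> 'g \<Rightarrow> 'g \<Rightarrow> 'g" where
  "conj_map S g x = g \<otimes>\<^bsub>S\<^esub> x \<otimes>\<^bsub>S\<^esub> inv\<^bsub>S\<^esub> g"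

locale fusion_system = group S
  for S :: "('g, 'm) monoid_scheme" (structure)
    and p :: nat
    and F :: "'g set \<Rightarrow> 'g set \<Rightarrow> ('g \<Rightarrow> 'g) set" +
  assumes prime_p: "prime p"
    and p_group: "finite (carrier S)" "\<exists>n. order S = p ^ n"
    and morphism: "\<lbrakk>subgroup P S; subgroup Q S; \<phi> \<in> F P Q\<rbrakk> \<Longrightarrow>
        \<phi> \<in> extensional P \<and> \<phi> \<in> hom (S\<lparr>carrier := P\<rparr>) (S\<lparr>carrier := Q\<rparr>) \<and> inj_on \<phi> P"
    and conj: "\<lbrakk>subgroup P S; subgroup Q S; g \<in> carrier S; conj_map S g ` P \<subseteq> Q\<rbrakk> \<Longrightarrow>
        restrict (conj_map S g) P \<in> F P Q"
    and comp: "\<lbrakk>subgroup P S; subgroup Q S; subgroup R S; \<phi> \<in> F P Q; \<psi> \<in> F Q R\<rbrakk> \<Longrightarrow>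
        compose P \<psi> \<phi> \<in> F P R"
    and onto_image: "\<lbrakk>subgroup P S; subgroup Q S; \<phi> \<in> F P Q\<rbrakk> \<Longrightarrow>
        \<phi> \<in> F P (\<phi> ` P) \<and> restrict (inv_into P \<phi>) (\<phi> ` P) \<in> F (\<phi> ` P) P"

definition F_conj ::
  "('g, 'm) monoid_scheme \<Rightarrow> ('g set \<Rightarrow> 'g set \<Rightarrow> ('g \<Rightarrow> 'g) set) \<Rightarrow> 'g set \<Rightarrow> 'g set \<Rightarrow> bool" where
  "F_conj S F P Q \<longleftrightarrow> subgroup P S \<and> subgroup Q S \<and>
     (\<exists>\<phi>\<in>F P Q. \<exists>\<psi>\<in>F Q P. compose P \<psi> \<phi> = (\<lambda>x\<in>P. x) \<and> compose Q \<phi> \<psi> = (\<lambda>x\<in>Q. x))"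

definition F_class ::
  "('g, 'm) monoid_scheme \<Rightarrow> ('g set \<Rightarrow> 'g set \<Rightarrow> ('g \<Rightarrow> 'g) set) \<Rightarrow> 'g set \<Rightarrow> 'g set set" where
  "F_class S F P = {Q. F_conj S F P Q}"

definition centralizer :: "('g, 'm) monoid_scheme \<Rightarrow> 'g set \<Rightarrow> 'g set" where
  "centralizer S P = {g \<in> carrier S. \<forall>x\<in>P. g \<otimes>\<^bsub>S\<^esub> x = x \<otimes>\<^bsub>S\<^esub> g}"

definition fully_normalized ::
  "('g, 'm) monoid_scheme \<Rightarrow> ('g set \<Rightarrow> 'g set \<Rightarrow> ('g \<Rightarrow> 'g) set) \<Rightarrow> 'g set \<Rightarrow> bool" where
  "fully_normalized S F P \<longleftrightarrow>
     (\<forall>Q\<in>F_class S F P. card (normalizer S Q) \<le> card (normalizer S P))"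

definition fully_centralized ::
  "('g, 'm) monoid_scheme \<Rightarrow> ('g set \<Rightarrow> 'g set \<Rightarrow> ('g \<Rightarrow> 'g) set) \<Rightarrow> 'g set \<Rightarrow> bool" where
  "fully_centralized S F P \<longleftrightarrow>
     (\<forall>Q\<in>F_class S F P. card (centralizer S Q) \<le> card (centralizer S P))"

definition Aut_F :: "('g set \<Rightarrow> 'g set \<Rightarrow> ('g \<Rightarrow> 'g) set) \<Rightarrow> 'g set \<Rightarrow> ('g \<Rightarrow> 'g) monoid" where
  "Aut_F F P = (BijGroup P)\<lparr>carrier := F P P\<rparr>"

definition Aut_S :: "('g, 'm) monoid_scheme \<Rightarrow> 'g set \<Rightarrow> ('g \<Rightarrow> 'g) set" where
  "Aut_S S P = (\<lambda>g. restrict (conj_map S g) P) ` normalizer S P"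

definition sylow_subgroup :: "nat \<Rightarrow> 'a set \<Rightarrow> ('a, 'm) monoid_scheme \<Rightarrow> bool" where
  "sylow_subgroup p H G \<longleftrightarrow> subgroup H G \<and> card H = p ^ multiplicity p (order G)"

definition extender :: "('g, 'm) monoid_scheme \<Rightarrow> 'g set \<Rightarrow> ('g \<Rightarrow> 'g) \<Rightarrow> 'g set" where
  "extender S P \<phi> =
     {x \<in> normalizer S P. \<exists>y\<in>carrier S. \<forall>u\<in>P. \<phi> (conj_map S x u) = conj_map S y (\<phi> u)}"

locale saturated_fusion_system = fusion_system S p F
  for S :: "('g, 'm) monoid_scheme" (structure) and p F +
  assumes fully_normalized_imp: "\<lbrakk>subgroup P S; fully_normalized S F P\<rbrakk> \<Longrightarrow>
        fully_centralized S F P \<and> sylow_subgroup p (Aut_S S P) (Aut_F F P)"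
    and extension:
      "\<lbrakk>subgroup P S; \<phi> \<in> F P (carrier S); fully_centralized S F (\<phi> ` P)\<rbrakk> \<Longrightarrow>
        \<exists>\<psi>\<in>F (extender S P \<phi>) (carrier S). \<forall>x\<in>P. \<psi> x = \<phi> x"


section \<open>Stable elements and the transfer map\<close>

definition F_stable ::
  "('g, 'm) monoid_scheme \<Rightarrow> nat \<Rightarrow> ('g set \<Rightarrow> 'g set \<Rightarrow> ('g \<Rightarrow> 'g) set) \<Rightarrow>
   'g burnside loc \<Rightarrow> bool" where
  "F_stable S p F A \<longleftrightarrow>
     (\<forall>P \<phi>. subgroup P S \<longrightarrow> \<phi> \<in> F P (carrier S) \<longrightarrow>
        loc_res p (S\<lparr>carrier := P\<rparr>) \<phi> A = loc_res p (S\<lparr>carrier := P\<rparr>) (\<lambda>x\<in>P. x) A)"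

definition stable_burnside ::
  "('g, 'm) monoid_scheme \<Rightarrow> nat \<Rightarrow> ('g set \<Rightarrow> 'g set \<Rightarrow> ('g \<Rightarrow> 'g) set) \<Rightarrow>
   (rat, 'g burnside loc) module" where
  "stable_burnside S p F =
     (burnside_loc p S)\<lparr>carrier := {A \<in> carrier (burnside_loc p S). F_stable S p F A}\<rparr>"

definition F_transfer ::
  "('g, 'm) monoid_scheme \<Rightarrow> nat \<Rightarrow> ('g set \<Rightarrow> 'g set \<Rightarrow> ('g \<Rightarrow> 'g) set) \<Rightarrow>
   'g burnside loc \<Rightarrow> 'g burnside loc" where
  "F_transfer S p F X =
     (THE Y. Y \<in> carrier (stable_burnside S p F) \<and>
        (\<forall>Q. subgroup Q S \<longrightarrow>
           loc_mark Q Y = (\<Sum>Q'\<in>F_class S F Q. loc_mark Q' X) / of_nat (card (F_class S F Q))))"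

definition beta ::
  "('g, 'm) monoid_scheme \<Rightarrow> nat \<Rightarrow> ('g set \<Rightarrow> 'g set \<Rightarrow> ('g \<Rightarrow> 'g) set) \<Rightarrow>
   'g set \<Rightarrow> 'g burnside loc" where
  "beta S p F P =
     F_transfer S p F (loc_frac p (burnside_ring S) (burnside_class S (gset_cosets S P)) 1)"

end

theory Submission
  imports Defs "HOL-Algebra.Generated_Groups"
begin

text \<open>An element \<open>x\<close> of $A(S)_{(p)}$ is determined by its marks $\Phi_Q(x)$, and it is stable if and only if
  $\Phi_Q(x)$ depends on the $\mathcal F$-class of \<open>Q\<close> only (\<open>loc_eqI\<close>, \<open>F_stable_iff\<close>). So the theorem is a
  statement about mark functions. Once it is known that the average of a mark function over the
  $\mathcal F$-classes is again a mark function (\<open>class_average_in_lattice\<close>), the transfer \<open>\<pi>\<close> exists; it is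
  linear and fixes the stable elements. A stable element $x = \sum_P d_P [S/P]$ then equals
  $\pi(x) = \sum_P d_P \beta_P$, and $\beta_P$ depends only on the class of \<open>P\<close>: its mark at \<open>Q\<close> counts the
  $\mathcal F$-conjugates of \<open>Q\<close> that lie in \<open>P\<close> (\<open>beta_mark_count\<close>). By the same count the matrix of
  marks of the $\beta_P$ is triangular with nonzero diagonal entries, whence independence.

  To see that an average \<open>f\<close> of a mark function is a mark function, one builds a mark function \<open>h\<close>
  that agrees with \<open>f\<close> on larger and larger families of subgroups, beginning with the large ones. If
  \<open>h\<close> and \<open>f\<close> agree above the order of \<open>Q\<close>, then a multiple of the marks of $S/Q$ corrects \<open>h\<close> at
  \<open>Q\<close>, provided that $f(Q) \equiv h(Q)$ modulo $|N_S(Q)/Q|$ (\<open>lattice_criterion\<close>). Every mark function satisfies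
  a congruence at each \<open>Q\<close>, the Cauchy-Frobenius count of the orbits of a subgroup of $N_S(Q)/Q$ on
  \<open>Q\<close>-fixed points (\<open>lattice_congruence\<close>), and the required congruence comes from three facts.

  First, since \<open>h\<close> is a class function above \<open>Q\<close>, and an isomorphism from \<open>Q\<close> to a fully normalized
  $Q^*$ can be chosen to extend to $N_S(Q)$, the congruences at \<open>Q\<close> and $Q^*$ give
  $h(Q) \equiv h(Q^*)$ modulo $|N_S(Q)/Q|$ (\<open>lattice_conjugate_congruence\<close>). So it is enough to treat $Q^*$.
  Second, the sum of the left-hand sides of the congruences over a whole $\mathcal F$-class is the same for a
  function and for its average, because it counts each subgroup with a weight that is a class
  function (\<open>class_average_sum_over_pairs\<close>). For mark functions it is a multiple of $|S|$
  (\<open>lattice_class_congruence\<close>), and hence the sum over the class of $f - h$ is divisible by $|S|/|Q|$. Third, the number of $\mathcal F$-conjugates of $Q^*$ is $|S : N_S(Q^*)|$ times a number prime to \<open>p\<close>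
  (\<open>card_F_class_unit\<close>), and dividing by it leaves the congruence at $Q^*$ alone.\<close>


section \<open>The $p$-local integers\<close>

abbreviation p_int :: "nat \<Rightarrow> rat set" where
  "p_int p \<equiv> carrier (Zloc p)"

lemma p_int_iff: "r \<in> p_int p \<longleftrightarrow> (\<exists>a b. \<not> int p dvd b \<and> r = of_int a / of_int b)"
proof
  assume "r \<in> p_int p"
  then have "\<not> int p dvd snd (quotient_of r)" by (simp add: Zloc_def)
  moreover have "r = of_int (fst (quotient_of r)) / of_int (snd (quotient_of r))"
    by (rule quotient_of_div) simp
  ultimately show "\<exists>a b. \<not> int p dvd b \<and> r = of_int a / of_int b" by blast
next
  assume "\<exists>a b. \<not> int p dvd b \<and> r = of_int a / of_int b"
  then obtain a b where b: "\<not> int p dvd b" and r: "r = of_int a / of_int b" by blast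
  obtain x y where q: "quotient_of r = (x, y)" by fastforce
  have y: "y > 0" and c: "coprime x y" and rxy: "r = of_int x / of_int y"
    using quotient_of_denom_pos[OF q] quotient_of_coprime[OF q] quotient_of_div[OF q] by auto
  have "b \<noteq> 0" using b by auto
  then have "(of_int (x * b) :: rat) = of_int (a * y)"
    using r rxy y by (simp add: field_simps)
  then have "x * b = a * y" by (simp only: of_int_eq_iff)
  then have "y dvd x * b" by simp
  then have "y dvd b" using c by (simp add: coprime_commute coprime_dvd_mult_right_iff)
  then have "\<not> int p dvd y" using b dvd_trans by blast
  then show "r \<in> p_int p" by (simp add: Zloc_def q)
qed

lemma p_int_fraction:
  "\<not> int p dvd b \<Longrightarrow> of_int a / of_int b \<in> p_int p"
  unfolding p_int_iff by blast

context
  fixes p :: nat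
  assumes p: "prime p"
begin

lemma not_dvd_mult_p: "\<not> int p dvd a \<Longrightarrow> \<not> int p dvd b \<Longrightarrow> \<not> int p dvd a * b"
  using p by (simp add: prime_dvd_mult_iff)

lemma not_dvd_one_p: "\<not> int p dvd 1"
  using p by (meson not_prime_unit prime_nat_int_transfer)

lemma p_int_of_int: "of_int a \<in> p_int p"
  using p_int_fraction[OF not_dvd_one_p, of a] by simp

lemma p_int_of_nat: "of_nat a \<in> p_int p"
  using p_int_of_int[of "int a"] by simp

lemma p_int_0: "0 \<in> p_int p" and p_int_1: "1 \<in> p_int p"
  using p_int_of_int[of 0] p_int_of_int[of 1] by auto

lemma p_int_add: assumes "r \<in> p_int p" "s \<in> p_int p" shows "r + s \<in> p_int p"
proof -
  obtain a b c d where "\<not> int p dvd b" "r = of_int a / of_int b"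
    "\<not> int p dvd d" "s = of_int c / of_int d"
    using assms unfolding p_int_iff by blast
  moreover from this have "b \<noteq> 0" "d \<noteq> 0" by auto
  ultimately have "r + s = of_int (a * d + c * b) / of_int (b * d)" "\<not> int p dvd b * d"
    by (auto simp: field_simps not_dvd_mult_p)
  then show ?thesis unfolding p_int_iff by blast
qed

lemma p_int_mult: assumes "r \<in> p_int p" "s \<in> p_int p" shows "r * s \<in> p_int p"
proof -
  obtain a b c d where "\<not> int p dvd b" "r = of_int a / of_int b"
    "\<not> int p dvd d" "s = of_int c / of_int d"
    using assms unfolding p_int_iff by blast
  then have "r * s = of_int (a * c) / of_int (b * d)" "\<not> int p dvd b * d"
    by (auto simp: not_dvd_mult_p)
  then show ?thesis unfolding p_int_iff by blast
qed

lemma p_int_uminus: assumes "r \<in> p_int p" shows "- r \<in> p_int p"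
  using p_int_mult[OF p_int_of_int[of "-1"] assms] by simp

lemma p_int_diff: assumes "r \<in> p_int p" "s \<in> p_int p" shows "r - s \<in> p_int p"
  using p_int_add[OF assms(1) p_int_uminus[OF assms(2)]] by simp

lemma p_int_sum: "(\<And>i. i \<in> I \<Longrightarrow> f i \<in> p_int p) \<Longrightarrow> sum f I \<in> p_int p"
  by (induction I rule: infinite_finite_induct) (auto intro: p_int_0 p_int_add)

end


section \<open>Finite actions and their marks\<close>

locale finite_group = group G for G :: "('g, 'm) monoid_scheme" (structure) +
  assumes finite_carrier: "finite (carrier G)"

text \<open>In contrast to \<^locale>\<open>group_action\<close>, only the values at the points matter, and so the same function
  still acts after passing to an invariant subset or to a subgroup.\<close>

definition acts :: "('g, 'm) monoid_scheme \<Rightarrow> ('g, 'x) gset \<Rightarrow> bool" where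
  "acts G X \<longleftrightarrow> (\<forall>x\<in>fst X. snd X \<one>\<^bsub>G\<^esub> x = x \<and> (\<forall>g\<in>carrier G. snd X g x \<in> fst X \<and>
     (\<forall>h\<in>carrier G. snd X (g \<otimes>\<^bsub>G\<^esub> h) x = snd X g (snd X h x))))"

lemma acts_closed: "acts G X \<Longrightarrow> g \<in> carrier G \<Longrightarrow> x \<in> fst X \<Longrightarrow> snd X g x \<in> fst X"
  and acts_one: "acts G X \<Longrightarrow> x \<in> fst X \<Longrightarrow> snd X \<one>\<^bsub>G\<^esub> x = x"
  and acts_mult: "acts G X \<Longrightarrow> g \<in> carrier G \<Longrightarrow> h \<in> carrier G \<Longrightarrow> x \<in> fst X \<Longrightarrow>
        snd X (g \<otimes>\<^bsub>G\<^esub> h) x = snd X g (snd X h x)"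
  unfolding acts_def by auto

lemma finite_gset_acts: "finite_gset G X \<Longrightarrow> acts G X"
proof -
  assume "finite_gset G X"
  then interpret group_action G "fst X" "snd X" by (simp add: finite_gset_def)
  show ?thesis unfolding acts_def
    by (simp add: composition_rule element_image id_eq_one[symmetric])
qed

lemma finite_gset_finite: "finite_gset G X \<Longrightarrow> finite (fst X)"
  by (simp add: finite_gset_def)

context group
begin

lemma acts_inv:
  assumes "acts G X" "g \<in> carrier G" "x \<in> fst X"
  shows "snd X (inv g) (snd X g x) = x" "snd X g (snd X (inv g) x) = x"
  using assms by (metis acts_mult acts_one inv_closed l_inv, metis acts_mult acts_one inv_closed r_inv)

lemma acts_bij:
  assumes "acts G X" "g \<in> carrier G" shows "bij_betw (snd X g) (fst X) (fst X)"
  by (rule bij_betwI[where g = "snd X (inv g)"]) (auto simp: assms acts_closed[OF assms(1)] acts_inv)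

lemma acts_group_action:
  assumes "acts G X" shows "group_action G (fst X) (\<lambda>g. restrict (snd X g) (fst X))"
proof -
  have B: "restrict (snd X g) (fst X) \<in> Bij (fst X)" if "g \<in> carrier G" for g
    using acts_bij[OF assms that] unfolding Bij_def by (simp cong: bij_betw_cong)
  have "group_hom G (BijGroup (fst X)) (\<lambda>g. restrict (snd X g) (fst X))"
    unfolding group_hom_def group_hom_axioms_def
  proof (intro conjI is_group group_BijGroup homI)
    show "restrict (snd X g) (fst X) \<in> carrier (BijGroup (fst X))" if "g \<in> carrier G" for g
      using B[OF that] by (simp add: BijGroup_def)
    show "restrict (snd X (g \<otimes> h)) (fst X)
        = restrict (snd X g) (fst X) \<otimes>\<^bsub>BijGroup (fst X)\<^esub> restrict (snd X h) (fst X)"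
      if "g \<in> carrier G" "h \<in> carrier G" for g h
      using B that assms by (auto simp: BijGroup_def compose_def acts_mult acts_closed[OF assms] fun_eq_iff)
  qed
  then show ?thesis by (rule group_action.intro)
qed

lemma finite_gsetI:
  assumes "finite (fst X)" "acts G X" "\<And>g. g \<in> carrier G \<Longrightarrow> snd X g \<in> extensional (fst X)"
  shows "finite_gset G X"
proof -
  interpret ga: group_action G "fst X" "\<lambda>g. restrict (snd X g) (fst X)"
    by (rule acts_group_action[OF assms(2)])
  have "snd X \<in> hom G (BijGroup (fst X))"
  proof (rule homI)
    show "snd X g \<in> carrier (BijGroup (fst X))" if "g \<in> carrier G" for g
      using ga.bij_prop0[OF that] assms(3)[OF that] by (simp add: BijGroup_def extensional_restrict)
    show "snd X (g \<otimes> h) = snd X g \<otimes>\<^bsub>BijGroup (fst X)\<^esub> snd X h"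
      if "g \<in> carrier G" "h \<in> carrier G" for g h
      using group_hom.hom_mult[OF ga.group_hom that] that assms(3)
      by (simp add: extensional_restrict)
  qed
  then have "group_action G (fst X) (snd X)"
    by (simp add: group_action_def group_hom_def group_hom_axioms_def group_BijGroup is_group)
  with assms(1) show ?thesis by (simp add: finite_gset_def)
qed

lemma finite_gset_transport:
  assumes "finite (fst X)" "acts G X"
  shows "\<exists>X' :: ('a, nat) gset. finite_gset G X' \<and> gset_iso G X X'"
proof -
  obtain f where f: "bij_betw f (fst X) {0..<card (fst X)}"
    using ex_bij_betw_finite_nat[OF assms(1)] by blast
  define k where "k = inv_into (fst X) f"
  have k: "k n \<in> fst X" "f (k n) = n" if "n < card (fst X)" for n
    using f that unfolding k_def bij_betw_def by (auto simp: inv_into_into f_inv_into_f)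
  have fk: "f x < card (fst X)" "k (f x) = x" if "x \<in> fst X" for x
    using f that unfolding k_def by (auto simp: bij_betw_def)
  let ?X' = "({0..<card (fst X)}, \<lambda>g. \<lambda>n\<in>{0..<card (fst X)}. f (snd X g (k n)))"
  have "finite_gset G ?X'"
    by (rule finite_gsetI)
      (use assms(2) in \<open>auto simp: acts_def fk k\<close>)
  moreover have "gset_iso G X ?X'"
    unfolding gset_iso_def using f fk by auto
  ultimately show ?thesis by blast
qed

end

lemma gset_iso_fix_card:
  assumes "gset_iso G X Y" "acts G X" "Q \<subseteq> carrier G"
  shows "card (gset_fix Q X) = card (gset_fix Q Y)"
proof -
  obtain f where f: "bij_betw f (fst X) (fst Y)"
    and eq: "\<And>g x. g \<in> carrier G \<Longrightarrow> x \<in> fst X \<Longrightarrow> f (snd X g x) = snd Y g (f x)"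
    using assms(1) unfolding gset_iso_def by blast
  have inj: "inj_on f (fst X)" and im: "f ` fst X = fst Y" using f by (auto simp: bij_betw_def)
  have "f ` gset_fix Q X = gset_fix Q Y"
  proof (intro equalityI subsetI)
    fix y assume "y \<in> f ` gset_fix Q X"
    then obtain x where x: "x \<in> fst X" "y = f x" "\<forall>q\<in>Q. snd X q x = x"
      by (auto simp: gset_fix_def)
    then have "snd Y q y = y" if "q \<in> Q" for q using eq[of q x] that assms(3) by auto
    then show "y \<in> gset_fix Q Y" using x im by (auto simp: gset_fix_def)
  next
    fix y assume y: "y \<in> gset_fix Q Y"
    then obtain x where x: "x \<in> fst X" "y = f x" using im by (auto simp: gset_fix_def)
    have "snd X q x = x" if "q \<in> Q" for q
    proof (rule inj_onD[OF inj])
      show "f (snd X q x) = f x" using eq[of q x] that assms(3) x y by (auto simp: gset_fix_def)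
    qed (use x(1) that assms(3) acts_closed[OF assms(2)] in blast)+
    then show "y \<in> f ` gset_fix Q X" using x by (auto simp: gset_fix_def)
  qed
  moreover have "inj_on f (gset_fix Q X)" using inj by (rule inj_on_subset) (auto simp: gset_fix_def)
  ultimately show ?thesis by (metis card_image)
qed

context finite_group
begin

lemma finite_subgroup: "subgroup H G \<Longrightarrow> finite H"
  using finite_carrier finite_subset subgroup.subset by blast

lemma finite_subgroups: "finite {P. subgroup P G}"
  by (rule finite_subset[of _ "Pow (carrier G)"]) (auto simp: finite_carrier dest: subgroup.subset)

lemma subgroup_card_pos: "subgroup H G \<Longrightarrow> card H > 0"
  using finite_subgroup subgroup.one_closed by (fastforce simp: card_gt_0_iff)

end

context group
begin

lemma point_stabilizer:
  assumes "acts G X" "x \<in> fst X"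
  shows "subgroup {g \<in> carrier G. snd X g x = x} G"
  by (rule subgroupI) (auto simp: assms acts_one acts_mult, metis acts_inv(1) assms)

text \<open>Each orbit is a copy of the cosets of the stabilizer of its base point, and the correspondence of
  the base points extends equivariantly when these stabilizers agree.\<close>

lemma orbit_iso:
  assumes X: "acts G X" "x \<in> fst X" and Y: "acts G Y" "y \<in> fst Y"
    and st: "\<And>g. g \<in> carrier G \<Longrightarrow> snd X g x = x \<longleftrightarrow> snd Y g y = y"
  shows "gset_iso G ((\<lambda>g. snd X g x) ` carrier G, snd X) ((\<lambda>g. snd Y g y) ` carrier G, snd Y)"
proof -
  have same: "snd X g x = snd X h x \<longleftrightarrow> snd Y g y = snd Y h y"
    if "g \<in> carrier G" "h \<in> carrier G" for g h
  proof -
    have "snd X g x = snd X h x \<longleftrightarrow> snd X (inv h \<otimes> g) x = x"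
      using that X by (metis acts_closed acts_inv acts_mult inv_closed)
    also have "\<dots> \<longleftrightarrow> snd Y (inv h \<otimes> g) y = y" using that by (intro st) auto
    also have "\<dots> \<longleftrightarrow> snd Y g y = snd Y h y"
      using that Y by (metis acts_closed acts_inv acts_mult inv_closed)
    finally show ?thesis .
  qed
  define f where "f z = snd Y (SOME g. g \<in> carrier G \<and> snd X g x = z) y" for z
  have f: "f (snd X g x) = snd Y g y" if g: "g \<in> carrier G" for g
  proof -
    let ?h = "SOME h. h \<in> carrier G \<and> snd X h x = snd X g x"
    have "?h \<in> carrier G \<and> snd X ?h x = snd X g x" by (rule someI[of _ g]) (simp add: g)
    then show ?thesis unfolding f_def using same g by blast
  qed
  have "bij_betw f ((\<lambda>g. snd X g x) ` carrier G) ((\<lambda>g. snd Y g y) ` carrier G)"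
    unfolding bij_betw_def inj_on_def using same f by (auto simp: image_image)
  moreover have "f (snd X h (snd X g x)) = snd Y h (f (snd X g x))"
    if "g \<in> carrier G" "h \<in> carrier G" for g h
    using that f X Y by (metis acts_mult m_closed)
  ultimately show ?thesis unfolding gset_iso_def by auto
qed

lemma orbit_splitting:
  assumes X: "acts G X" and x: "x \<in> fst X" and fin: "finite (fst X)"
    and A: "A = (\<lambda>g. snd X g x) ` carrier G"
  shows "A \<subseteq> fst X" "x \<in> A" "acts G (A, snd X)" "acts G (fst X - A, snd X)"
    "card (gset_fix Q X) = card (gset_fix Q (A, snd X)) + card (gset_fix Q (fst X - A, snd X))"
proof -
  show sub: "A \<subseteq> fst X" unfolding A using x by (auto simp: acts_closed[OF X])
  show "x \<in> A" unfolding A using acts_one[OF X x] by (intro image_eqI[of _ _ \<one>]) auto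
  have cl: "snd X g z \<in> A" if "g \<in> carrier G" "z \<in> A" for g z
    using that X x unfolding A by (auto simp: acts_mult[symmetric] intro!: image_eqI)
  have cl': "snd X g z \<in> fst X - A" if "g \<in> carrier G" "z \<in> fst X - A" for g z
    using that X cl[of "inv g" "snd X g z"] by (auto simp: acts_closed[OF X] acts_inv)
  show "acts G (A, snd X)" "acts G (fst X - A, snd X)"
    using X sub cl cl' unfolding acts_def by auto
  show "card (gset_fix Q X) = card (gset_fix Q (A, snd X)) + card (gset_fix Q (fst X - A, snd X))"
    by (subst card_Un_disjoint[symmetric])
      (use sub fin in \<open>auto simp: gset_fix_def intro: finite_subset intro!: arg_cong[where f = card]\<close>)
qed

end

lemma gset_iso_union:
  assumes "gset_iso G (A, snd X) (B, snd Y)" "gset_iso G (fst X - A, snd X) (fst Y - B, snd Y)"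
    and A: "A \<subseteq> fst X" "B \<subseteq> fst Y"
    and cl: "acts G (fst X - A, snd X)" "acts G (A, snd X)"
  shows "gset_iso G X Y"
proof -
  obtain f h where f: "bij_betw f A B" "\<forall>g\<in>carrier G. \<forall>x\<in>A. f (snd X g x) = snd Y g (f x)"
    and h: "bij_betw h (fst X - A) (fst Y - B)"
      "\<forall>g\<in>carrier G. \<forall>x\<in>fst X - A. h (snd X g x) = snd Y g (h x)"
    using assms unfolding gset_iso_def by auto
  let ?k = "\<lambda>x. if x \<in> A then f x else h x"
  have "bij_betw ?k (A \<union> (fst X - A)) (B \<union> (fst Y - B))"
    by (rule bij_betw_disjoint_Un[OF f(1) h(1)]) auto
  then have "bij_betw ?k (fst X) (fst Y)" using A by (simp add: Un_absorb1)
  moreover have "?k (snd X g x) = snd Y g (?k x)" if "g \<in> carrier G" "x \<in> fst X" for g x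
    using f(2) h(2) acts_closed[OF cl(1), of g x] acts_closed[OF cl(2), of g x] that by auto
  ultimately show ?thesis unfolding gset_iso_def by blast
qed

text \<open>A point of \<open>X\<close> with a largest stabilizer \<open>P\<close> gives a \<open>P\<close>-fixed point of \<open>Y\<close>. If the stabilizer of that
  point were larger, then it would fix a point of \<open>X\<close> too, against the choice of \<open>P\<close>. So both actions have an orbit of type
  $G/P$, and when these orbits are removed, the marks still agree.\<close>

theorem (in finite_group) marks_determine_gset:
  fixes X :: "('g, 'x) gset" and Y :: "('g, 'y) gset"
  assumes "finite (fst X)" "acts G X" "finite (fst Y)" "acts G Y"
    and "\<And>Q. subgroup Q G \<Longrightarrow> card (gset_fix Q X) = card (gset_fix Q Y)"
  shows "gset_iso G X Y"
  using assms
proof (induction "card (fst X)" arbitrary: X Y rule: less_induct)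
  case less
  note X = \<open>acts G X\<close> and Y = \<open>acts G Y\<close> and marks = less.prems(5)
  have fix1: "gset_fix {\<one>} X = fst X" "gset_fix {\<one>} Y = fst Y"
    using X Y by (auto simp: gset_fix_def acts_one)
  have "card (fst X) = card (fst Y)" using marks[OF triv_subgroup] by (simp add: fix1)
  show ?case
  proof (cases "fst X = {}")
    case True
    then have "fst Y = {}" using \<open>card (fst X) = card (fst Y)\<close> less.prems by simp
    with True show ?thesis unfolding gset_iso_def by (auto simp: bij_betw_def)
  next
    case False
    define stX where "stX x = {g \<in> carrier G. snd X g x = x}" for x
    define stY where "stY y = {g \<in> carrier G. snd Y g y = y}" for y
    obtain x where x: "x \<in> fst X" and xmax: "\<And>x'. x' \<in> fst X \<Longrightarrow> card (stX x') \<le> card (stX x)"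
    proof -
      have "finite ((\<lambda>x. card (stX x)) ` fst X)" using less.prems(1) by simp
      then have "Max ((\<lambda>x. card (stX x)) ` fst X) \<in> (\<lambda>x. card (stX x)) ` fst X"
        and "\<And>x'. x' \<in> fst X \<Longrightarrow> card (stX x') \<le> Max ((\<lambda>x. card (stX x)) ` fst X)"
        using False by (auto intro!: Max_in)
      then show ?thesis using that by fastforce
    qed
    have sX: "subgroup (stX x') G" if "x' \<in> fst X" for x'
      unfolding stX_def by (rule point_stabilizer[OF X that])
    have sY: "subgroup (stY y') G" if "y' \<in> fst Y" for y'
      unfolding stY_def by (rule point_stabilizer[OF Y that])
    have fin: "finite (gset_fix Q X)" "finite (gset_fix Q Y)" for Q
      using less.prems by (auto simp: gset_fix_def)
    have "x \<in> gset_fix (stX x) X" using x by (auto simp: gset_fix_def stX_def)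
    then have "gset_fix (stX x) Y \<noteq> {}" using marks[OF sX[OF x]] fin by (metis card_0_eq emptyE)
    then obtain y where y: "y \<in> fst Y" "stX x \<subseteq> stY y"
      using subgroup.subset[OF sX[OF x]] by (auto simp: gset_fix_def stY_def)
    have "y \<in> gset_fix (stY y) Y" using y by (auto simp: gset_fix_def stY_def)
    then have "gset_fix (stY y) X \<noteq> {}" using marks[OF sY[OF y(1)]] fin by (metis card_0_eq emptyE)
    then obtain x' where x': "x' \<in> fst X" "stY y \<subseteq> stX x'"
      using subgroup.subset[OF sY[OF y(1)]] by (auto simp: gset_fix_def stX_def)
    have "card (stY y) \<le> card (stX x)"
      using card_mono[OF finite_subgroup[OF sX[OF x'(1)]] x'(2)] xmax[OF x'(1)] by linarith
    then have st: "stX x = stY y"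
      using y(2) finite_subgroup[OF sY[OF y(1)]] by (simp add: card_seteq)
    define A where "A = (\<lambda>g. snd X g x) ` carrier G"
    define B where "B = (\<lambda>g. snd Y g y) ` carrier G"
    note spX = orbit_splitting[OF X x less.prems(1) A_def]
      and spY = orbit_splitting[OF Y y(1) less.prems(3) B_def]
    have iso: "gset_iso G (A, snd X) (B, snd Y)"
      unfolding A_def B_def using st by (intro orbit_iso X Y x y) (auto simp: stX_def stY_def)
    have "gset_iso G (fst X - A, snd X) (fst Y - B, snd Y)"
    proof (rule less.hyps)
      show "card (fst (fst X - A, snd X)) < card (fst X)"
        using less.prems(1) x spX(2) by (auto intro!: psubset_card_mono)
      fix Q assume Q: "subgroup Q G"
      show "card (gset_fix Q (fst X - A, snd X)) = card (gset_fix Q (fst Y - B, snd Y))"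
        using gset_iso_fix_card[OF iso spX(3) subgroup.subset[OF Q]] marks[OF Q] spX(5)[of Q] spY(5)[of Q]
        by linarith
    qed (use less.prems spX(4) spY(4) in auto)
    then show ?thesis by (rule gset_iso_union[OF iso _ spX(1) spY(1) spX(4,3)])
  qed
qed

section \<open>The Burnside ring is determined by marks\<close>

definition gset_mark :: "'g set \<Rightarrow> ('g, 'x) gset \<Rightarrow> int" where
  "gset_mark Q X = int (card (gset_fix Q X))"

definition finite_action :: "('g, 'm) monoid_scheme \<Rightarrow> ('g, 'x) gset \<Rightarrow> bool" where
  "finite_action G X \<longleftrightarrow> finite (fst X) \<and> acts G X"

lemma finite_gset_action: "finite_gset G X \<Longrightarrow> finite_action G X"
  by (simp add: finite_action_def finite_gset_acts finite_gset_finite)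

lemma finite_action_sum:
  "finite_action G X \<Longrightarrow> finite_action G Y \<Longrightarrow> finite_action G (gset_sum X Y)"
  unfolding finite_action_def acts_def gset_sum_def by auto

lemma gset_mark_sum:
  assumes "finite_action G X" "finite_action G Y"
  shows "gset_mark Q (gset_sum X Y) = gset_mark Q X + gset_mark Q Y"
proof -
  have "gset_fix Q (gset_sum X Y) = Sum_Type.Plus (gset_fix Q X) (gset_fix Q Y)"
    unfolding gset_fix_def gset_sum_def by auto
  moreover have "finite (gset_fix Q X)" "finite (gset_fix Q Y)"
    using assms unfolding finite_action_def gset_fix_def by auto
  ultimately show ?thesis unfolding gset_mark_def by (simp add: card_Plus)
qed

lemma gset_mark_empty [simp]: "gset_mark Q gset_empty = 0"
  by (simp add: gset_mark_def gset_fix_def gset_empty_def)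

lemma gset_mark_iso:
  "gset_iso G X Y \<Longrightarrow> finite_action G X \<Longrightarrow> Q \<subseteq> carrier G \<Longrightarrow> gset_mark Q X = gset_mark Q Y"
  by (simp add: gset_mark_def finite_action_def gset_iso_fix_card)

text \<open>The operations on Burnside rings and on localizations are unions over representatives; the
  next two facts evaluate them once the result is seen not to depend on the representatives.\<close>

lemma UN_const2:
  assumes "a \<noteq> {}" "\<And>x y. (x, y) \<in> a \<Longrightarrow> f x y = c"
  shows "(\<Union>(x, y)\<in>a. f x y) = c"
  using assms by fast

lemma UN_const4:
  assumes "a \<noteq> {}" "b \<noteq> {}"
    and "\<And>x y u v. (x, y) \<in> a \<Longrightarrow> (u, v) \<in> b \<Longrightarrow> f x y u v = c"
  shows "(\<Union>(x, y)\<in>a. \<Union>(u, v)\<in>b. f x y u v) = c"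
  by (intro UN_const2 assms)

lemma the_elem_const2:
  assumes "a \<noteq> {}" "\<And>x y. (x, y) \<in> a \<Longrightarrow> f x y = c"
  shows "the_elem ((\<lambda>(x, y). f x y) ` a) = c"
proof -
  have "(\<lambda>(x, y). f x y) ` a = {c}" using assms by fast
  then show ?thesis by simp
qed

context finite_group
begin

lemma finite_gset_empty: "finite_gset G gset_empty"
  by (rule finite_gsetI) (auto simp: gset_empty_def acts_def)

lemma finite_action_nat:
  assumes "finite_action G X"
  obtains X' :: "('g, nat) gset" where "finite_gset G X'"
    "\<And>Q. subgroup Q G \<Longrightarrow> gset_mark Q X' = gset_mark Q X"
proof -
  obtain X' :: "('g, nat) gset" where X': "finite_gset G X'" "gset_iso G X X'"
    using finite_gset_transport assms unfolding finite_action_def by blast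
  show thesis
  proof (rule that[OF X'(1)])
    show "gset_mark Q X' = gset_mark Q X" if "subgroup Q G" for Q
      using gset_mark_iso[OF X'(2) assms subgroup.subset[OF that]] by simp
  qed
qed

text \<open>Because marks determine finite actions up to isomorphism, the class of a formal difference
  is the set of all formal differences with the same differences of marks.\<close>

lemma gset_diff_eq:
  assumes X: "finite_action G X" and Y: "finite_action G Y"
  shows "gset_diff G X Y = {(U, V). finite_gset G U \<and> finite_gset G V \<and>
    (\<forall>Q. subgroup Q G \<longrightarrow> gset_mark Q U - gset_mark Q V = gset_mark Q X - gset_mark Q Y)}"
proof -
  have "(\<exists>Z :: ('g, nat) gset. finite_gset G Z \<and>
          gset_iso G (gset_sum (gset_sum X V) Z) (gset_sum (gset_sum U Y) Z)) \<longleftrightarrow>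
        (\<forall>Q. subgroup Q G \<longrightarrow> gset_mark Q U - gset_mark Q V = gset_mark Q X - gset_mark Q Y)"
    (is "?L \<longleftrightarrow> ?R") if "finite_gset G U" "finite_gset G V" for U V :: "('g, nat) gset"
  proof
    have U: "finite_action G U" and V: "finite_action G V"
      using that by (auto intro: finite_gset_action)
    show ?R if ?L
    proof (intro allI impI)
      fix Q assume Q: "subgroup Q G"
      obtain Z :: "('g, nat) gset" where Z: "finite_gset G Z"
        "gset_iso G (gset_sum (gset_sum X V) Z) (gset_sum (gset_sum U Y) Z)"
        using \<open>?L\<close> by blast
      note Za = finite_gset_action[OF Z(1)]
      have "gset_mark Q (gset_sum (gset_sum X V) Z) = gset_mark Q (gset_sum (gset_sum U Y) Z)"
        by (intro gset_mark_iso[OF Z(2)] finite_action_sum X Y U V Za subgroup.subset[OF Q])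
      then show "gset_mark Q U - gset_mark Q V = gset_mark Q X - gset_mark Q Y"
        by (simp add: gset_mark_sum[of G] finite_action_sum X Y U V Za)
    qed
    show ?L if ?R
    proof (intro exI conjI)
      let ?Z = "gset_empty :: ('g, nat) gset"
      note Za = finite_gset_action[OF finite_gset_empty]
      show "finite_gset G ?Z" by (rule finite_gset_empty)
      have "finite_action G (gset_sum (gset_sum X V) ?Z)" "finite_action G (gset_sum (gset_sum U Y) ?Z)"
        by (intro finite_action_sum X Y U V Za)+
      moreover have "gset_mark Q (gset_sum (gset_sum X V) ?Z) = gset_mark Q (gset_sum (gset_sum U Y) ?Z)"
        if "subgroup Q G" for Q
        using \<open>?R\<close>[rule_format, OF that]
        by (simp add: gset_mark_sum[of G] finite_action_sum X Y U V Za)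
      ultimately show "gset_iso G (gset_sum (gset_sum X V) ?Z) (gset_sum (gset_sum U Y) ?Z)"
        by (intro marks_determine_gset) (auto simp: finite_action_def gset_mark_def)
    qed
  qed
  then show ?thesis unfolding gset_diff_def
    by (intro Collect_cong) (simp add: case_prod_unfold cong: conj_cong del: split_paired_Ex)
qed

lemma gset_diff_nonempty:
  assumes "finite_action G X" "finite_action G Y"
  shows "gset_diff G X Y \<noteq> {}"
proof -
  obtain U :: "('g, nat) gset" where "finite_gset G U"
    "\<And>Q. subgroup Q G \<Longrightarrow> gset_mark Q U = gset_mark Q X" using finite_action_nat[OF assms(1)] by blast
  moreover obtain V :: "('g, nat) gset" where "finite_gset G V"
    "\<And>Q. subgroup Q G \<Longrightarrow> gset_mark Q V = gset_mark Q Y" using finite_action_nat[OF assms(2)] by blast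
  ultimately have "(U, V) \<in> gset_diff G X Y" by (simp add: gset_diff_eq assms)
  then show ?thesis by blast
qed

lemma gset_diff_cong:
  assumes "finite_action G X" "finite_action G Y" "finite_action G X'" "finite_action G Y'"
    and "\<And>Q. subgroup Q G \<Longrightarrow> gset_mark Q X - gset_mark Q Y = gset_mark Q X' - gset_mark Q Y'"
  shows "gset_diff G X Y = gset_diff G X' Y'"
  using assms(5) by (auto simp: gset_diff_eq assms(1-4))

lemma gset_diff_carrier:
  assumes "finite_action G X" "finite_action G Y"
  shows "gset_diff G X Y \<in> carrier (burnside_ring G)"
proof -
  obtain U :: "('g, nat) gset" where U: "finite_gset G U"
    "\<And>Q. subgroup Q G \<Longrightarrow> gset_mark Q U = gset_mark Q X" using finite_action_nat[OF assms(1)] by blast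
  obtain V :: "('g, nat) gset" where V: "finite_gset G V"
    "\<And>Q. subgroup Q G \<Longrightarrow> gset_mark Q V = gset_mark Q Y" using finite_action_nat[OF assms(2)] by blast
  have "gset_diff G X Y = gset_diff G U V"
    by (intro gset_diff_cong assms finite_gset_action) (simp_all add: U V)
  then show ?thesis using U(1) V(1) unfolding burnside_ring_def partial_object.simps by blast
qed

lemma burnside_carrierE:
  assumes "a \<in> carrier (burnside_ring G)"
  obtains X Y :: "('g, nat) gset" where "a = gset_diff G X Y" "finite_action G X" "finite_action G Y"
  using assms finite_gset_action unfolding burnside_ring_def partial_object.simps by blast

lemma burnside_mark_diff:
  assumes "finite_action G X" "finite_action G Y" "subgroup Q G"
  shows "burnside_mark Q (gset_diff G X Y) = gset_mark Q X - gset_mark Q Y"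
  unfolding burnside_mark_def
  by (rule the_elem_const2[OF gset_diff_nonempty[OF assms(1,2)]])
    (use assms(3) in \<open>auto simp: gset_diff_eq[OF assms(1,2)] gset_mark_def\<close>)

lemma burnside_eqI:
  assumes "a \<in> carrier (burnside_ring G)" "b \<in> carrier (burnside_ring G)"
    and "\<And>Q. subgroup Q G \<Longrightarrow> burnside_mark Q a = burnside_mark Q b"
  shows "a = b"
  using assms(3) burnside_carrierE[OF assms(1)] burnside_carrierE[OF assms(2)]
  by (smt (verit) burnside_mark_diff gset_diff_cong)

lemma burnside_add:
  assumes "a \<in> carrier (burnside_ring G)" "b \<in> carrier (burnside_ring G)"
  shows "a \<oplus>\<^bsub>burnside_ring G\<^esub> b \<in> carrier (burnside_ring G)"
    and "subgroup Q G \<Longrightarrow>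
      burnside_mark Q (a \<oplus>\<^bsub>burnside_ring G\<^esub> b) = burnside_mark Q a + burnside_mark Q b"
proof -
  obtain X Y :: "('g, nat) gset" where a: "a = gset_diff G X Y" "finite_action G X" "finite_action G Y"
    using burnside_carrierE[OF assms(1)] by blast
  obtain U V :: "('g, nat) gset" where b: "b = gset_diff G U V" "finite_action G U" "finite_action G V"
    using burnside_carrierE[OF assms(2)] by blast
  have "a \<oplus>\<^bsub>burnside_ring G\<^esub> b
      = (\<Union>(X, Y)\<in>a. \<Union>(X', Y')\<in>b. gset_diff G (gset_sum X X') (gset_sum Y Y'))"
    by (simp add: burnside_ring_def)
  also have "\<dots> = gset_diff G (gset_sum X U) (gset_sum Y V)"
  proof (rule UN_const4)
    fix X1 Y1 X2 Y2 assume "(X1, Y1) \<in> a" "(X2, Y2) \<in> b"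
    then have 1: "finite_action G X1" "finite_action G Y1" "finite_action G X2" "finite_action G Y2"
      and 2: "\<And>Q. subgroup Q G \<Longrightarrow> gset_mark Q X1 - gset_mark Q Y1 = gset_mark Q X - gset_mark Q Y"
        "\<And>Q. subgroup Q G \<Longrightarrow> gset_mark Q X2 - gset_mark Q Y2 = gset_mark Q U - gset_mark Q V"
      using a b by (auto simp: gset_diff_eq finite_gset_action)
    show "gset_diff G (gset_sum X1 X2) (gset_sum Y1 Y2) = gset_diff G (gset_sum X U) (gset_sum Y V)"
      using 2 by (intro gset_diff_cong finite_action_sum 1 a b)
        (simp add: gset_mark_sum[of G] 1 a b, fastforce)
  qed (simp_all add: a b gset_diff_nonempty)
  finally have eq: "a \<oplus>\<^bsub>burnside_ring G\<^esub> b = gset_diff G (gset_sum X U) (gset_sum Y V)" .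
  show "a \<oplus>\<^bsub>burnside_ring G\<^esub> b \<in> carrier (burnside_ring G)"
    unfolding eq by (intro gset_diff_carrier finite_action_sum a b)
  show "burnside_mark Q (a \<oplus>\<^bsub>burnside_ring G\<^esub> b) = burnside_mark Q a + burnside_mark Q b"
    if "subgroup Q G"
    unfolding eq using that a b
    by (simp add: burnside_mark_diff finite_action_sum gset_mark_sum[of G])
qed

lemma burnside_zero:
  shows "\<zero>\<^bsub>burnside_ring G\<^esub> \<in> carrier (burnside_ring G)"
    and "subgroup Q G \<Longrightarrow> burnside_mark Q \<zero>\<^bsub>burnside_ring G\<^esub> = 0"
proof -
  have "finite_action G (gset_empty :: ('g, nat) gset)" by (rule finite_gset_action[OF finite_gset_empty])
  moreover have "\<zero>\<^bsub>burnside_ring G\<^esub> = gset_diff G gset_empty gset_empty" by (simp add: burnside_ring_def)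
  ultimately show "\<zero>\<^bsub>burnside_ring G\<^esub> \<in> carrier (burnside_ring G)"
    "subgroup Q G \<Longrightarrow> burnside_mark Q \<zero>\<^bsub>burnside_ring G\<^esub> = 0"
    by (auto simp: gset_diff_carrier burnside_mark_diff)
qed

lemma burnside_neg:
  assumes "a \<in> carrier (burnside_ring G)"
  shows "\<exists>b\<in>carrier (burnside_ring G).
    \<forall>Q. subgroup Q G \<longrightarrow> burnside_mark Q b = - burnside_mark Q a"
proof -
  obtain X Y :: "('g, nat) gset" where a: "a = gset_diff G X Y" "finite_action G X" "finite_action G Y"
    using burnside_carrierE[OF assms(1)] by blast
  show ?thesis
    by (rule bexI[of _ "gset_diff G Y X"]) (auto simp: a burnside_mark_diff gset_diff_carrier)
qed

lemma burnside_abelian_group: "abelian_group (burnside_ring G)"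
proof (rule abelian_groupI)
  let ?R = "burnside_ring G"
  fix a b c assume abc: "a \<in> carrier ?R" "b \<in> carrier ?R"
  show "a \<oplus>\<^bsub>?R\<^esub> b \<in> carrier ?R" using abc by (rule burnside_add)
  show "a \<oplus>\<^bsub>?R\<^esub> b = b \<oplus>\<^bsub>?R\<^esub> a"
    by (rule burnside_eqI) (simp_all add: burnside_add abc)
  show "\<zero>\<^bsub>?R\<^esub> \<oplus>\<^bsub>?R\<^esub> a = a"
    by (rule burnside_eqI) (simp_all add: burnside_add burnside_zero abc)
  show "a \<oplus>\<^bsub>?R\<^esub> b \<oplus>\<^bsub>?R\<^esub> c = a \<oplus>\<^bsub>?R\<^esub> (b \<oplus>\<^bsub>?R\<^esub> c)" if "c \<in> carrier ?R"
    by (rule burnside_eqI) (simp_all add: burnside_add abc that)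
  obtain b' where b': "b' \<in> carrier ?R" "\<forall>Q. subgroup Q G \<longrightarrow> burnside_mark Q b' = - burnside_mark Q a"
    using burnside_neg[OF abc(1)] by blast
  show "\<exists>y\<in>carrier ?R. y \<oplus>\<^bsub>?R\<^esub> a = \<zero>\<^bsub>?R\<^esub>"
    by (rule bexI[OF _ b'(1)], rule burnside_eqI) (simp_all add: burnside_add burnside_zero abc b')
qed (rule burnside_zero)

lemma burnside_add_pow:
  assumes a: "a \<in> carrier (burnside_ring G)"
  shows "[(k :: int)] \<cdot>\<^bsub>burnside_ring G\<^esub> a \<in> carrier (burnside_ring G)"
    and "subgroup Q G \<Longrightarrow> burnside_mark Q ([k] \<cdot>\<^bsub>burnside_ring G\<^esub> a) = k * burnside_mark Q a"
proof -
  let ?R = "burnside_ring G"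
  interpret R: abelian_group ?R by (rule burnside_abelian_group)
  show "[k] \<cdot>\<^bsub>?R\<^esub> a \<in> carrier ?R" using a by (rule R.add.int_pow_closed)
  have nat: "burnside_mark Q ([(n :: nat)] \<cdot>\<^bsub>?R\<^esub> a) = int n * burnside_mark Q a"
    if Q: "subgroup Q G" for Q n
    by (induction n) (use a Q in \<open>simp_all add: burnside_zero burnside_add algebra_simps\<close>)
  show "burnside_mark Q ([k] \<cdot>\<^bsub>?R\<^esub> a) = k * burnside_mark Q a" if Q: "subgroup Q G"
  proof (cases "k \<ge> 0")
    case True
    then show ?thesis using nat[OF Q, of "nat k"] by (simp add: add_pow_int_ge)
  next
    case False
    let ?x = "[nat (- k)] \<cdot>\<^bsub>?R\<^esub> a"
    have x: "?x \<in> carrier ?R" using a by simp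
    have "burnside_mark Q (\<ominus>\<^bsub>?R\<^esub> ?x \<oplus>\<^bsub>?R\<^esub> ?x) = 0" using x by (simp add: R.l_neg burnside_zero Q)
    then have "burnside_mark Q (\<ominus>\<^bsub>?R\<^esub> ?x) = - burnside_mark Q ?x"
      using x Q by (simp add: burnside_add)
    then show ?thesis using nat[OF Q, of "nat (- k)"] False by (simp add: add_pow_int_lt)
  qed
qed

end

lemma burnside_res:
  fixes G :: "('g, 'm) monoid_scheme" and H :: "('h, 'n) monoid_scheme"
  assumes "finite_group G" "finite_group H" and \<phi>: "\<phi> \<in> hom H G"
    and a: "a \<in> carrier (burnside_ring G)"
  shows "burnside_res H \<phi> a \<in> carrier (burnside_ring H)"
    and "subgroup Q H \<Longrightarrow> burnside_mark Q (burnside_res H \<phi> a) = burnside_mark (\<phi> ` Q) a"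
proof -
  interpret G: finite_group G by fact
  interpret H: finite_group H by fact
  interpret \<phi>: group_hom H G \<phi> by unfold_locales (rule \<phi>)
  have res: "finite_action H (gset_res \<phi> X)" if "finite_action G X" for X :: "('g, nat) gset"
    using that \<phi>.hom_closed unfolding finite_action_def acts_def gset_res_def by auto
  have mark: "gset_mark Q (gset_res \<phi> X) = gset_mark (\<phi> ` Q) X" for X :: "('g, nat) gset" and Q
    unfolding gset_mark_def gset_fix_def gset_res_def by simp
  have im: "subgroup (\<phi> ` Q) G" if "subgroup Q H" for Q using that by (rule \<phi>.subgroup_img_is_subgroup)
  obtain X Y :: "('g, nat) gset" where X: "a = gset_diff G X Y" "finite_action G X" "finite_action G Y"
    using G.burnside_carrierE[OF a] by blast
  have eq: "burnside_res H \<phi> a = gset_diff H (gset_res \<phi> X) (gset_res \<phi> Y)"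
    unfolding burnside_res_def
  proof (rule UN_const2)
    show "a \<noteq> {}" using X G.gset_diff_nonempty by blast
    fix U V assume "(U, V) \<in> a"
    then show "gset_diff H (gset_res \<phi> U) (gset_res \<phi> V) = gset_diff H (gset_res \<phi> X) (gset_res \<phi> Y)"
      using X im by (intro H.gset_diff_cong)
        (simp_all add: G.gset_diff_eq res mark finite_gset_action)
  qed
  show "burnside_res H \<phi> a \<in> carrier (burnside_ring H)"
    unfolding eq by (intro H.gset_diff_carrier res X)
  show "burnside_mark Q (burnside_res H \<phi> a) = burnside_mark (\<phi> ` Q) a" if "subgroup Q H"
    unfolding eq using that X by (simp add: H.burnside_mark_diff G.burnside_mark_diff res mark im)
qed


section \<open>The $p$-local Burnside ring is determined by marks\<close>

locale finite_group_at_prime = finite_group G for G :: "('g, 'm) monoid_scheme" (structure) +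
  fixes p :: nat
  assumes prime_p: "prime p"
begin

abbreviation "A \<equiv> burnside_ring G"
abbreviation "Ap \<equiv> burnside_loc p G"

text \<open>Marks are integers, and so the factor \<open>k\<close> in the equality of fractions cancels.\<close>

lemma loc_frac_eq:
  assumes a: "a \<in> carrier A" and m: "\<not> int p dvd m"
  shows "loc_frac p A a m = {(b, n). b \<in> carrier A \<and> \<not> int p dvd n \<and>
    (\<forall>Q. subgroup Q G \<longrightarrow>
       rat_of_int (burnside_mark Q b) / of_int n = of_int (burnside_mark Q a) / of_int m)}"
proof -
  have "(\<exists>k. \<not> int p dvd k \<and> [(k * n)] \<cdot>\<^bsub>A\<^esub> a = [(k * m)] \<cdot>\<^bsub>A\<^esub> b) \<longleftrightarrow>
    (\<forall>Q. subgroup Q G \<longrightarrow>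
       rat_of_int (burnside_mark Q b) / of_int n = of_int (burnside_mark Q a) / of_int m)"
    (is "?L \<longleftrightarrow> ?R")
    if b: "b \<in> carrier A" and n: "\<not> int p dvd n" for b n
  proof -
    have nz: "m \<noteq> 0" "n \<noteq> 0" using m n by auto
    have eq: "rat_of_int (burnside_mark Q b) / of_int n = of_int (burnside_mark Q a) / of_int m
      \<longleftrightarrow> n * burnside_mark Q a = m * burnside_mark Q b" for Q
    proof -
      have "rat_of_int (burnside_mark Q b) / of_int n = of_int (burnside_mark Q a) / of_int m
        \<longleftrightarrow> rat_of_int (n * burnside_mark Q a) = of_int (m * burnside_mark Q b)"
        using nz by (auto simp: field_simps)
      then show ?thesis by (simp only: of_int_eq_iff)
    qed
    show ?thesis
    proof
      assume ?L
      then obtain k where k: "\<not> int p dvd k" "[(k * n)] \<cdot>\<^bsub>A\<^esub> a = [(k * m)] \<cdot>\<^bsub>A\<^esub> b" by blast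
      then have "k \<noteq> 0" by auto
      show ?R unfolding eq
      proof (intro allI impI)
        fix Q assume Q: "subgroup Q G"
        have "k * n * burnside_mark Q a = k * m * burnside_mark Q b"
          using burnside_add_pow(2)[OF a Q, of "k * n"] burnside_add_pow(2)[OF b Q, of "k * m"] k(2)
          by metis
        then show "n * burnside_mark Q a = m * burnside_mark Q b"
          using \<open>k \<noteq> 0\<close> by (simp only: mult.assoc mult_cancel_left simp_thms)
      qed
    next
      assume ?R
      then have "[(1 * n)] \<cdot>\<^bsub>A\<^esub> a = [(1 * m)] \<cdot>\<^bsub>A\<^esub> b"
        unfolding eq by (intro burnside_eqI) (simp_all add: burnside_add_pow a b)
      then show ?L using not_dvd_one_p[OF prime_p] by blast
    qed
  qed
  then show ?thesis unfolding loc_frac_def by auto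
qed

lemma loc_frac_nonempty: "a \<in> carrier A \<Longrightarrow> \<not> int p dvd m \<Longrightarrow> loc_frac p A a m \<noteq> {}"
  using loc_frac_eq[of a m] by auto

lemma loc_frac_cong:
  assumes "a \<in> carrier A" "\<not> int p dvd m" "b \<in> carrier A" "\<not> int p dvd n"
    and "\<And>Q. subgroup Q G \<Longrightarrow>
       rat_of_int (burnside_mark Q a) / of_int m = of_int (burnside_mark Q b) / of_int n"
  shows "loc_frac p A a m = loc_frac p A b n"
  using assms(5) by (auto simp: loc_frac_eq assms(1-4))

lemma loc_carrierE:
  assumes "x \<in> carrier Ap"
  obtains a m where "x = loc_frac p A a m" "a \<in> carrier A" "\<not> int p dvd m"
  using assms unfolding localization_def by auto

lemma loc_frac_carrier: "a \<in> carrier A \<Longrightarrow> \<not> int p dvd m \<Longrightarrow> loc_frac p A a m \<in> carrier Ap"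
  unfolding localization_def by auto

lemma loc_mark_frac:
  assumes "a \<in> carrier A" "\<not> int p dvd m" "subgroup Q G"
  shows "loc_mark Q (loc_frac p A a m) = of_int (burnside_mark Q a) / of_int m"
  unfolding loc_mark_def
  by (rule the_elem_const2[OF loc_frac_nonempty[OF assms(1,2)]])
    (use assms(3) in \<open>auto simp: loc_frac_eq[OF assms(1,2)]\<close>)

lemma loc_eqI:
  assumes "x \<in> carrier Ap" "y \<in> carrier Ap"
    and "\<And>Q. subgroup Q G \<Longrightarrow> loc_mark Q x = loc_mark Q y"
  shows "x = y"
proof -
  obtain a m where a: "x = loc_frac p A a m" "a \<in> carrier A" "\<not> int p dvd m"
    by (rule loc_carrierE[OF assms(1)])
  obtain b n where b: "y = loc_frac p A b n" "b \<in> carrier A" "\<not> int p dvd n"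
    by (rule loc_carrierE[OF assms(2)])
  show ?thesis
    unfolding a(1) b(1) using assms(3) by (intro loc_frac_cong a b) (simp add: a b loc_mark_frac)
qed

lemma loc_add:
  assumes "x \<in> carrier Ap" "y \<in> carrier Ap"
  shows "x \<oplus>\<^bsub>Ap\<^esub> y \<in> carrier Ap"
    and "subgroup Q G \<Longrightarrow> loc_mark Q (x \<oplus>\<^bsub>Ap\<^esub> y) = loc_mark Q x + loc_mark Q y"
proof -
  obtain a m where a: "x = loc_frac p A a m" "a \<in> carrier A" "\<not> int p dvd m"
    by (rule loc_carrierE[OF assms(1)])
  obtain b n where b: "y = loc_frac p A b n" "b \<in> carrier A" "\<not> int p dvd n"
    by (rule loc_carrierE[OF assms(2)])
  have mark: "rat_of_int (burnside_mark Q ([n] \<cdot>\<^bsub>A\<^esub> a \<oplus>\<^bsub>A\<^esub> [m] \<cdot>\<^bsub>A\<^esub> b)) / of_int (m * n)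
      = of_int (burnside_mark Q a) / of_int m + of_int (burnside_mark Q b) / of_int n"
    if "a \<in> carrier A" "\<not> int p dvd m" "b \<in> carrier A" "\<not> int p dvd n" "subgroup Q G" for Q a b m n
  proof -
    have "m \<noteq> 0" "n \<noteq> 0" using that by auto
    then show ?thesis using that
      by (simp add: burnside_add burnside_add_pow field_simps)
  qed
  have cl: "[n] \<cdot>\<^bsub>A\<^esub> a \<oplus>\<^bsub>A\<^esub> [m] \<cdot>\<^bsub>A\<^esub> b \<in> carrier A" if "a \<in> carrier A" "b \<in> carrier A" for a b and m n :: int
    using that by (simp add: burnside_add burnside_add_pow)
  note nd = not_dvd_mult_p[OF prime_p]
  have "x \<oplus>\<^bsub>Ap\<^esub> y = (\<Union>(a, m)\<in>x. \<Union>(b, n)\<in>y. loc_frac p A ([n] \<cdot>\<^bsub>A\<^esub> a \<oplus>\<^bsub>A\<^esub> [m] \<cdot>\<^bsub>A\<^esub> b) (m * n))"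
    by (simp add: localization_def)
  also have "\<dots> = loc_frac p A ([n] \<cdot>\<^bsub>A\<^esub> a \<oplus>\<^bsub>A\<^esub> [m] \<cdot>\<^bsub>A\<^esub> b) (m * n)"
  proof (rule UN_const4)
    fix a' m' b' n' assume "(a', m') \<in> x" "(b', n') \<in> y"
    then have "a' \<in> carrier A" "\<not> int p dvd m'" "b' \<in> carrier A" "\<not> int p dvd n'"
      "\<And>Q. subgroup Q G \<Longrightarrow> rat_of_int (burnside_mark Q a') / of_int m' = of_int (burnside_mark Q a) / of_int m"
      "\<And>Q. subgroup Q G \<Longrightarrow> rat_of_int (burnside_mark Q b') / of_int n' = of_int (burnside_mark Q b) / of_int n"
      using a b by (auto simp: loc_frac_eq)
    then show "loc_frac p A ([n'] \<cdot>\<^bsub>A\<^esub> a' \<oplus>\<^bsub>A\<^esub> [m'] \<cdot>\<^bsub>A\<^esub> b') (m' * n')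
        = loc_frac p A ([n] \<cdot>\<^bsub>A\<^esub> a \<oplus>\<^bsub>A\<^esub> [m] \<cdot>\<^bsub>A\<^esub> b) (m * n)"
      using a b by (intro loc_frac_cong cl nd) (simp_all only: mark not_False_eq_True)
  qed (use a b loc_frac_nonempty in auto)
  finally have eq: "x \<oplus>\<^bsub>Ap\<^esub> y = loc_frac p A ([n] \<cdot>\<^bsub>A\<^esub> a \<oplus>\<^bsub>A\<^esub> [m] \<cdot>\<^bsub>A\<^esub> b) (m * n)" .
  show "x \<oplus>\<^bsub>Ap\<^esub> y \<in> carrier Ap" unfolding eq by (intro loc_frac_carrier cl nd a b)
  show "loc_mark Q (x \<oplus>\<^bsub>Ap\<^esub> y) = loc_mark Q x + loc_mark Q y" if "subgroup Q G"
    unfolding eq using that a b by (simp only: loc_mark_frac cl nd mark not_False_eq_True)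
qed

lemma loc_zero:
  shows "\<zero>\<^bsub>Ap\<^esub> \<in> carrier Ap" and "subgroup Q G \<Longrightarrow> loc_mark Q \<zero>\<^bsub>Ap\<^esub> = 0"
proof -
  have eq: "\<zero>\<^bsub>Ap\<^esub> = loc_frac p A \<zero>\<^bsub>A\<^esub> 1" by (simp add: localization_def)
  show "\<zero>\<^bsub>Ap\<^esub> \<in> carrier Ap" "subgroup Q G \<Longrightarrow> loc_mark Q \<zero>\<^bsub>Ap\<^esub> = 0"
    unfolding eq using not_dvd_one_p[OF prime_p]
    by (auto simp: loc_frac_carrier loc_mark_frac burnside_zero)
qed

lemma loc_smult:
  assumes x: "x \<in> carrier Ap" and r: "r \<in> p_int p"
  shows "r \<odot>\<^bsub>Ap\<^esub> x \<in> carrier Ap"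
    and "subgroup Q G \<Longrightarrow> loc_mark Q (r \<odot>\<^bsub>Ap\<^esub> x) = r * loc_mark Q x"
proof -
  obtain a m where a: "x = loc_frac p A a m" "a \<in> carrier A" "\<not> int p dvd m"
    by (rule loc_carrierE[OF x])
  obtain u v where uv: "quotient_of r = (u, v)" by fastforce
  have v: "\<not> int p dvd v" using r by (simp add: Zloc_def uv)
  have r_eq: "r = of_int u / of_int v" by (rule quotient_of_div[OF uv])
  note nd = not_dvd_mult_p[OF prime_p]
  have mark: "rat_of_int (burnside_mark Q ([u] \<cdot>\<^bsub>A\<^esub> a)) / of_int (v * m) = r * (of_int (burnside_mark Q a) / of_int m)"
    if "a \<in> carrier A" "subgroup Q G" for Q a m
    using that by (simp add: burnside_add_pow r_eq)
  have "r \<odot>\<^bsub>Ap\<^esub> x = (\<Union>(a, m)\<in>x. loc_frac p A ([u] \<cdot>\<^bsub>A\<^esub> a) (v * m))"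
    by (simp add: localization_def uv)
  also have "\<dots> = loc_frac p A ([u] \<cdot>\<^bsub>A\<^esub> a) (v * m)"
  proof (rule UN_const2)
    fix a' m' assume "(a', m') \<in> x"
    then have "a' \<in> carrier A" "\<not> int p dvd m'"
      "\<And>Q. subgroup Q G \<Longrightarrow> rat_of_int (burnside_mark Q a') / of_int m' = of_int (burnside_mark Q a) / of_int m"
      using a by (auto simp: loc_frac_eq)
    then show "loc_frac p A ([u] \<cdot>\<^bsub>A\<^esub> a') (v * m') = loc_frac p A ([u] \<cdot>\<^bsub>A\<^esub> a) (v * m)"
      using a v by (intro loc_frac_cong nd burnside_add_pow) (simp_all only: mark not_False_eq_True)
  qed (use a loc_frac_nonempty in auto)
  finally have eq: "r \<odot>\<^bsub>Ap\<^esub> x = loc_frac p A ([u] \<cdot>\<^bsub>A\<^esub> a) (v * m)" .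
  show "r \<odot>\<^bsub>Ap\<^esub> x \<in> carrier Ap" unfolding eq by (intro loc_frac_carrier burnside_add_pow nd a v)
  show "loc_mark Q (r \<odot>\<^bsub>Ap\<^esub> x) = r * loc_mark Q x" if "subgroup Q G"
    unfolding eq using that a v by (simp only: loc_mark_frac burnside_add_pow(1) nd mark not_False_eq_True)
qed

end

lemma loc_res:
  fixes G :: "('g, 'm) monoid_scheme" and H :: "('h, 'n) monoid_scheme"
  assumes "finite_group_at_prime G p" "finite_group_at_prime H p" and \<phi>: "\<phi> \<in> hom H G"
    and x: "x \<in> carrier (burnside_loc p G)"
  shows "loc_res p H \<phi> x \<in> carrier (burnside_loc p H)"
    and "subgroup Q H \<Longrightarrow> loc_mark Q (loc_res p H \<phi> x) = loc_mark (\<phi> ` Q) x"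
proof -
  interpret G: finite_group_at_prime G p by fact
  interpret H: finite_group_at_prime H p by fact
  interpret \<phi>: group_hom H G \<phi> by unfold_locales (rule \<phi>)
  note res = burnside_res[OF G.finite_group_axioms H.finite_group_axioms \<phi>]
  have im: "subgroup (\<phi> ` Q) G" if "subgroup Q H" for Q using that by (rule \<phi>.subgroup_img_is_subgroup)
  obtain a m where a: "x = loc_frac p G.A a m" "a \<in> carrier G.A" "\<not> int p dvd m"
    by (rule G.loc_carrierE[OF x])
  have eq: "loc_res p H \<phi> x = loc_frac p H.A (burnside_res H \<phi> a) m"
    unfolding loc_res_def
  proof (rule UN_const2)
    fix a' m' assume "(a', m') \<in> x"
    then show "loc_frac p H.A (burnside_res H \<phi> a') m' = loc_frac p H.A (burnside_res H \<phi> a) m"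
      using a im by (intro H.loc_frac_cong) (auto simp: res G.loc_frac_eq)
  qed (use a G.loc_frac_nonempty in auto)
  show "loc_res p H \<phi> x \<in> carrier (burnside_loc p H)"
    unfolding eq by (intro H.loc_frac_carrier res a)
  show "loc_mark Q (loc_res p H \<phi> x) = loc_mark (\<phi> ` Q) x" if "subgroup Q H"
    unfolding eq using that a by (simp add: H.loc_mark_frac G.loc_mark_frac res im)
qed

section \<open>Marks of coset actions\<close>

lemma card_fibres:
  assumes "finite A" "\<And>y. y \<in> f ` A \<Longrightarrow> card {x \<in> A. f x = y} = n"
  shows "card A = card (f ` A) * n"
proof -
  have "card A = (\<Sum>y\<in>f ` A. card {x \<in> A. f x = y})"
    using sum.image_gen[OF assms(1), of "\<lambda>_. 1 :: nat" f] by simp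
  also have "\<dots> = card (f ` A) * n" using assms(2) by simp
  finally show ?thesis .
qed

context group
begin

lemma conj_map_hom: "g \<in> carrier G \<Longrightarrow> group_hom G G (conj_map G g)"
  by unfold_locales (auto simp: hom_def conj_map_def m_assoc inv_solve_left)

lemma conj_map_closed: "g \<in> carrier G \<Longrightarrow> x \<in> carrier G \<Longrightarrow> conj_map G g x \<in> carrier G"
  by (simp add: conj_map_def)

lemma conj_map_mult:
  "g \<in> carrier G \<Longrightarrow> h \<in> carrier G \<Longrightarrow> x \<in> carrier G \<Longrightarrow>
   conj_map G (g \<otimes> h) x = conj_map G g (conj_map G h x)"
  by (simp add: conj_map_def m_assoc inv_mult_group)

lemma conj_map_one: "x \<in> carrier G \<Longrightarrow> conj_map G \<one> x = x"
  by (simp add: conj_map_def)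

lemma conj_map_inv:
  assumes "g \<in> carrier G" "x \<in> carrier G"
  shows "conj_map G (inv g) (conj_map G g x) = x" "conj_map G g (conj_map G (inv g) x) = x"
  using assms by (simp_all add: conj_map_mult[symmetric] conj_map_one)

lemma conj_image_mult:
  assumes "g \<in> carrier G" "h \<in> carrier G" "Q \<subseteq> carrier G"
  shows "conj_map G (g \<otimes> h) ` Q = conj_map G g ` conj_map G h ` Q"
  unfolding image_image by (rule image_cong) (use assms in \<open>auto simp: conj_map_mult\<close>)

lemma conj_image_one: "Q \<subseteq> carrier G \<Longrightarrow> conj_map G \<one> ` Q = Q"
  by (force simp: conj_map_one)

lemma conj_image_subgroup: "g \<in> carrier G \<Longrightarrow> subgroup Q G \<Longrightarrow> subgroup (conj_map G g ` Q) G"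
  using conj_map_hom group_hom.subgroup_img_is_subgroup by blast

lemma conj_map_inj: "g \<in> carrier G \<Longrightarrow> Q \<subseteq> carrier G \<Longrightarrow> inj_on (conj_map G g) Q"
  by (rule inj_on_inverseI[where g = "conj_map G (inv g)"]) (auto simp: conj_map_inv)

lemma conj_image_card: "g \<in> carrier G \<Longrightarrow> Q \<subseteq> carrier G \<Longrightarrow> card (conj_map G g ` Q) = card Q"
  by (simp add: card_image conj_map_inj)

lemma normalizer_eq:
  assumes "Q \<subseteq> carrier G"
  shows "normalizer G Q = {g \<in> carrier G. conj_map G g ` Q = Q}"
proof -
  have "g <# Q #> inv g = conj_map G g ` Q" for g
    by (auto simp: l_coset_def r_coset_def conj_map_def)
  then show ?thesis unfolding normalizer_def stabilizer_def using assms by auto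
qed

lemma normalizer_subgroup: "subgroup Q G \<Longrightarrow> subgroup (normalizer G Q) G"
  by (rule normalizer_imp_subgroup) (rule subgroup.subset)

lemma subgroup_conj_self:
  assumes "subgroup Q G" "g \<in> Q" shows "conj_map G g ` Q = Q"
proof -
  have sub: "conj_map G h ` Q \<subseteq> Q" if "h \<in> Q" for h
    using assms(1) that by (auto simp: conj_map_def subgroup.m_closed subgroup.m_inv_closed)
  have g: "g \<in> carrier G" using assms subgroup.mem_carrier by fast
  have "Q = conj_map G g ` conj_map G (inv g) ` Q"
    using conj_image_mult[of g "inv g" Q] conj_image_one g subgroup.subset[OF assms(1)] by simp
  also have "\<dots> \<subseteq> conj_map G g ` Q"
    using sub[of "inv g"] assms by (intro image_mono) (simp add: subgroup.m_inv_closed)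
  finally show ?thesis using sub[OF assms(2)] by blast
qed

lemma subgroup_le_normalizer: "subgroup Q G \<Longrightarrow> Q \<subseteq> normalizer G Q"
  using subgroup_conj_self subgroup.subset by (fastforce simp: normalizer_eq)

abbreviation adjoin :: "'a \<Rightarrow> 'a set \<Rightarrow> 'a set" where
  "adjoin s Q \<equiv> generate G (insert s Q)"

lemma generate_of_subgroup: "subgroup Q G \<Longrightarrow> s \<in> Q \<Longrightarrow> adjoin s Q = Q"
  using generate_subgroup_incl[of "insert s Q" Q] generate.incl[of _ "insert s Q" G] by fast

end

context finite_group
begin

lemma conj_subset_imp_eq:
  assumes "subgroup Q G" "g \<in> carrier G" "conj_map G g ` Q \<subseteq> Q"
  shows "conj_map G g ` Q = Q"
  using card_subset_eq[OF finite_subgroup[OF assms(1)] assms(3)]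
    conj_image_card[OF assms(2) subgroup.subset[OF assms(1)]] by simp

lemma subgroup_card_dvd:
  assumes "subgroup H G" "subgroup K G" "H \<subseteq> K"
  shows "card H dvd card K"
proof -
  interpret K: group "G\<lparr>carrier := K\<rparr>" using assms(2) by (rule subgroup_imp_group)
  have "subgroup H (G\<lparr>carrier := K\<rparr>)" using assms by (simp add: subgroup_incl)
  from K.lagrange[OF this] have "card K = card (rcosets\<^bsub>G\<lparr>carrier := K\<rparr>\<^esub> H) * card H"
    by (simp add: order_def)
  then show ?thesis by simp
qed

lemma lcoset_self:
  assumes "subgroup P G" "g \<in> carrier G" "h \<in> carrier G"
  shows "g <# P = h <# P \<longleftrightarrow> inv g \<otimes> h \<in> P"
proof
  assume "g <# P = h <# P"
  then have "h \<in> g <# P" using lcos_self[OF assms(3,1)] by simp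
  then show "inv g \<otimes> h \<in> P" by (rule subgroup.lcos_module_imp[OF assms(1) is_group assms(2)])
next
  assume "inv g \<otimes> h \<in> P"
  then have "h \<in> g <# P" by (rule subgroup.lcos_module_rev[OF assms(1) is_group assms(2,3)])
  then show "g <# P = h <# P" by (rule l_repr_independence[OF _ assms(2,1)])
qed

lemma gset_cosets_action: assumes "subgroup P G" shows "finite_gset G (gset_cosets G P)"
proof (rule finite_gsetI)
  have P: "P \<subseteq> carrier G" by (rule subgroup.subset[OF assms])
  show "finite (fst (gset_cosets G P))"
    using finite_carrier by (simp add: gset_cosets_def LCOSETS_def)
  have "C \<subseteq> carrier G" if "C \<in> lcosets P" for C
    using that P l_coset_subset_G by (auto simp: LCOSETS_def)
  moreover have "g <# C \<in> lcosets P" if "g \<in> carrier G" "C \<in> lcosets P" for g C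
    using that P by (auto simp: LCOSETS_def lcos_m_assoc)
  ultimately show "acts G (gset_cosets G P)"
    unfolding acts_def gset_cosets_def by (simp add: lcos_m_assoc lcos_mult_one)
qed (simp add: gset_cosets_def)

lemma gset_cosets_finite_action: "subgroup P G \<Longrightarrow> finite_action G (gset_cosets G P)"
  by (rule finite_gset_action[OF gset_cosets_action])

text \<open>A coset $gP$ is fixed by $Q$ if and only if $g^{-1}Qg \le P$, and it has $|P|$ representatives.\<close>

lemma gset_mark_cosets:
  assumes P: "subgroup P G" and Q: "Q \<subseteq> carrier G"
  shows "gset_mark Q (gset_cosets G P) * int (card P)
       = int (card {g \<in> carrier G. conj_map G (inv g) ` Q \<subseteq> P})"
proof -
  let ?A = "{g \<in> carrier G. conj_map G (inv g) ` Q \<subseteq> P}"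
  have fixed: "(\<forall>q\<in>Q. q <# (g <# P) = g <# P) \<longleftrightarrow> conj_map G (inv g) ` Q \<subseteq> P" if g: "g \<in> carrier G" for g
  proof -
    have "q <# (g <# P) = g <# P \<longleftrightarrow> conj_map G (inv g) q \<in> P" if q: "q \<in> Q" for q
    proof -
      have "q \<in> carrier G" using q Q by blast
      then have "q <# (g <# P) = (q \<otimes> g) <# P" using g subgroup.subset[OF P] by (simp add: lcos_m_assoc)
      then have "q <# (g <# P) = g <# P \<longleftrightarrow> inv g \<otimes> (q \<otimes> g) \<in> P"
        using lcoset_self[OF P g, of "q \<otimes> g"] g \<open>q \<in> carrier G\<close> by auto
      then show ?thesis using g \<open>q \<in> carrier G\<close> by (simp add: conj_map_def m_assoc)
    qed
    then show ?thesis by blast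
  qed
  have im: "(\<lambda>g. g <# P) ` ?A = gset_fix Q (gset_cosets G P)"
  proof -
    have "gset_fix Q (gset_cosets G P) = {C \<in> (\<lambda>g. g <# P) ` carrier G. \<forall>q\<in>Q. q <# C = C}"
      by (auto simp: gset_fix_def gset_cosets_def LCOSETS_def)
    also have "\<dots> = (\<lambda>g. g <# P) ` {g \<in> carrier G. \<forall>q\<in>Q. q <# (g <# P) = g <# P}" by blast
    also have "{g \<in> carrier G. \<forall>q\<in>Q. q <# (g <# P) = g <# P} = ?A" using fixed by blast
    finally show ?thesis by simp
  qed
  have "card ?A = card ((\<lambda>g. g <# P) ` ?A) * card P"
  proof (rule card_fibres)
    fix C assume "C \<in> (\<lambda>g. g <# P) ` ?A"
    then obtain g where g: "g \<in> ?A" "C = g <# P" by blast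
    have "{h \<in> ?A. h <# P = C} = C"
    proof (intro equalityI subsetI)
      fix h assume "h \<in> {h \<in> ?A. h <# P = C}"
      then show "h \<in> C" using lcos_self[OF _ P] by auto
    next
      fix h assume h: "h \<in> C"
      then have hc: "h \<in> carrier G" using g l_coset_subset_G[OF subgroup.subset[OF P]] by blast
      obtain u where "u \<in> P" "h = g \<otimes> u" using h g by (auto simp: l_coset_def)
      then have "inv g \<otimes> h \<in> P" using g subgroup.mem_carrier[OF P] by (simp add: m_assoc[symmetric])
      then have "h <# P = C" using lcoset_self[OF P _ hc, of g] g by auto
      moreover have "conj_map G (inv h) ` Q \<subseteq> P"
        using fixed[OF hc] fixed[of g] g \<open>h <# P = C\<close> by auto
      ultimately show "h \<in> {h \<in> ?A. h <# P = C}" using hc by simp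
    qed
    then show "card {h \<in> ?A. h <# P = C} = card P"
    proof -
      have "C = (\<lambda>u. g \<otimes> u) ` P" using g by (auto simp: l_coset_def)
      moreover have "inj_on (\<lambda>u. g \<otimes> u) P"
        using g subgroup.mem_carrier[OF P] by (auto intro!: inj_onI)
      ultimately show ?thesis using \<open>{h \<in> ?A. h <# P = C} = C\<close> by (simp add: card_image)
    qed
  qed (simp add: finite_carrier)
  then show ?thesis unfolding im gset_mark_def by simp
qed

lemma gset_mark_cosets_self:
  assumes "subgroup Q G"
  shows "gset_mark Q (gset_cosets G Q) * int (card Q) = int (card (normalizer G Q))"
proof -
  have Q: "Q \<subseteq> carrier G" by (rule subgroup.subset[OF assms])
  have "{g \<in> carrier G. conj_map G (inv g) ` Q \<subseteq> Q} = normalizer G Q" (is "?A = _")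
  proof -
    have "conj_map G (inv g) ` Q = Q \<longleftrightarrow> conj_map G g ` Q = Q" if "g \<in> carrier G" for g
    proof -
      have "conj_map G g ` conj_map G (inv g) ` Q = Q" "conj_map G (inv g) ` conj_map G g ` Q = Q"
        using conj_image_mult[of g "inv g" Q] conj_image_mult[of "inv g" g Q] conj_image_one[OF Q] that Q
        by simp_all
      then show ?thesis by auto
    qed
    moreover have "conj_map G (inv g) ` Q \<subseteq> Q \<longleftrightarrow> conj_map G (inv g) ` Q = Q" if "g \<in> carrier G" for g
      using conj_subset_imp_eq[OF assms, of "inv g"] that by blast
    ultimately show ?thesis unfolding normalizer_eq[OF Q] by blast
  qed
  then show ?thesis using gset_mark_cosets[OF assms Q] by simp
qed

lemma gset_mark_cosets_nonzero:
  assumes "subgroup P G" "Q \<subseteq> carrier G" "gset_mark Q (gset_cosets G P) \<noteq> 0"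
  shows "\<exists>g\<in>carrier G. conj_map G g ` Q \<subseteq> P"
proof -
  have "int (card {g \<in> carrier G. conj_map G (inv g) ` Q \<subseteq> P}) \<noteq> 0"
    unfolding gset_mark_cosets[OF assms(1,2), symmetric]
    using assms(3) subgroup_card_pos[OF assms(1)] by simp
  then have "{g \<in> carrier G. conj_map G (inv g) ` Q \<subseteq> P} \<noteq> {}" by force
  then obtain g where "g \<in> carrier G" "conj_map G (inv g) ` Q \<subseteq> P" by blast
  then show ?thesis by (intro bexI[of _ "inv g"]) auto
qed

lemma gset_mark_conj:
  assumes X: "finite_action G X" and g: "g \<in> carrier G" and Q: "Q \<subseteq> carrier G"
  shows "gset_mark (conj_map G g ` Q) X = gset_mark Q X"
proof -
  have a: "acts G X" using X by (simp add: finite_action_def)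
  have "bij_betw (snd X g) (gset_fix Q X) (gset_fix (conj_map G g ` Q) X)"
  proof (rule bij_betwI[where g = "snd X (inv g)"])
    have [simp]: "conj_map G g q \<in> carrier G" "q \<in> carrier G" if "q \<in> Q" for q
      using that Q g conj_map_closed by auto
    have 1: "snd X (conj_map G g q) (snd X g x) = snd X g (snd X q x)" if "q \<in> Q" "x \<in> fst X" for q x
    proof -
      have "conj_map G g q \<otimes> g = g \<otimes> q" using that Q g by (auto simp: conj_map_def m_assoc)
      then have "snd X (conj_map G g q \<otimes> g) x = snd X (g \<otimes> q) x" by simp
      then show ?thesis using that g by (simp add: acts_mult[OF a])
    qed
    show "snd X g \<in> gset_fix Q X \<rightarrow> gset_fix (conj_map G g ` Q) X"
      using 1 g by (auto simp: gset_fix_def acts_closed[OF a])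
    have 2: "snd X q (snd X (inv g) y) = snd X (inv g) (snd X (conj_map G g q) y)" if "q \<in> Q" "y \<in> fst X" for q y
      using 1[OF that(1), of "snd X (inv g) y"] that g
      by (simp add: acts_closed[OF a] acts_inv[OF a])
    show "snd X (inv g) \<in> gset_fix (conj_map G g ` Q) X \<rightarrow> gset_fix Q X"
      using 2 g by (auto simp: gset_fix_def acts_closed[OF a])
  qed (use g in \<open>auto simp: gset_fix_def acts_inv[OF a]\<close>)
  then show ?thesis unfolding gset_mark_def using bij_betw_same_card by fastforce
qed

lemma gset_mark_generate:
  assumes X: "acts G X" and A: "A \<subseteq> carrier G"
  shows "gset_mark (generate G A) X = gset_mark A X"
proof -
  have "snd X g x = x" if "g \<in> generate G A" "x \<in> fst X" "\<forall>q\<in>A. snd X q x = x" for g x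
    using that
  proof (induction rule: generate.induct)
    case one then show ?case using X by (simp add: acts_one)
  next
    case (incl h) then show ?case by simp
  next
    case (inv h) then show ?case using A X acts_inv(1)[OF X, of h x] by auto
  next
    case (eng h1 h2)
    then show ?case using acts_mult[OF X] generate_in_carrier[OF A] by simp
  qed
  then have "gset_fix (generate G A) X = gset_fix A X"
    unfolding gset_fix_def using generate.incl by fast
  then show ?thesis by (simp add: gset_mark_def)
qed

text \<open>The number of orbits of \<open>H\<close> on the \<open>Q\<close>-fixed points is the average of the numbers of points fixed
  by the elements of \<open>H\<close>.\<close>

lemma gset_mark_congruence:
  assumes X: "finite_action G X" and Q: "subgroup Q G" and H: "subgroup H G"
    and QH: "H \<subseteq> normalizer G Q"
  shows "int (card H) dvd (\<Sum>s\<in>H. gset_mark (adjoin s Q) X)"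
proof -
  have a: "acts G X" and f: "finite (fst X)" using X by (auto simp: finite_action_def)
  have Qc: "Q \<subseteq> carrier G" and Hc: "H \<subseteq> carrier G" using Q H subgroup.subset by auto
  let ?H = "G\<lparr>carrier := H\<rparr>"
  let ?Y = "(gset_fix Q X, snd X)"
  interpret H: group ?H using H by (rule subgroup_imp_group)
  have stab: "snd X h x \<in> gset_fix Q X" if "h \<in> H" "x \<in> gset_fix Q X" for h x
  proof -
    have h: "h \<in> carrier G" "conj_map G h ` Q = Q" using that QH by (auto simp: normalizer_eq Qc)
    have "snd X q (snd X h x) = snd X h x" if "q \<in> Q" for q
    proof -
      obtain r where r: "r \<in> Q" "q = conj_map G h r" using h \<open>q \<in> Q\<close> by blast
      have rc: "r \<in> carrier G" "q \<in> carrier G" using r \<open>q \<in> Q\<close> Qc by auto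
      have "q \<otimes> h = h \<otimes> r" unfolding r(2) using h rc(1) by (simp add: conj_map_def m_assoc)
      then have "snd X q (snd X h x) = snd X h (snd X r x)"
        using acts_mult[OF a, of q h x] acts_mult[OF a, of h r x] \<open>x \<in> gset_fix Q X\<close> h rc
        by (simp add: gset_fix_def)
      then show ?thesis using r \<open>x \<in> gset_fix Q X\<close> by (simp add: gset_fix_def)
    qed
    then show ?thesis using acts_closed[OF a] h \<open>x \<in> gset_fix Q X\<close> by (simp add: gset_fix_def)
  qed
  have "acts ?H ?Y"
    unfolding acts_def using stab Hc a by (auto simp: gset_fix_def acts_one acts_mult subset_eq)
  then interpret ga: group_action ?H "fst ?Y" "\<lambda>g. restrict (snd ?Y g) (fst ?Y)"
    by (rule H.acts_group_action)
  have "card (orbits ?H (fst ?Y) (\<lambda>g. restrict (snd ?Y g) (fst ?Y))) * order ?H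
      = (\<Sum>g\<in>carrier ?H. card (invariants (fst ?Y) (\<lambda>g. restrict (snd ?Y g) (fst ?Y)) g))"
    using f finite_subgroup[OF H] by (intro ga.burnside) (auto simp: gset_fix_def)
  then have "card H dvd (\<Sum>s\<in>H. card (invariants (fst ?Y) (\<lambda>g. restrict (snd ?Y g) (fst ?Y)) s))"
    by (simp add: order_def del: fst_conv snd_conv) (metis dvd_triv_right)
  moreover have "invariants (fst ?Y) (\<lambda>g. restrict (snd ?Y g) (fst ?Y)) s = gset_fix (insert s Q) X" for s
    by (auto simp: invariants_def gset_fix_def)
  moreover have "gset_mark (adjoin s Q) X = int (card (gset_fix (insert s Q) X))" if "s \<in> H" for s
    using gset_mark_generate[OF a, of "insert s Q"] that Hc Qc by (auto simp: gset_mark_def)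
  ultimately show ?thesis by (simp flip: of_nat_sum)
qed

text \<open>A sum over a set of subgroups that is closed under conjugation is a sum over orbits, and an
  orbit and the normalizer of one of its members have orders with product $|G|$.\<close>

lemma conj_closed_sum:
  fixes z :: "'g set \<Rightarrow> rat"
  assumes p: "prime p"
    and sub: "\<And>Q. Q \<in> K \<Longrightarrow> subgroup Q G"
    and closed: "\<And>Q g. Q \<in> K \<Longrightarrow> g \<in> carrier G \<Longrightarrow> conj_map G g ` Q \<in> K"
    and z: "\<And>Q. Q \<in> K \<Longrightarrow> z Q \<in> p_int p"
    and inv: "\<And>Q g. Q \<in> K \<Longrightarrow> g \<in> carrier G \<Longrightarrow> z (conj_map G g ` Q) = z Q"
  shows "(\<Sum>Q\<in>K. of_nat (card (normalizer G Q)) * z Q) / of_nat (order G) \<in> p_int p"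
proof -
  let ?Y = "(K, \<lambda>g Q. conj_map G g ` Q)"
  let ?a = "\<lambda>g. restrict (snd ?Y g) (fst ?Y)"
  have finK: "finite K" by (rule finite_subset[OF _ finite_subgroups]) (use sub in auto)
  have "acts G ?Y"
    unfolding acts_def using closed sub[THEN subgroup.subset] by (auto simp: conj_image_one conj_image_mult)
  then interpret ga: group_action G "fst ?Y" ?a by (rule acts_group_action)
  have st: "stabilizer G ?a Q = normalizer G Q" if "Q \<in> K" for Q
    using that by (auto simp: stabilizer_def normalizer_eq subgroup.subset[OF sub])
  have G: "(of_nat (order G) :: rat) \<noteq> 0"
    using finite_carrier by (simp add: order_def card_eq_0_iff) (use one_closed in auto)
  let ?f = "\<lambda>Q. of_nat (card (normalizer G Q)) * z Q"
  have orb: "(\<Sum>Q\<in>orb. ?f Q) / of_nat (order G) \<in> p_int p" if o: "orb \<in> orbits G (fst ?Y) ?a" for orb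
  proof -
    obtain Q where Q: "Q \<in> K" "orb = orbit G ?a Q" using o by (auto simp: orbits_def)
    have mem: "R \<in> K \<and> z R = z Q" if "R \<in> orb" for R
      using that Q closed inv by (auto simp: orbit_def)
    have "(\<Sum>Q\<in>orb. ?f Q) = (\<Sum>R\<in>orb. of_nat (card (stabilizer G ?a R)) * z Q)"
      using mem st by (intro sum.cong) auto
    also have "\<dots> = of_nat (\<Sum>R\<in>orb. card (stabilizer G ?a R)) * z Q"
      by (simp add: sum_distrib_right)
    also have "\<dots> = of_nat (order G) * z Q" using ga.card_stablizer_sum[OF finite_carrier o] by simp
    finally show ?thesis using G z[OF Q(1)] by simp
  qed
  have "(\<Sum>Q\<in>K. ?f Q) = (\<Sum>orb\<in>orbits G (fst ?Y) ?a. \<Sum>Q\<in>orb. ?f Q)"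
    using ga.disjoint_sum[of ?f] finK by simp
  then show ?thesis
    using orb by (simp add: sum_divide_distrib p_int_sum[OF p])
qed

end

section \<open>The lattice of mark functions\<close>

text \<open>The orbit of a point with stabilizer \<open>P\<close> contributes the marks of $G/P$.\<close>

lemma (in finite_group) gset_mark_decomposition:
  fixes X :: "('g, 'x) gset"
  assumes "finite_action G X"
  shows "\<exists>n :: 'g set \<Rightarrow> int. \<forall>Q. subgroup Q G \<longrightarrow>
    gset_mark Q X = (\<Sum>P | subgroup P G. n P * gset_mark Q (gset_cosets G P))"
  using assms
proof (induction "card (fst X)" arbitrary: X rule: less_induct)
  case less
  then have a: "acts G X" and f: "finite (fst X)" by (auto simp: finite_action_def)
  show ?case
  proof (cases "fst X = {}")
    case True
    then have "gset_mark Q X = 0" for Q by (simp add: gset_mark_def gset_fix_def)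
    then show ?thesis by (intro exI[of _ "\<lambda>_. 0"]) simp
  next
    case False
    then obtain x where x: "x \<in> fst X" by blast
    let ?A = "(\<lambda>g. snd X g x) ` carrier G"
    define P where "P = {g \<in> carrier G. snd X g x = x}"
    have P: "subgroup P G" unfolding P_def by (rule point_stabilizer[OF a x])
    have Pc: "P \<subseteq> carrier G" by (rule subgroup.subset[OF P])
    note sp = orbit_splitting[OF a x f refl]
    let ?C = "gset_cosets G P"
    have memP: "P \<in> fst ?C"
      using lcos_mult_one[OF Pc] by (force simp: gset_cosets_def LCOSETS_def)
    have act: "snd ?C g P = g <# P" for g using memP by (simp add: gset_cosets_def)
    have "gset_iso G (?A, snd X) ((\<lambda>g. snd ?C g P) ` carrier G, snd ?C)"
    proof (rule orbit_iso[OF a x finite_gset_acts[OF gset_cosets_action[OF P]] memP])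
      fix g assume g: "g \<in> carrier G"
      have "snd X g x = x \<longleftrightarrow> g \<in> P" using g by (simp add: P_def)
      also have "\<dots> \<longleftrightarrow> inv g \<otimes> \<one> \<in> P"
        using g subgroup.m_inv_closed[OF P, of g] subgroup.m_inv_closed[OF P, of "inv g"] by auto
      also have "\<dots> \<longleftrightarrow> snd ?C g P = P"
        using lcoset_self[OF P g one_closed] by (simp add: act lcos_mult_one[OF Pc])
      finally show "snd X g x = x \<longleftrightarrow> snd ?C g P = P" .
    qed
    moreover have "((\<lambda>g. snd ?C g P) ` carrier G, snd ?C) = ?C"
      by (auto simp: act prod_eq_iff) (auto simp: gset_cosets_def LCOSETS_def)
    ultimately have iso: "gset_iso G (?A, snd X) ?C" by simp
    have finA: "finite_action G (?A, snd X)"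
      using sp(3) finite_carrier by (simp add: finite_action_def)
    have "card (fst (fst X - ?A, snd X)) < card (fst X)"
      using f x sp(2) by (auto intro!: psubset_card_mono)
    moreover have "finite_action G (fst X - ?A, snd X)"
      using sp(4) f by (simp add: finite_action_def)
    ultimately obtain n :: "'g set \<Rightarrow> int" where n: "\<forall>Q. subgroup Q G \<longrightarrow>
        gset_mark Q (fst X - ?A, snd X) = (\<Sum>P | subgroup P G. n P * gset_mark Q (gset_cosets G P))"
      using less.hyps by blast
    show ?thesis
    proof (intro exI allI impI)
      fix Q assume Q: "subgroup Q G"
      have "gset_mark Q X = gset_mark Q (?A, snd X) + gset_mark Q (fst X - ?A, snd X)"
        using sp(5)[of Q] by (simp add: gset_mark_def)
      also have "gset_mark Q (?A, snd X) = gset_mark Q ?C"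
        using gset_mark_iso[OF iso finA subgroup.subset[OF Q]] .
      also have "gset_mark Q (fst X - ?A, snd X) = (\<Sum>P | subgroup P G. n P * gset_mark Q (gset_cosets G P))"
        using n Q by blast
      also have "gset_mark Q ?C + (\<Sum>P | subgroup P G. n P * gset_mark Q (gset_cosets G P))
        = (\<Sum>R | subgroup R G. (n R + (if R = P then 1 else 0)) * gset_mark Q (gset_cosets G R))"
        using P finite_subgroups
        by (simp add: distrib_right sum.distrib if_distrib[of "\<lambda>x. x * _"] sum.delta cong: if_cong)
      finally show "gset_mark Q X
        = (\<Sum>R | subgroup R G. (n R + (if R = P then 1 else 0)) * gset_mark Q (gset_cosets G R))" .
    qed
  qed
qed

context finite_group_at_prime
begin

text \<open>The image of $A(G)_{(p)}$ under all marks in the ghost ring of \<open>G\<close>. Values at sets that are not subgroups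
  are arbitrary.\<close>

definition mark_lattice :: "('g set \<Rightarrow> rat) set" where
  "mark_lattice = {f. \<exists>x\<in>carrier Ap. \<forall>Q. subgroup Q G \<longrightarrow> f Q = loc_mark Q x}"

definition coset_class :: "'g set \<Rightarrow> 'g burnside loc" where
  "coset_class P = loc_frac p A (burnside_class G (gset_cosets G P)) 1"

lemma coset_class:
  assumes "subgroup P G"
  shows "coset_class P \<in> carrier Ap"
    and "subgroup Q G \<Longrightarrow> loc_mark Q (coset_class P) = of_int (gset_mark Q (gset_cosets G P))"
proof -
  note fin = gset_cosets_finite_action[OF assms] finite_gset_action[OF finite_gset_empty]
  show "coset_class P \<in> carrier Ap"
    unfolding coset_class_def burnside_class_def
    by (intro loc_frac_carrier gset_diff_carrier fin not_dvd_one_p prime_p)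
  show "loc_mark Q (coset_class P) = of_int (gset_mark Q (gset_cosets G P))" if "subgroup Q G"
    unfolding coset_class_def burnside_class_def using that not_dvd_one_p[OF prime_p]
    by (simp add: loc_mark_frac gset_diff_carrier fin burnside_mark_diff)
qed

lemma lattice_cosets:
  "subgroup P G \<Longrightarrow> (\<lambda>Q. of_int (gset_mark Q (gset_cosets G P))) \<in> mark_lattice"
  unfolding mark_lattice_def using coset_class by (auto intro!: bexI[of _ "coset_class P"])

lemma lattice_add: "f \<in> mark_lattice \<Longrightarrow> h \<in> mark_lattice \<Longrightarrow> (\<lambda>Q. f Q + h Q) \<in> mark_lattice"
  unfolding mark_lattice_def by (auto intro: loc_add(1) simp: loc_add(2)[symmetric])

lemma lattice_smult: "r \<in> p_int p \<Longrightarrow> f \<in> mark_lattice \<Longrightarrow> (\<lambda>Q. r * f Q) \<in> mark_lattice"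
  unfolding mark_lattice_def by (auto intro: loc_smult(1) simp: loc_smult(2)[symmetric])

lemma lattice_zero: "(\<lambda>Q. 0) \<in> mark_lattice"
  unfolding mark_lattice_def using loc_zero by (auto intro!: bexI[of _ "\<zero>\<^bsub>Ap\<^esub>"])

lemma latticeE:
  assumes "f \<in> mark_lattice"
  obtains X Y :: "('g, nat) gset" and m where
    "finite_action G X" "finite_action G Y" "\<not> int p dvd m"
    "\<forall>Q. subgroup Q G \<longrightarrow> f Q = of_int (gset_mark Q X - gset_mark Q Y) / of_int m"
proof -
  obtain x where x: "x \<in> carrier Ap" "\<forall>Q. subgroup Q G \<longrightarrow> f Q = loc_mark Q x"
    using assms by (auto simp: mark_lattice_def)
  obtain a m where a: "x = loc_frac p A a m" "a \<in> carrier A" "\<not> int p dvd m"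
    by (rule loc_carrierE[OF x(1)])
  obtain X Y :: "('g, nat) gset" where X: "a = gset_diff G X Y" "finite_action G X" "finite_action G Y"
    by (rule burnside_carrierE[OF a(2)])
  show thesis
    by (rule that[OF X(2,3) a(3)]) (use x a X in \<open>simp add: loc_mark_frac burnside_mark_diff\<close>)
qed

lemma lattice_conj:
  assumes "f \<in> mark_lattice" "subgroup Q G" "g \<in> carrier G"
  shows "f (conj_map G g ` Q) = f Q"
proof -
  obtain X Y :: "('g, nat) gset" and m where X: "finite_action G X" "finite_action G Y"
    and "\<not> int p dvd m"
    and f: "\<forall>Q. subgroup Q G \<longrightarrow> f Q = of_int (gset_mark Q X - gset_mark Q Y) / of_int m"
    by (rule latticeE[OF assms(1)])
  show ?thesis
    using assms(2,3) subgroup.subset[OF assms(2)] X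
    by (simp add: f conj_image_subgroup gset_mark_conj)
qed

lemma lattice_congruence:
  assumes f: "f \<in> mark_lattice" and Q: "subgroup Q G" and H: "subgroup H G" "H \<subseteq> normalizer G Q"
  shows "(\<Sum>s\<in>H. f (adjoin s Q)) / of_nat (card H) \<in> p_int p"
proof -
  obtain X Y :: "('g, nat) gset" and m where X: "finite_action G X" "finite_action G Y"
    and m: "\<not> int p dvd m"
    and f: "\<forall>Q. subgroup Q G \<longrightarrow> f Q = of_int (gset_mark Q X - gset_mark Q Y) / of_int m"
    by (rule latticeE[OF f])
  let ?gen = "\<lambda>s. adjoin s Q"
  have gen: "subgroup (?gen s) G" if "s \<in> H" for s
    using that subgroup.subset[OF Q] subgroup.subset[OF H(1)] by (intro generate_is_subgroup) auto
  have "int (card H) dvd (\<Sum>s\<in>H. gset_mark (?gen s) X) - (\<Sum>s\<in>H. gset_mark (?gen s) Y)"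
    by (intro dvd_diff gset_mark_congruence X Q H)
  then obtain k where k: "(\<Sum>s\<in>H. gset_mark (?gen s) X - gset_mark (?gen s) Y) = int (card H) * k"
    by (auto simp: sum_subtractf dvd_def)
  have "(\<Sum>s\<in>H. f (?gen s)) = (\<Sum>s\<in>H. of_int (gset_mark (?gen s) X - gset_mark (?gen s) Y) / of_int m)"
    by (intro sum.cong) (auto simp: f gen)
  also have "\<dots> = of_int (\<Sum>s\<in>H. gset_mark (?gen s) X - gset_mark (?gen s) Y) / of_int m"
    by (simp add: sum_divide_distrib)
  also have "\<dots> = of_nat (card H) * (of_int k / of_int m)" unfolding k by simp
  finally show ?thesis
    using subgroup_card_pos[OF H(1)] p_int_fraction[OF m, of k] by simp
qed

lemma lattice_decomposition:
  assumes "f \<in> mark_lattice"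
  shows "\<exists>c. (\<forall>P. c P \<in> p_int p) \<and> (\<forall>Q. subgroup Q G \<longrightarrow>
    f Q = (\<Sum>P | subgroup P G. c P * of_int (gset_mark Q (gset_cosets G P))))"
proof -
  obtain X Y :: "('g, nat) gset" and m where X: "finite_action G X" "finite_action G Y"
    and m: "\<not> int p dvd m"
    and f: "\<forall>Q. subgroup Q G \<longrightarrow> f Q = of_int (gset_mark Q X - gset_mark Q Y) / of_int m"
    by (rule latticeE[OF assms])
  obtain n k :: "'g set \<Rightarrow> int" where
    n: "\<And>Q. subgroup Q G \<Longrightarrow> gset_mark Q X = (\<Sum>P | subgroup P G. n P * gset_mark Q (gset_cosets G P))" and
    k: "\<And>Q. subgroup Q G \<Longrightarrow> gset_mark Q Y = (\<Sum>P | subgroup P G. k P * gset_mark Q (gset_cosets G P))"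
    using gset_mark_decomposition[OF X(1)] gset_mark_decomposition[OF X(2)] by blast
  show ?thesis
  proof (intro exI conjI allI impI)
    show "of_int (n P - k P) / of_int m \<in> p_int p" for P by (rule p_int_fraction[OF m])
    fix Q assume Q: "subgroup Q G"
    have "gset_mark Q X - gset_mark Q Y = (\<Sum>P | subgroup P G. (n P - k P) * gset_mark Q (gset_cosets G P))"
      by (simp add: n[OF Q] k[OF Q] sum_subtractf left_diff_distrib)
    then show "f Q = (\<Sum>P | subgroup P G. of_int (n P - k P) / of_int m * of_int (gset_mark Q (gset_cosets G P)))"
      by (simp add: f Q sum_divide_distrib)
  qed
qed

text \<open>A function is corrected at one conjugacy class of subgroups after another, from large to
  small: a multiple of the marks of $G/Q$ changes the values at the conjugates of $Q$ and at smaller subgroups only.\<close>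

lemma lattice_correction_step:
  assumes conj: "\<And>Q g. subgroup Q G \<Longrightarrow> g \<in> carrier G \<Longrightarrow> f (conj_map G g ` Q) = f Q"
    and step: "\<And>Q h. subgroup Q G \<Longrightarrow> card Q = k \<Longrightarrow> h \<in> mark_lattice \<Longrightarrow>
      (\<And>R. subgroup R G \<Longrightarrow> card R > k \<Longrightarrow> h R = f R) \<Longrightarrow>
      (f Q - h Q) * of_nat (card Q) / of_nat (card (normalizer G Q)) \<in> p_int p"
    and h: "h \<in> mark_lattice" "\<And>R. subgroup R G \<Longrightarrow> card R > k \<Longrightarrow> h R = f R"
  shows "\<exists>h'\<in>mark_lattice. \<forall>R. subgroup R G \<longrightarrow> card R \<ge> k \<longrightarrow> h' R = f R"
  using h
proof (induction "card {R. subgroup R G \<and> card R = k \<and> h R \<noteq> f R}" arbitrary: h rule: less_induct)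
  case less
  let ?bad = "\<lambda>h. {R. subgroup R G \<and> card R = k \<and> h R \<noteq> f R}"
  show ?case
  proof (cases "?bad h = {}")
    case True
    then show ?thesis using less.prems by (intro bexI[of _ h]) (auto simp: le_less)
  next
    case False
    then obtain Q where Q: "subgroup Q G" "card Q = k" "h Q \<noteq> f Q" by blast
    define d where "d = (f Q - h Q) * of_nat (card Q) / of_nat (card (normalizer G Q))"
    define h' where "h' R = h R + d * of_int (gset_mark R (gset_cosets G Q))" for R
    have dp: "d \<in> p_int p" unfolding d_def using step[OF Q(1,2) less.prems] by blast
    have L': "h' \<in> mark_lattice"
      unfolding h'_def by (intro lattice_add lattice_smult lattice_cosets dp Q less.prems)
    have pos: "card Q > 0" "card (normalizer G Q) > 0"
      using Q by (auto intro!: subgroup_card_pos normalizer_subgroup)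
    have "(of_int (gset_mark Q (gset_cosets G Q)) :: rat) * of_nat (card Q) = of_nat (card (normalizer G Q))"
      using gset_mark_cosets_self[OF Q(1)] by (metis of_int_mult of_int_of_nat_eq)
    then have good: "h' Q = f Q" unfolding h'_def d_def using pos by (simp add: field_simps)
    have cases: "h' R = h R \<or> h' R = f R" if R: "subgroup R G" "card R \<ge> k" for R
    proof (cases "gset_mark R (gset_cosets G Q) = 0")
      case False
      have Rc: "R \<subseteq> carrier G" by (rule subgroup.subset[OF R(1)])
      obtain g where g: "g \<in> carrier G" "conj_map G g ` R \<subseteq> Q"
        using gset_mark_cosets_nonzero[OF Q(1) Rc False] by blast
      have "conj_map G g ` R = Q"
        using g R Q conj_image_card[OF g(1) Rc] finite_subgroup[OF Q(1)] by (intro card_seteq) auto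
      then have "h' R = f R"
        using good lattice_conj[OF L' R(1) g(1)] conj[OF R(1) g(1)] by simp
      then show ?thesis ..
    qed (simp add: h'_def)
    have "?bad h' \<subseteq> ?bad h"
    proof
      fix R assume "R \<in> ?bad h'"
      then show "R \<in> ?bad h" using cases[of R] by auto
    qed
    then have "?bad h' \<subset> ?bad h" using Q good by auto
    moreover have "finite (?bad h)" by (rule finite_subset[OF _ finite_subgroups]) auto
    ultimately have "card (?bad h') < card (?bad h)" by (simp add: psubset_card_mono)
    moreover have "h' R = f R" if "subgroup R G" "card R > k" for R
      using cases[OF that(1)] less.prems(2)[OF that] that(2) by auto
    ultimately show ?thesis using less.hyps L' by blast
  qed
qed

text \<open>The congruence for \<open>Q\<close> is only required against those mark functions that already agree with \<open>f\<close>
  above the order of \<open>Q\<close>, which is what a recursion from large subgroups to small ones supplies.\<close>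

lemma lattice_criterion:
  assumes conj: "\<And>Q g. subgroup Q G \<Longrightarrow> g \<in> carrier G \<Longrightarrow> f (conj_map G g ` Q) = f Q"
    and step: "\<And>Q h. subgroup Q G \<Longrightarrow> h \<in> mark_lattice \<Longrightarrow>
      (\<And>R. subgroup R G \<Longrightarrow> card R > card Q \<Longrightarrow> h R = f R) \<Longrightarrow>
      (f Q - h Q) * of_nat (card Q) / of_nat (card (normalizer G Q)) \<in> p_int p"
  shows "f \<in> mark_lattice"
proof -
  have "\<exists>h\<in>mark_lattice. \<forall>R. subgroup R G \<longrightarrow> card R + n > card (carrier G) \<longrightarrow> h R = f R" for n
  proof (induction n)
    case 0
    have "card R \<le> card (carrier G)" if "subgroup R G" for R
      using that finite_carrier by (intro card_mono subgroup.subset)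
    then show ?case using lattice_zero by (auto simp: not_less[symmetric])
  next
    case (Suc n)
    then obtain h where h: "h \<in> mark_lattice"
      "\<And>R. subgroup R G \<Longrightarrow> card R > card (carrier G) - n \<Longrightarrow> h R = f R"
      by fastforce
    have "\<exists>h'\<in>mark_lattice. \<forall>R. subgroup R G \<longrightarrow> card R \<ge> card (carrier G) - n \<longrightarrow> h' R = f R"
    proof (rule lattice_correction_step[where f = f, OF conj _ h])
      fix Q h
      assume Q: "subgroup Q G" "card Q = card (carrier G) - n" and "h \<in> mark_lattice"
        and "\<And>R. subgroup R G \<Longrightarrow> card R > card (carrier G) - n \<Longrightarrow> h R = f R"
      then show "(f Q - h Q) * of_nat (card Q) / of_nat (card (normalizer G Q)) \<in> p_int p"
        by (intro step) simp_all
    qed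
    then obtain h' where h': "h' \<in> mark_lattice"
      "\<And>R. subgroup R G \<Longrightarrow> card R \<ge> card (carrier G) - n \<Longrightarrow> h' R = f R"
      by blast
    have "h' R = f R" if "subgroup R G" "card R + Suc n > card (carrier G)" for R
      by (rule h'(2)[OF that(1)]) (use that(2) in linarith)
    then show ?case using h'(1) by blast
  qed
  then obtain h where h: "h \<in> mark_lattice"
    "\<And>R. subgroup R G \<Longrightarrow> card R + card (carrier G) > card (carrier G) \<Longrightarrow> h R = f R"
    by blast
  then have "h R = f R" if "subgroup R G" for R using that subgroup_card_pos by auto
  then show ?thesis using h(1) unfolding mark_lattice_def by auto
qed

end

section \<open>Fixed points of $p$-groups\<close>

text \<open>The length of every orbit is a power of \<open>p\<close>, and an orbit of length 1 would be a fixed point.\<close>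

lemma (in group) p_group_without_fixed_points:
  assumes X: "finite_action G X" and ord: "card (carrier G) = p ^ k" and p: "prime p"
    and nofix: "gset_fix (carrier G) X = {}"
  shows "p dvd card (fst X)"
proof -
  let ?a = "\<lambda>g. restrict (snd X g) (fst X)"
  have act: "acts G X" and fin: "finite (fst X)" using X by (auto simp: finite_action_def)
  interpret ga: group_action G "fst X" ?a by (rule acts_group_action[OF act])
  have "p dvd card orb" if orb: "orb \<in> orbits G (fst X) ?a" for orb
  proof -
    obtain x where x: "x \<in> fst X" "orb = orbit G ?a x" using orb by (auto simp: orbits_def)
    have "card orb * card (stabilizer G ?a x) = p ^ k"
      using ga.orbit_stabilizer_theorem[OF x(1)] x(2) ord by (simp add: order_def)
    then have "card orb dvd p ^ k" by (metis dvd_triv_left)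
    then obtain i where i: "card orb = p ^ i" using divides_primepow_nat[OF p] by blast
    have "i \<noteq> 0"
    proof
      assume "i = 0"
      then obtain y where y: "orb = {y}" using i card_1_singletonE by (metis power_0)
      have "x \<in> orb" using ga.orbit_refl[OF x(1)] x(2) by simp
      then have "snd X g x = x" if "g \<in> carrier G" for g
        using that x y by (force simp: orbit_def)
      then show False using x(1) nofix by (auto simp: gset_fix_def)
    qed
    then show ?thesis using i by simp
  qed
  then have "p dvd (\<Sum>orb\<in>orbits G (fst X) ?a. \<Sum>x\<in>orb. 1)"
    by (intro dvd_sum[where A = "orbits G (fst X) ?a"]) simp
  also have "(\<Sum>orb\<in>orbits G (fst X) ?a. \<Sum>x\<in>orb. 1) = card (fst X)"
    using ga.disjoint_sum[OF fin, of "\<lambda>_. 1 :: nat"] by simp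
  finally show ?thesis .
qed

lemma (in group) p_group_fixed_points:
  assumes X: "finite_action G X" and ord: "card (carrier G) = p ^ k" and p: "prime p"
  shows "int p dvd int (card (fst X)) - gset_mark (carrier G) X"
proof -
  let ?F = "gset_fix (carrier G) X"
  have act: "acts G X" and fin: "finite (fst X)" using X by (auto simp: finite_action_def)
  have sub: "?F \<subseteq> fst X" by (auto simp: gset_fix_def)
  have cl: "snd X g x \<in> fst X - ?F" if "g \<in> carrier G" "x \<in> fst X - ?F" for g x
  proof -
    have "snd X g x \<notin> ?F"
    proof
      assume "snd X g x \<in> ?F"
      then have "snd X (inv g) (snd X g x) = snd X g x" using that(1) by (auto simp: gset_fix_def)
      then have "snd X g x = x" using that acts_inv(1)[OF act, of g x] by auto
      then show False using \<open>snd X g x \<in> ?F\<close> that(2) by simp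
    qed
    then show ?thesis using that by (simp add: acts_closed[OF act])
  qed
  have "finite_action G (fst X - ?F, snd X)"
    using fin act cl unfolding finite_action_def acts_def by auto
  moreover have "gset_fix (carrier G) (fst X - ?F, snd X) = {}" by (auto simp: gset_fix_def)
  ultimately have "p dvd card (fst X - ?F)"
    using p_group_without_fixed_points[OF _ ord p] by force
  moreover have "int (card (fst X - ?F)) = int (card (fst X)) - gset_mark (carrier G) X"
    using card_Diff_subset[OF finite_subset[OF sub fin] sub] card_mono[OF fin sub]
    by (simp add: gset_mark_def of_nat_diff)
  ultimately show ?thesis by (metis int_dvd_int_iff)
qed

lemma (in finite_group) card_cosets:
  assumes "subgroup P G" shows "card (fst (gset_cosets G P)) * card P = order G"
proof -
  have "gset_fix {\<one>} (gset_cosets G P) = fst (gset_cosets G P)"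
    using acts_one[OF finite_gset_acts[OF gset_cosets_action[OF assms]]] by (auto simp: gset_fix_def)
  moreover have "{g \<in> carrier G. conj_map G (inv g) ` {\<one>} \<subseteq> P} = carrier G"
    using subgroup.one_closed[OF assms] by (auto simp: conj_map_def)
  ultimately have "int (card (fst (gset_cosets G P)) * card P) = int (order G)"
    using gset_mark_cosets[OF assms, of "{\<one>}"] by (simp add: gset_mark_def order_def)
  then show ?thesis by (simp only: of_nat_eq_iff)
qed

text \<open>The number of cosets of \<open>Q\<close> that \<open>Q\<close> fixes is $|N_G(Q) : Q|$. Modulo \<open>p\<close> it is the number of all cosets,
  and so it is divisible by \<open>p\<close>.\<close>

lemma (in finite_group) p_group_normalizer_grows:
  assumes p: "prime p" and ord: "order G = p ^ n" and Q: "subgroup Q G" "Q \<noteq> carrier G"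
  shows "card Q < card (normalizer G Q)"
proof -
  let ?X = "gset_cosets G Q" and ?Q = "G\<lparr>carrier := Q\<rparr>"
  interpret Q: group ?Q using Q(1) by (rule subgroup_imp_group)
  have Qc: "Q \<subseteq> carrier G" by (rule subgroup.subset[OF Q(1)])
  have idx: "card (fst ?X) * card Q = p ^ n" using card_cosets[OF Q(1)] ord by simp
  then obtain k i where k: "card Q = p ^ k" and i: "card (fst ?X) = p ^ i"
    using divides_primepow_nat[OF p] by (metis dvd_triv_left dvd_triv_right)
  have "card Q < order G" using Q(2) Qc finite_carrier unfolding order_def by (auto intro: psubset_card_mono)
  then have "i \<noteq> 0" using idx i ord by (auto intro!: Nat.gr0I)
  then have "int p dvd int (card (fst ?X))" using i by simp
  moreover have "finite_action ?Q ?X"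
    using gset_cosets_finite_action[OF Q(1)] Qc by (auto simp: finite_action_def acts_def subset_eq)
  from Q.p_group_fixed_points[OF this _ p, of k]
  have "int p dvd int (card (fst ?X)) - gset_mark Q ?X" using k by simp
  ultimately have pm: "int p dvd gset_mark Q ?X" by (metis dvd_diff_right_iff dvd_diff_commute)
  have "gset_mark Q ?X * int (card Q) = int (card (normalizer G Q))" by (rule gset_mark_cosets_self[OF Q(1)])
  moreover have "card (normalizer G Q) > 0" by (intro subgroup_card_pos normalizer_subgroup Q)
  ultimately have "gset_mark Q ?X \<noteq> 0" by auto
  moreover have "gset_mark Q ?X \<ge> 0" by (simp add: gset_mark_def)
  ultimately have "gset_mark Q ?X \<ge> int p" using pm by (simp add: zdvd_imp_le)
  then have "gset_mark Q ?X \<ge> 2" using prime_ge_2_nat[OF p] by linarith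
  then have "2 * int (card Q) \<le> int (card (normalizer G Q))"
    using \<open>gset_mark Q ?X * int (card Q) = _\<close> by (metis mult_right_mono of_nat_0_le_iff)
  then show ?thesis using subgroup_card_pos[OF Q(1)] by linarith
qed


section \<open>Fusion systems\<close>

context fusion_system
begin

sublocale finite_group_at_prime S p
  by unfold_locales (use p_group prime_p in auto)

lemma morphismD:
  assumes "subgroup P S" "subgroup Q S" "\<phi> \<in> F P Q"
  shows "\<phi> \<in> extensional P" "\<phi> \<in> hom (S\<lparr>carrier := P\<rparr>) (S\<lparr>carrier := Q\<rparr>)" "inj_on \<phi> P" "\<phi> ` P \<subseteq> Q"
  using morphism[OF assms] by (auto simp: hom_def)

lemma morphism_mult:
  assumes "subgroup P S" "subgroup Q S" "\<phi> \<in> F P Q" "x \<in> P" "y \<in> P"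
  shows "\<phi> (x \<otimes> y) = \<phi> x \<otimes> \<phi> y"
  using morphismD(2)[OF assms(1-3)] assms(4,5) by (simp add: hom_def)

lemma morphism_group_hom:
  assumes "subgroup P S" "subgroup Q S" "\<phi> \<in> F P Q"
  shows "group_hom (S\<lparr>carrier := P\<rparr>) S \<phi>"
proof -
  have "\<phi> \<in> hom (S\<lparr>carrier := P\<rparr>) S"
    using morphismD(2)[OF assms] subgroup.subset[OF assms(2)] by (auto simp: hom_def)
  then show ?thesis
    by (simp add: group_hom_def group_hom_axioms_def subgroup_imp_group[OF assms(1)] is_group)
qed

lemma morphism_inv:
  assumes "subgroup P S" "subgroup Q S" "\<phi> \<in> F P Q" "x \<in> P"
  shows "\<phi> (inv x) = inv (\<phi> x)"
  using group_hom.hom_inv[OF morphism_group_hom[OF assms(1-3)], of x] assms(1,4)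
  by (simp add: m_inv_consistent)

lemma morphism_image_subgroup:
  assumes "subgroup P S" "subgroup Q S" "\<phi> \<in> F P Q" "subgroup R S" "R \<subseteq> P"
  shows "subgroup (\<phi> ` R) S"
  by (rule group_hom.subgroup_img_is_subgroup[OF morphism_group_hom[OF assms(1-3)]])
    (rule subgroup_incl[OF assms(4,1,5)])

lemma morphism_conj:
  assumes "subgroup P S" "subgroup Q S" "\<phi> \<in> F P Q" "x \<in> P" "u \<in> P"
  shows "\<phi> (conj_map S x u) = conj_map S (\<phi> x) (\<phi> u)"
  unfolding conj_map_def using assms
  by (simp add: morphism_mult[OF assms(1-3)] morphism_inv[OF assms(1-3)]
      subgroup.m_closed subgroup.m_inv_closed)

lemma inclusion: 
  assumes "subgroup P S" "subgroup Q S" "P \<subseteq> Q" shows "(\<lambda>x\<in>P. x) \<in> F P Q"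
proof -
  have "conj_map S \<one> ` P = P" by (rule conj_image_one[OF subgroup.subset[OF assms(1)]])
  then have "restrict (conj_map S \<one>) P \<in> F P Q" using assms by (intro conj) auto
  moreover have "restrict (conj_map S \<one>) P = (\<lambda>x\<in>P. x)"
    using subgroup.mem_carrier[OF assms(1)] by (auto simp: conj_map_one)
  ultimately show ?thesis by simp
qed

lemma morphism_restrict:
  assumes "subgroup P S" "subgroup Q S" "\<phi> \<in> F P Q" "subgroup R S" "R \<subseteq> P"
  shows "restrict \<phi> R \<in> F R Q"
proof -
  have "compose R \<phi> (\<lambda>x\<in>R. x) \<in> F R Q"
    by (rule comp[OF assms(4,1,2) inclusion[OF assms(4,1,5)] assms(3)])
  moreover have "compose R \<phi> (\<lambda>x\<in>R. x) = restrict \<phi> R" by (auto simp: compose_def)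
  ultimately show ?thesis by simp
qed

lemma morphism_codomain:
  assumes "subgroup P S" "subgroup Q S" "\<phi> \<in> F P Q" "subgroup R S" "\<phi> ` P \<subseteq> R"
  shows "\<phi> \<in> F P R"
proof -
  have im: "subgroup (\<phi> ` P) S" by (rule morphism_image_subgroup[OF assms(1-3,1)]) simp
  have 1: "\<phi> \<in> F P (\<phi> ` P)" using onto_image[OF assms(1-3)] by simp
  have "compose P (\<lambda>x\<in>\<phi> ` P. x) \<phi> \<in> F P R"
    by (rule comp[OF assms(1) im assms(4) 1 inclusion[OF im assms(4,5)]])
  moreover have "compose P (\<lambda>x\<in>\<phi> ` P. x) \<phi> = \<phi>"
    using morphismD(1)[OF assms(1-3)] by (auto simp: compose_def fun_eq_iff extensional_def)
  ultimately show ?thesis by simp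
qed

lemma carrier_subgroup: "subgroup (carrier S) S"
  by (rule subgroup_self)

lemma morphism_card:
  assumes "subgroup P S" "subgroup Q S" "\<phi> \<in> F P Q" "R \<subseteq> P" shows "card (\<phi> ` R) = card R"
  using morphismD(3)[OF assms(1-3)] assms(4) by (meson card_image inj_on_subset)

lemma morphism_inverse:
  assumes "subgroup P S" "subgroup Q S" "\<phi> \<in> F P Q"
  obtains \<psi> where "\<psi> \<in> F (\<phi> ` P) P" "\<forall>x\<in>P. \<psi> (\<phi> x) = x" "\<psi> ` \<phi> ` P = P"
proof -
  let ?\<psi> = "restrict (inv_into P \<phi>) (\<phi> ` P)"
  have "?\<psi> (\<phi> x) = x" if "x \<in> P" for x using that morphismD(3)[OF assms] by simp
  moreover from this have "?\<psi> ` \<phi> ` P = P" by (auto simp: image_image)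
  ultimately show thesis using that onto_image[OF assms] by blast
qed

lemma F_conj_iff:
  "F_conj S F P Q \<longleftrightarrow> subgroup P S \<and> subgroup Q S \<and> (\<exists>\<phi>\<in>F P (carrier S). \<phi> ` P = Q)"
proof (intro iffI conjI)
  assume c: "F_conj S F P Q"
  then show P: "subgroup P S" and Q: "subgroup Q S" by (auto simp: F_conj_def)
  obtain \<phi> \<psi> where \<phi>: "\<phi> \<in> F P Q" and \<psi>: "\<psi> \<in> F Q P" and id: "compose Q \<phi> \<psi> = (\<lambda>x\<in>Q. x)"
    using c by (auto simp: F_conj_def)
  have "y \<in> \<phi> ` P" if "y \<in> Q" for y
  proof -
    have "\<phi> (\<psi> y) = y" using fun_cong[OF id, of y] that by (simp add: compose_def)
    moreover have "\<psi> y \<in> P" using morphismD(4)[OF Q P \<psi>] that by blast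
    ultimately show ?thesis by (metis imageI)
  qed
  then have "\<phi> ` P = Q" using morphismD(4)[OF P Q \<phi>] by blast
  moreover have "\<phi> \<in> F P (carrier S)"
    by (rule morphism_codomain[OF P Q \<phi> carrier_subgroup])
      (use \<open>\<phi> ` P = Q\<close> subgroup.subset[OF Q] in auto)
  ultimately show "\<exists>\<phi>\<in>F P (carrier S). \<phi> ` P = Q" by blast
next
  assume "subgroup P S \<and> subgroup Q S \<and> (\<exists>\<phi>\<in>F P (carrier S). \<phi> ` P = Q)"
  then obtain \<phi> where P: "subgroup P S" and Q: "subgroup Q S" and \<phi>: "\<phi> \<in> F P (carrier S)" "\<phi> ` P = Q"
    by blast
  obtain \<psi> where \<psi>: "\<psi> \<in> F (\<phi> ` P) P" "\<forall>x\<in>P. \<psi> (\<phi> x) = x" "\<psi> ` \<phi> ` P = P"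
    by (rule morphism_inverse[OF P carrier_subgroup \<phi>(1)])
  have "\<phi> \<in> F P Q" using onto_image[OF P carrier_subgroup \<phi>(1)] \<phi>(2) by simp
  moreover have "compose P \<psi> \<phi> = (\<lambda>x\<in>P. x)" using \<psi>(2) by (auto simp: compose_def)
  moreover have "compose Q \<phi> \<psi> = (\<lambda>x\<in>Q. x)"
    using \<psi>(2) \<phi>(2) by (auto simp: compose_def fun_eq_iff)
  ultimately show "F_conj S F P Q" using \<psi>(1) \<phi>(2) P Q unfolding F_conj_def by blast
qed

lemma F_conj_subgroups: "F_conj S F P Q \<Longrightarrow> subgroup P S \<and> subgroup Q S"
  by (simp add: F_conj_def)

lemma F_conjI: "subgroup P S \<Longrightarrow> \<phi> \<in> F P (carrier S) \<Longrightarrow> F_conj S F P (\<phi> ` P)"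
  unfolding F_conj_iff using morphism_image_subgroup[OF _ carrier_subgroup] by blast

lemma F_conj_refl: "subgroup P S \<Longrightarrow> F_conj S F P P"
  using F_conjI[OF _ inclusion[OF _ carrier_subgroup]] subgroup.subset by fastforce

lemma F_conj_sym: "F_conj S F P Q \<Longrightarrow> F_conj S F Q P"
  unfolding F_conj_def by blast

lemma F_conj_trans: 
  assumes "F_conj S F P Q" "F_conj S F Q R" shows "F_conj S F P R"
proof -
  obtain \<phi> where P: "subgroup P S" and Q: "subgroup Q S" and \<phi>: "\<phi> \<in> F P (carrier S)" "\<phi> ` P = Q"
    using assms(1) unfolding F_conj_iff by blast
  obtain \<psi> where R: "subgroup R S" and \<psi>: "\<psi> \<in> F Q (carrier S)" "\<psi> ` Q = R"
    using assms(2) unfolding F_conj_iff by blast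
  have "\<phi> \<in> F P Q" using onto_image[OF P carrier_subgroup \<phi>(1)] \<phi>(2) by simp
  then have "compose P \<psi> \<phi> \<in> F P (carrier S)" using comp[OF P Q carrier_subgroup _ \<psi>(1)] by blast
  moreover have "compose P \<psi> \<phi> ` P = R" using \<phi>(2) \<psi>(2) by (force simp: compose_def)
  ultimately show ?thesis using P R unfolding F_conj_iff by blast
qed

lemma F_conj_card: "F_conj S F P Q \<Longrightarrow> card Q = card P"
  unfolding F_conj_iff using morphism_card[OF _ carrier_subgroup] by blast

lemma F_conj_conj:
  assumes "subgroup P S" "g \<in> carrier S" shows "F_conj S F P (conj_map S g ` P)"
proof -
  have "conj_map S g ` P \<subseteq> carrier S"
    using assms subgroup.mem_carrier[OF assms(1)] by (auto simp: conj_map_closed)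
  from F_conjI[OF assms(1) conj[OF assms(1) carrier_subgroup assms(2) this]] show ?thesis by simp
qed

lemma mem_F_class: "Q \<in> F_class S F P \<longleftrightarrow> F_conj S F P Q"
  by (simp add: F_class_def)

lemma F_class_eq: "F_conj S F P Q \<Longrightarrow> F_class S F P = F_class S F Q"
  unfolding F_class_def using F_conj_sym F_conj_trans by blast

lemma finite_F_class: "finite (F_class S F P)"
  by (rule finite_subset[OF _ finite_subgroups]) (auto simp: F_class_def F_conj_def)

lemma F_class_card_pos: "subgroup P S \<Longrightarrow> card (F_class S F P) > 0"
  using finite_F_class F_conj_refl by (auto simp: card_gt_0_iff F_class_def)

lemma exists_fully_normalized:
  assumes "subgroup P S"
  shows "\<exists>Q. F_conj S F P Q \<and> fully_normalized S F Q"
proof -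
  let ?N = "\<lambda>Q. card (normalizer S Q)"
  have ne: "F_class S F P \<noteq> {}" using F_class_card_pos[OF assms] by auto
  then have "Max (?N ` F_class S F P) \<in> ?N ` F_class S F P" by (intro Max_in) (auto simp: finite_F_class)
  then obtain Q where Q: "F_conj S F P Q" "?N Q = Max (?N ` F_class S F P)" by (auto simp: F_class_def)
  have "fully_normalized S F Q"
    unfolding fully_normalized_def F_class_eq[OF Q(1), symmetric] Q(2) by (simp add: finite_F_class)
  with Q(1) show ?thesis by blast
qed

lemma p_subgroup_card: "subgroup P S \<Longrightarrow> \<exists>k. card P = p ^ k"
proof -
  assume P: "subgroup P S"
  obtain n where "order S = p ^ n" using p_group by blast
  moreover have "card P dvd order S"
    using subgroup_card_dvd[OF P carrier_subgroup subgroup.subset[OF P]] by (simp add: order_def)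
  ultimately show "\<exists>k. card P = p ^ k" using divides_primepow_nat[OF prime_p] by (metis)
qed

lemma normalizer_morphism:
  assumes N: "subgroup N S" and \<phi>: "\<phi> \<in> F N (carrier S)" and Q: "subgroup Q S" "Q \<subseteq> N"
    and norm: "N \<subseteq> normalizer S Q"
  shows "\<phi> ` N \<subseteq> normalizer S (\<phi> ` Q)"
proof
  fix y assume "y \<in> \<phi> ` N"
  then obtain x where x: "x \<in> N" "y = \<phi> x" by blast
  have "conj_map S x ` Q = Q" using x norm by (auto simp: normalizer_eq subgroup.subset[OF Q(1)])
  then have "\<phi> ` Q = (\<lambda>u. \<phi> (conj_map S x u)) ` Q" by (metis image_image)
  also have "\<dots> = (\<lambda>u. conj_map S (\<phi> x) (\<phi> u)) ` Q"
    using Q(2) x by (intro image_cong) (auto simp: morphism_conj[OF N carrier_subgroup \<phi>])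
  also have "\<dots> = conj_map S y ` \<phi> ` Q" by (simp add: x image_image)
  finally have "conj_map S y ` \<phi> ` Q = \<phi> ` Q" by simp
  moreover have "y \<in> carrier S" "\<phi> ` Q \<subseteq> carrier S"
    using morphismD(4)[OF N carrier_subgroup \<phi>] x Q(2) by auto
  ultimately show "y \<in> normalizer S (\<phi> ` Q)" by (simp add: normalizer_eq)
qed


subsection \<open>Automizers\<close>

lemma Aut_F_Bij: assumes "subgroup P S" shows "F P P \<subseteq> Bij P"
proof
  fix \<alpha> assume "\<alpha> \<in> F P P"
  note \<alpha> = morphismD[OF assms assms this]
  have "\<alpha> ` P = P" by (rule endo_inj_surj[OF finite_subgroup[OF assms] \<alpha>(4,3)])
  then show "\<alpha> \<in> Bij P" using \<alpha>(1,3) by (simp add: Bij_def bij_betw_def)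
qed

lemma Aut_F_carrier: "carrier (Aut_F F P) = F P P"
  by (simp add: Aut_F_def)

lemma Aut_F_mult:
  assumes "subgroup P S" "\<alpha> \<in> F P P" "\<beta> \<in> F P P"
  shows "\<alpha> \<otimes>\<^bsub>Aut_F F P\<^esub> \<beta> = compose P \<alpha> \<beta>"
  using Aut_F_Bij[OF assms(1)] assms(2,3) by (auto simp: Aut_F_def BijGroup_def)

lemma Aut_F_one: "\<one>\<^bsub>Aut_F F P\<^esub> = (\<lambda>x\<in>P. x)"
  by (simp add: Aut_F_def BijGroup_def)

lemma Aut_F_group:
  assumes P: "subgroup P S" shows "finite_group (Aut_F F P)"
proof -
  have "group (Aut_F F P)"
  proof (rule groupI)
    fix \<alpha> \<beta> \<gamma> assume a: "\<alpha> \<in> carrier (Aut_F F P)" "\<beta> \<in> carrier (Aut_F F P)"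
    then show c: "\<alpha> \<otimes>\<^bsub>Aut_F F P\<^esub> \<beta> \<in> carrier (Aut_F F P)"
      using comp[OF P P P] by (simp add: Aut_F_carrier Aut_F_mult P)
    show "\<alpha> \<otimes>\<^bsub>Aut_F F P\<^esub> \<beta> \<otimes>\<^bsub>Aut_F F P\<^esub> \<gamma> = \<alpha> \<otimes>\<^bsub>Aut_F F P\<^esub> (\<beta> \<otimes>\<^bsub>Aut_F F P\<^esub> \<gamma>)"
      if "\<gamma> \<in> carrier (Aut_F F P)"
      using a that comp[OF P P P] morphismD(4)[OF P P, of \<gamma>]
      by (auto simp: Aut_F_carrier Aut_F_mult P compose_def fun_eq_iff)
    show "\<one>\<^bsub>Aut_F F P\<^esub> \<otimes>\<^bsub>Aut_F F P\<^esub> \<alpha> = \<alpha>"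
      using a inclusion[OF P P] morphismD(1,4)[OF P P, of \<alpha>]
      by (auto simp: Aut_F_carrier Aut_F_mult P Aut_F_one compose_def fun_eq_iff extensional_def)
    have \<alpha>: "\<alpha> \<in> F P P" using a by (simp add: Aut_F_carrier)
    have "\<alpha> ` P = P" using Aut_F_Bij[OF P] \<alpha> by (auto simp: Bij_def bij_betw_def)
    then obtain \<psi> where "\<psi> \<in> F P P" "\<forall>x\<in>P. \<psi> (\<alpha> x) = x"
      using onto_image[OF P P \<alpha>] morphismD(3)[OF P P \<alpha>]
      by (intro that[of "restrict (inv_into P \<alpha>) P"]) auto
    then show "\<exists>\<beta>\<in>carrier (Aut_F F P). \<beta> \<otimes>\<^bsub>Aut_F F P\<^esub> \<alpha> = \<one>\<^bsub>Aut_F F P\<^esub>"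
      using \<alpha> by (intro bexI[of _ \<psi>]) (auto simp: Aut_F_carrier Aut_F_mult P Aut_F_one compose_def)
  qed (simp add: Aut_F_carrier Aut_F_one inclusion P)
  moreover have "finite (F P P)"
  proof (rule finite_subset)
    show "F P P \<subseteq> P \<rightarrow>\<^sub>E P" using morphismD(1,4)[OF P P] unfolding PiE_def Pi_def by blast
  qed (simp add: finite_PiE finite_subgroup P)
  ultimately show ?thesis by (simp add: finite_group_def finite_group_axioms_def Aut_F_carrier)
qed

lemma conj_hom_Aut_F:
  assumes P: "subgroup P S"
  shows "(\<lambda>g. restrict (conj_map S g) P) \<in> hom (S\<lparr>carrier := normalizer S P\<rparr>) (Aut_F F P)"
proof (rule homI)
  have Pc: "P \<subseteq> carrier S" by (rule subgroup.subset[OF P])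
  have N: "g \<in> carrier S" "conj_map S g ` P = P" if "g \<in> normalizer S P" for g
    using that by (auto simp: normalizer_eq Pc)
  have mem: "restrict (conj_map S g) P \<in> F P P" if "g \<in> normalizer S P" for g
    using N[OF that] by (intro conj[OF P P]) auto
  then show "restrict (conj_map S g) P \<in> carrier (Aut_F F P)"
    if "g \<in> carrier (S\<lparr>carrier := normalizer S P\<rparr>)" for g using that by (simp add: Aut_F_carrier)
  show "restrict (conj_map S (g \<otimes>\<^bsub>S\<lparr>carrier := normalizer S P\<rparr>\<^esub> h)) P
      = restrict (conj_map S g) P \<otimes>\<^bsub>Aut_F F P\<^esub> restrict (conj_map S h) P"
    if "g \<in> carrier (S\<lparr>carrier := normalizer S P\<rparr>)" "h \<in> carrier (S\<lparr>carrier := normalizer S P\<rparr>)" for g h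
    using that N[of g] N[of h] Pc
    by (auto simp: Aut_F_carrier Aut_F_mult P mem compose_def fun_eq_iff conj_map_mult)
qed

end

section \<open>Extending to normalizers\<close>

text \<open>An isomorphism $\psi \colon P \to Q$ turns conjugation by $s \in N_S(P)$ into the automorphism
  $\psi c_s \psi^{-1}$ of \<open>Q\<close>.\<close>

lemma (in fusion_system) transported_conj_hom:
  assumes P: "subgroup P S" and \<psi>: "\<psi> \<in> F P (carrier S)" "\<psi> ` P = Q"
  obtains c where "c \<in> hom (S\<lparr>carrier := normalizer S P\<rparr>) (Aut_F F Q)"
    "\<forall>s\<in>normalizer S P. \<forall>u\<in>P. c s (\<psi> u) = \<psi> (conj_map S s u)"
proof -
  let ?c = "\<lambda>s. restrict (conj_map S s) P"
  have Q: "subgroup Q S" using morphism_image_subgroup[OF P carrier_subgroup \<psi>(1) P] \<psi>(2) by simp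
  obtain \<theta> where \<theta>: "\<theta> \<in> F (\<psi> ` P) P" and \<theta>\<psi>: "\<forall>x\<in>P. \<theta> (\<psi> x) = x" and "\<theta> ` \<psi> ` P = P"
    by (rule morphism_inverse[OF P carrier_subgroup \<psi>(1)])
  have \<psi>Q: "\<psi> \<in> F P Q" using onto_image[OF P carrier_subgroup \<psi>(1)] \<psi>(2) by simp
  have \<theta>Q: "\<theta> \<in> F Q P" using \<theta> \<psi>(2) by simp
  define c where "c s = compose Q \<psi> (compose Q (?c s) \<theta>)" for s
  have c: "?c s \<in> F P P" if "s \<in> normalizer S P" for s
    using hom_in_carrier[OF conj_hom_Aut_F[OF P], of s] that by (simp add: Aut_F_carrier)
  have cF: "c s \<in> F Q Q" if "s \<in> normalizer S P" for s
    unfolding c_def by (intro comp[OF Q P Q _ \<psi>Q] comp[OF Q P P \<theta>Q] c that)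
  have cP: "conj_map S s u \<in> P" if "s \<in> normalizer S P" "u \<in> P" for s u
    using that by (auto simp: normalizer_eq subgroup.subset[OF P])
  have app: "c s (\<psi> u) = \<psi> (conj_map S s u)" if "s \<in> normalizer S P" "u \<in> P" for s u
    using that \<theta>\<psi> \<psi>(2) by (auto simp: c_def compose_def)
  have "c \<in> hom (S\<lparr>carrier := normalizer S P\<rparr>) (Aut_F F Q)"
  proof (rule homI)
    show "c s \<in> carrier (Aut_F F Q)" if "s \<in> carrier (S\<lparr>carrier := normalizer S P\<rparr>)" for s
      using cF that by (simp add: Aut_F_carrier)
    fix s t assume "s \<in> carrier (S\<lparr>carrier := normalizer S P\<rparr>)" "t \<in> carrier (S\<lparr>carrier := normalizer S P\<rparr>)"
    then have st: "s \<in> normalizer S P" "t \<in> normalizer S P" by simp_all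
    then have "s \<otimes> t \<in> normalizer S P" by (rule subgroup.m_closed[OF normalizer_subgroup[OF P]])
    have carr: "s \<in> carrier S" "t \<in> carrier S" using st by (auto simp: normalizer_eq subgroup.subset[OF P])
    have "c (s \<otimes> t) y = compose Q (c s) (c t) y" for y
    proof (cases "y \<in> Q")
      case True
      then obtain u where "u \<in> P" "y = \<psi> u" using \<psi>(2) by blast
      then show ?thesis
        using True st \<open>s \<otimes> t \<in> _\<close> carr subgroup.mem_carrier[OF P] by (simp add: compose_def app cP conj_map_mult)
    qed (simp add: c_def compose_def)
    then show "c (s \<otimes>\<^bsub>S\<lparr>carrier := normalizer S P\<rparr>\<^esub> t) = c s \<otimes>\<^bsub>Aut_F F Q\<^esub> c t"
      using st by (simp add: Aut_F_mult Q cF fun_eq_iff)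
  qed
  then show thesis using that app by blast
qed

context saturated_fusion_system
begin

text \<open>The group $N_S(P)$ acts on the cosets of the Sylow subgroup $\mathrm{Aut}_S(Q)$ of
  $\mathrm{Aut}_{\mathcal F}(Q)$, whose number is prime to \<open>p\<close>, and so it fixes one of them. The
  fixed coset gives the automorphism of \<open>Q\<close> by which an isomorphism $P \to Q$ must be
  changed to extend to $N_S(P)$.\<close>

lemma extend_to_normalizer:
  assumes conj: "F_conj S F P Q" and fn: "fully_normalized S F Q"
  obtains \<phi> where "\<phi> \<in> F (normalizer S P) (carrier S)" "\<phi> ` P = Q"
    "\<phi> ` normalizer S P \<subseteq> normalizer S Q"
proof -
  obtain \<psi> where P: "subgroup P S" and Q: "subgroup Q S" and \<psi>: "\<psi> \<in> F P (carrier S)" "\<psi> ` P = Q"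
    using conj unfolding F_conj_iff by blast
  let ?N = "normalizer S P" and ?A = "Aut_F F Q" and ?T = "Aut_S S Q"
  let ?H = "S\<lparr>carrier := ?N\<rparr>"
  have N: "subgroup ?N S" by (rule normalizer_subgroup[OF P])
  have Pc: "P \<subseteq> carrier S" and Qc: "Q \<subseteq> carrier S" using P Q subgroup.subset by auto
  have PN: "P \<subseteq> ?N" by (rule subgroup_le_normalizer[OF P])
  interpret A: finite_group ?A by (rule Aut_F_group[OF Q])
  interpret H: group ?H by (rule subgroup_imp_group[OF N])
  have fc: "fully_centralized S F Q" and syl: "subgroup ?T ?A" "card ?T = p ^ multiplicity p (order ?A)"
    using fully_normalized_imp[OF Q fn] by (auto simp: sylow_subgroup_def)
  obtain c where c: "c \<in> hom ?H ?A" and c_app: "\<forall>s\<in>?N. \<forall>u\<in>P. c s (\<psi> u) = \<psi> (conj_map S s u)"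
    by (rule transported_conj_hom[OF P \<psi>])
  interpret c: group_hom ?H ?A c by unfold_locales (rule c)
  let ?X = "gset_res c (gset_cosets ?A ?T)"
  have X: "finite_action ?H ?X"
    using A.gset_cosets_finite_action[OF syl(1)] c.hom_closed c.hom_mult c.hom_one
    unfolding finite_action_def acts_def gset_res_def by simp
  have fin: "order ?A > 0" using A.subgroup_card_pos[OF A.subgroup_self] by (simp add: order_def)
  have "\<not> p dvd card (fst ?X)"
  proof
    assume "p dvd card (fst ?X)"
    then obtain k where "card (fst ?X) = p * k" by (auto simp: dvd_def)
    then have "order ?A = p ^ Suc (multiplicity p (order ?A)) * k"
      using A.card_cosets[OF syl(1)] syl(2) by (simp add: gset_res_def mult_ac)
    then have "p ^ Suc (multiplicity p (order ?A)) dvd order ?A" by (metis dvd_triv_left)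
    then have "Suc (multiplicity p (order ?A)) \<le> multiplicity p (order ?A)"
      using fin prime_p by (intro multiplicity_geI) (auto simp: not_prime_unit)
    then show False by simp
  qed
  moreover obtain k where k: "card ?N = p ^ k" using p_subgroup_card[OF N] by blast
  ultimately have "gset_fix (carrier ?H) ?X \<noteq> {}"
    using H.p_group_without_fixed_points[OF X _ prime_p, of k] by auto
  then obtain C where C: "C \<in> lcosets\<^bsub>?A\<^esub> ?T" "\<And>s. s \<in> ?N \<Longrightarrow> c s <#\<^bsub>?A\<^esub> C = C"
    by (fastforce simp: gset_fix_def gset_res_def gset_cosets_def)
  then obtain a where a: "a \<in> carrier ?A" "C = a <#\<^bsub>?A\<^esub> ?T" by (auto simp: LCOSETS_def)
  define \<alpha> where "\<alpha> = inv\<^bsub>?A\<^esub> a"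
  have \<alpha>A: "\<alpha> \<in> carrier ?A" and a_inv: "a = inv\<^bsub>?A\<^esub> \<alpha>" using a by (auto simp: \<alpha>_def)
  then have \<alpha>: "\<alpha> \<in> F Q Q" by (simp add: Aut_F_carrier)
  have inT: "\<alpha> \<otimes>\<^bsub>?A\<^esub> c s \<otimes>\<^bsub>?A\<^esub> inv\<^bsub>?A\<^esub> \<alpha> \<in> ?T" if s: "s \<in> ?N" for s
  proof -
    have cs: "c s \<in> carrier ?A" using c.hom_closed s by simp
    have "(c s \<otimes>\<^bsub>?A\<^esub> a) <#\<^bsub>?A\<^esub> ?T = a <#\<^bsub>?A\<^esub> ?T"
      using C(2)[OF s] a cs subgroup.subset[OF syl(1)] by (simp add: A.lcos_m_assoc)
    then have "inv\<^bsub>?A\<^esub> a \<otimes>\<^bsub>?A\<^esub> (c s \<otimes>\<^bsub>?A\<^esub> a) \<in> ?T"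
      using A.lcoset_self[OF syl(1) a(1), of "c s \<otimes>\<^bsub>?A\<^esub> a"] a(1) cs by simp
    then show ?thesis using a cs by (simp add: \<alpha>_def A.m_assoc)
  qed
  define \<phi> where "\<phi> = compose P \<alpha> \<psi>"
  have \<psi>Q: "\<psi> \<in> F P Q" using onto_image[OF P carrier_subgroup \<psi>(1)] \<psi>(2) by simp
  have \<phi>Q: "\<phi> \<in> F P Q" unfolding \<phi>_def by (rule comp[OF P Q Q \<psi>Q \<alpha>])
  have \<phi>: "\<phi> \<in> F P (carrier S)"
    by (rule morphism_codomain[OF P Q \<phi>Q carrier_subgroup]) (use morphismD(4)[OF P Q \<phi>Q] Qc in blast)
  have "\<alpha> ` Q = Q" using Aut_F_Bij[OF Q] \<alpha> by (auto simp: Bij_def bij_betw_def)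
  then have \<phi>P: "\<phi> ` P = Q" using \<psi>(2) by (force simp: \<phi>_def compose_def)
  have ext: "extender S P \<phi> = ?N"
  proof -
    have "\<exists>y\<in>carrier S. \<forall>u\<in>P. \<phi> (conj_map S s u) = conj_map S y (\<phi> u)" if s: "s \<in> ?N" for s
    proof -
      have csA: "c s \<in> carrier ?A" using c.hom_closed s by simp
      then have cs: "c s \<in> F Q Q" by (simp add: Aut_F_carrier)
      obtain y where y: "y \<in> normalizer S Q" "\<alpha> \<otimes>\<^bsub>?A\<^esub> c s \<otimes>\<^bsub>?A\<^esub> inv\<^bsub>?A\<^esub> \<alpha> = restrict (conj_map S y) Q"
        using inT[OF s] by (auto simp: Aut_S_def)
      then have "\<alpha> \<otimes>\<^bsub>?A\<^esub> c s = restrict (conj_map S y) Q \<otimes>\<^bsub>?A\<^esub> \<alpha>"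
        using \<alpha>A csA by (metis A.inv_closed A.l_inv A.m_assoc A.m_closed A.r_one)
      moreover have yF: "restrict (conj_map S y) Q \<in> F Q Q"
        using hom_in_carrier[OF conj_hom_Aut_F[OF Q], of y] y(1) by (simp add: Aut_F_carrier)
      ultimately have eq: "compose Q \<alpha> (c s) = compose Q (restrict (conj_map S y) Q) \<alpha>"
        using \<alpha> cs by (simp add: Aut_F_mult Q)
      have "\<phi> (conj_map S s u) = conj_map S y (\<phi> u)" if u: "u \<in> P" for u
      proof -
        have uQ: "\<psi> u \<in> Q" "\<alpha> (\<psi> u) \<in> Q" using u \<psi>(2) \<open>\<alpha> ` Q = Q\<close> by auto
        have "conj_map S s u \<in> P" using s u by (auto simp: normalizer_eq Pc)
        then have "\<phi> (conj_map S s u) = compose Q \<alpha> (c s) (\<psi> u)"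
          using s u uQ c_app by (simp add: \<phi>_def compose_def)
        also have "\<dots> = conj_map S y (\<phi> u)" unfolding eq using u uQ by (simp add: \<phi>_def compose_def)
        finally show ?thesis .
      qed
      then show ?thesis using y(1) by (auto simp: normalizer_eq Qc)
    qed
    then show ?thesis unfolding extender_def by blast
  qed
  obtain \<chi> where \<chi>: "\<chi> \<in> F ?N (carrier S)" "\<forall>x\<in>P. \<chi> x = \<phi> x"
    using extension[OF P \<phi>] fc ext \<phi>P by auto
  then have "\<chi> ` P = Q" using \<phi>P by auto
  moreover have "\<chi> ` ?N \<subseteq> normalizer S Q"
    using normalizer_morphism[OF N \<chi>(1) P PN] \<open>\<chi> ` P = Q\<close> by simp
  ultimately show thesis using that \<chi>(1) by blast
qed

end

section \<open>The number of conjugates of a fully normalized subgroup\<close>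

lemma p_int_unit_perturb:
  assumes p: "prime p" and r: "r \<in> p_int p" and v: "v \<in> p_int p" "r * v = 1" and t: "t \<in> p_int p"
  shows "\<exists>w\<in>p_int p. (r + of_nat p * t) * w = 1"
proof -
  obtain a b where b: "\<not> int p dvd b" and r_eq: "r = of_int a / of_int b"
    using r unfolding p_int_iff by blast
  obtain c d where d: "\<not> int p dvd d" and v_eq: "v = of_int c / of_int d"
    using v(1) unfolding p_int_iff by blast
  obtain e f where f: "\<not> int p dvd f" and t_eq: "t = of_int e / of_int f"
    using t unfolding p_int_iff by blast
  have nz: "b \<noteq> 0" "d \<noteq> 0" "f \<noteq> 0" using b d f by auto
  have "rat_of_int (a * c) = of_int (b * d)" using v(2) nz by (simp add: r_eq v_eq field_simps)
  then have "a * c = b * d" by (simp only: of_int_eq_iff)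
  then have "\<not> int p dvd a" using not_dvd_mult_p[OF p b d] by (metis dvd_mult2)
  then have "\<not> int p dvd a * f" using f by (rule not_dvd_mult_p[OF p])
  define n where "n = a * f + int p * (e * b)"
  have n: "\<not> int p dvd n" using \<open>\<not> int p dvd a * f\<close> by (simp add: n_def dvd_add_left_iff)
  then have "n \<noteq> 0" by auto
  have "r + of_nat p * t = of_int n / of_int (b * f)"
    using nz by (simp add: r_eq t_eq n_def field_simps)
  then have "(r + of_nat p * t) * (of_int (b * f) / of_int n) = 1" using nz \<open>n \<noteq> 0\<close> by simp
  then show ?thesis using p_int_fraction[OF n] by blast
qed

lemma (in finite_group) normalizer_conj:
  assumes Q: "subgroup Q G" and g: "g \<in> carrier G"
  shows "normalizer G (conj_map G g ` Q) = conj_map G g ` normalizer G Q"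
proof -
  have sub: "conj_map G h ` normalizer G R \<subseteq> normalizer G (conj_map G h ` R)"
    if R: "subgroup R G" and h: "h \<in> carrier G" for R h
  proof
    have Rc: "R \<subseteq> carrier G" by (rule subgroup.subset[OF R])
    fix y assume "y \<in> conj_map G h ` normalizer G R"
    then obtain x where x: "x \<in> carrier G" "conj_map G x ` R = R" "y = conj_map G h x"
      by (auto simp: normalizer_eq Rc)
    have y: "y \<in> carrier G" and "y \<otimes> h = h \<otimes> x" using x h by (auto simp: conj_map_def m_assoc)
    then have "conj_map G y ` conj_map G h ` R = conj_map G h ` R"
      using conj_image_mult[OF y h Rc] conj_image_mult[OF h x(1) Rc] x(2) by simp
    then show "y \<in> normalizer G (conj_map G h ` R)"
      using y by (simp add: normalizer_eq subgroup.subset[OF conj_image_subgroup[OF h R]])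
  qed
  have Qc: "Q \<subseteq> carrier G" by (rule subgroup.subset[OF Q])
  have gQ: "subgroup (conj_map G g ` Q) G" by (rule conj_image_subgroup[OF g Q])
  have NgQ: "normalizer G (conj_map G g ` Q) \<subseteq> carrier G"
    by (rule subgroup.subset[OF normalizer_subgroup[OF gQ]])
  have "conj_map G (inv g) ` conj_map G g ` Q = Q"
    using conj_image_mult[of "inv g" g Q] conj_image_one g Qc by simp
  then have "conj_map G g ` conj_map G (inv g) ` normalizer G (conj_map G g ` Q) \<subseteq> conj_map G g ` normalizer G Q"
    using sub[OF gQ, of "inv g"] g by (intro image_mono) simp
  moreover have "conj_map G g ` conj_map G (inv g) ` normalizer G (conj_map G g ` Q) = normalizer G (conj_map G g ` Q)"
    using conj_image_mult[of g "inv g", OF _ _ NgQ] conj_image_one[OF NgQ] g by simp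
  ultimately show ?thesis using sub[OF Q g] by simp
qed

lemma (in finite_group) card_normalizer_conj:
  "subgroup Q G \<Longrightarrow> g \<in> carrier G \<Longrightarrow> card (normalizer G (conj_map G g ` Q)) = card (normalizer G Q)"
  by (simp add: normalizer_conj conj_image_card subgroup.subset normalizer_subgroup)

lemma (in group) conj_map_restrict_eq_iff:
  assumes P: "P \<subseteq> carrier G" and g: "g \<in> carrier G" and h: "h \<in> carrier G"
  shows "restrict (conj_map G g) P = restrict (conj_map G h) P \<longleftrightarrow> inv h \<otimes> g \<in> centralizer G P"
proof -
  have "conj_map G g x = conj_map G h x \<longleftrightarrow> inv h \<otimes> g \<otimes> x = x \<otimes> (inv h \<otimes> g)" if "x \<in> P" for x
  proof -
    have x: "x \<in> carrier G" using that P by blast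
    have "conj_map G g x = conj_map G h x \<longleftrightarrow> conj_map G (inv h) (conj_map G g x) = x"
      using conj_map_inv[OF h, of x] conj_map_inv[OF h, of "conj_map G g x"] conj_map_closed[OF g x] x
      by metis
    also have "conj_map G (inv h) (conj_map G g x) = conj_map G (inv h \<otimes> g) x"
      using g h x by (simp add: conj_map_mult)
    also have "conj_map G (inv h \<otimes> g) x = x \<longleftrightarrow> inv h \<otimes> g \<otimes> x = x \<otimes> (inv h \<otimes> g)"
      using g h x unfolding conj_map_def by (metis inv_closed inv_solve_right' m_closed)
    finally show ?thesis .
  qed
  then show ?thesis using g h by (auto simp: centralizer_def fun_eq_iff restrict_def)
qed

text \<open>Conjugation identifies $H / C_G(P)$ with a group of automorphisms of \<open>P\<close>.\<close>

lemma (in finite_group) card_conj_restrictions: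
  assumes P: "P \<subseteq> carrier G" and H: "subgroup H G" and CH: "centralizer G P \<subseteq> H"
  shows "card ((\<lambda>g. restrict (conj_map G g) P) ` H) * card (centralizer G P) = card H"
proof -
  let ?c = "\<lambda>g. restrict (conj_map G g) P" and ?C = "centralizer G P"
  have "card H = card (?c ` H) * card ?C"
  proof (rule card_fibres[OF finite_subgroup[OF H]])
    fix y assume "y \<in> ?c ` H"
    then obtain h where h: "h \<in> H" "y = ?c h" by blast
    have hc: "h \<in> carrier G" using h subgroup.mem_carrier[OF H] by blast
    have Cc: "?C \<subseteq> carrier G" by (auto simp: centralizer_def)
    have "{g \<in> H. ?c g = y} = (\<lambda>z. h \<otimes> z) ` ?C"
    proof (intro equalityI subsetI)
      fix g assume g: "g \<in> {g \<in> H. ?c g = y}"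
      then have gc: "g \<in> carrier G" using subgroup.mem_carrier[OF H] by blast
      then have "inv h \<otimes> g \<in> ?C" using g h conj_map_restrict_eq_iff[OF P gc hc] by auto
      moreover have "g = h \<otimes> (inv h \<otimes> g)" using gc hc by (simp add: m_assoc[symmetric])
      ultimately show "g \<in> (\<lambda>z. h \<otimes> z) ` ?C" by blast
    next
      fix g assume "g \<in> (\<lambda>z. h \<otimes> z) ` ?C"
      then obtain z where z: "z \<in> ?C" "g = h \<otimes> z" by blast
      then have gH: "g \<in> H" using h CH subgroup.m_closed[OF H] by blast
      have "inv h \<otimes> g = z" using z hc Cc by (auto simp: m_assoc[symmetric])
      then show "g \<in> {g \<in> H. ?c g = y}"
        using conj_map_restrict_eq_iff[OF P subgroup.mem_carrier[OF H gH] hc] z gH h by auto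
    qed
    moreover have "inj_on (\<lambda>z. h \<otimes> z) ?C" using hc Cc by (intro inj_onI) (simp add: subset_iff)
    ultimately show "card {g \<in> H. ?c g = y} = card ?C" by (simp add: card_image)
  qed
  then show ?thesis by simp
qed

lemma (in fusion_system) fully_normalized_le:
  "fully_normalized S F Q \<Longrightarrow> F_conj S F Q R \<Longrightarrow> card (normalizer S R) \<le> card (normalizer S Q)"
  by (simp add: fully_normalized_def mem_F_class)

lemma (in fusion_system) fully_normalized_transfer:
  assumes "fully_normalized S F Q" "F_conj S F Q R" "card (normalizer S R) = card (normalizer S Q)"
  shows "fully_normalized S F R"
  using assms F_class_eq[OF assms(2)] by (simp add: fully_normalized_def)

text \<open>The normalizer of a fully normalized subgroup is as large as it can be, so a morphism defined
  on it carries it onto the normalizer of the image.\<close>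

lemma (in fusion_system) normalizer_of_image:
  assumes Q: "subgroup Q S" and fn: "fully_normalized S F Q"
    and \<phi>: "\<phi> \<in> F (normalizer S Q) (carrier S)"
  shows "normalizer S (\<phi> ` Q) = \<phi> ` normalizer S Q" "F_conj S F Q (\<phi> ` Q)"
    "fully_normalized S F (\<phi> ` Q)"
proof -
  let ?N = "normalizer S Q"
  have N: "subgroup ?N S" by (rule normalizer_subgroup[OF Q])
  have QN: "Q \<subseteq> ?N" by (rule subgroup_le_normalizer[OF Q])
  have "restrict \<phi> Q ` Q = \<phi> ` Q" by auto
  then show c: "F_conj S F Q (\<phi> ` Q)"
    using F_conjI[OF Q morphism_restrict[OF N carrier_subgroup \<phi> Q QN]] by simp
  have im: "subgroup (\<phi> ` Q) S" by (rule morphism_image_subgroup[OF N carrier_subgroup \<phi> Q QN])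
  have card: "card (\<phi> ` ?N) = card ?N" by (rule morphism_card[OF N carrier_subgroup \<phi>]) simp
  have "\<phi> ` ?N = normalizer S (\<phi> ` Q)"
    using normalizer_morphism[OF N \<phi> Q QN] card fully_normalized_le[OF fn c]
    by (intro card_seteq finite_subgroup normalizer_subgroup im) auto
  then show eq: "normalizer S (\<phi> ` Q) = \<phi> ` ?N" by simp
  show "fully_normalized S F (\<phi> ` Q)"
    by (rule fully_normalized_transfer[OF fn c]) (simp add: eq card)
qed

text \<open>A morphism that moves $N_S(Q)$ to a fully normalized conjugate moves \<open>Q\<close> along, and it does not change
  the order of the normalizer of \<open>Q\<close>.\<close>

lemma (in fusion_system) exists_fully_normalized_normalizer:
  assumes "subgroup Q S"
  shows "\<exists>R. F_conj S F Q R \<and> fully_normalized S F R \<and> fully_normalized S F (normalizer S R)"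
proof -
  obtain R where R: "F_conj S F Q R" "fully_normalized S F R"
    using exists_fully_normalized[OF assms] by blast
  have Rs: "subgroup R S" using R(1) by (simp add: F_conj_def)
  obtain N where N: "F_conj S F (normalizer S R) N" "fully_normalized S F N"
    using exists_fully_normalized[OF normalizer_subgroup[OF Rs]] by blast
  obtain \<phi> where \<phi>: "\<phi> \<in> F (normalizer S R) (carrier S)" "\<phi> ` normalizer S R = N"
    using N(1) unfolding F_conj_iff by blast
  show ?thesis
    using normalizer_of_image[OF Rs R(2) \<phi>(1)] \<phi>(2) N(2) F_conj_trans[OF R(1)]
    by (intro exI[of _ "\<phi> ` R"]) auto
qed

context saturated_fusion_system
begin

definition fn_conjugates :: "'g set \<Rightarrow> 'g set \<Rightarrow> 'g set set" where
  "fn_conjugates Q N = {R \<in> F_class S F Q. fully_normalized S F R \<and> normalizer S R = N}"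

lemma fn_conjugates_le:
  assumes "F_conj S F N N'"
  shows "card (fn_conjugates Q N) \<le> card (fn_conjugates Q N')"
proof -
  obtain \<phi> where N: "subgroup N S" and \<phi>: "\<phi> \<in> F N (carrier S)" "\<phi> ` N = N'"
    using assms unfolding F_conj_iff by blast
  have sub: "subgroup R S" if "R \<in> fn_conjugates Q N" for R
    using that by (simp add: fn_conjugates_def mem_F_class F_conj_def)
  have "inj_on ((`) \<phi>) (fn_conjugates Q N)"
  proof (rule inj_on_subset[OF inj_on_image_Pow[OF morphismD(3)[OF N carrier_subgroup \<phi>(1)]]])
    show "fn_conjugates Q N \<subseteq> Pow N"
      using sub subgroup_le_normalizer by (auto simp: fn_conjugates_def)
  qed
  moreover have "\<phi> ` R \<in> fn_conjugates Q N'" if R: "R \<in> fn_conjugates Q N" for R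
  proof -
    have "F_conj S F Q R" "fully_normalized S F R" "normalizer S R = N"
      using R by (auto simp: fn_conjugates_def mem_F_class)
    then show ?thesis
      using normalizer_of_image[OF sub[OF R], of \<phi>] \<phi> F_conj_trans[of Q R "\<phi> ` R"]
      by (simp add: fn_conjugates_def mem_F_class)
  qed
  moreover have "finite (fn_conjugates Q N')"
    using finite_F_class by (simp add: fn_conjugates_def)
  ultimately show ?thesis by (intro card_inj_on_le[of "(`) \<phi>"]) auto
qed

lemma normalizers_of_fn_conjugates:
  assumes "fully_normalized S F Q" "F_conj S F Q R" "fully_normalized S F R"
  obtains \<phi> where "\<phi> \<in> F (normalizer S Q) (carrier S)" "\<phi> ` Q = R" "\<phi> ` normalizer S Q = normalizer S R"
proof -
  obtain \<phi> where \<phi>: "\<phi> \<in> F (normalizer S Q) (carrier S)" "\<phi> ` Q = R"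
    and "\<phi> ` normalizer S Q \<subseteq> normalizer S R"
    by (rule extend_to_normalizer[OF assms(2,3)])
  moreover have "subgroup Q S" using assms(2) by (simp add: F_conj_def)
  ultimately show thesis using that normalizer_of_image(1)[OF _ assms(1) \<phi>(1)] by auto
qed

text \<open>Normalizers of fully normalized conjugates are conjugate, and an isomorphism between two such
  normalizers matches the subgroups with these normalizers. So all fibres of the map
  $R \mapsto N_S(R)$ have the same order.\<close>

lemma card_fully_normalized_conjugates:
  assumes Q: "subgroup Q S" and fn: "fully_normalized S F Q"
  shows "card {R \<in> F_class S F Q. fully_normalized S F R}
    = card (F_class S F (normalizer S Q)) * card (fn_conjugates Q (normalizer S Q))"
proof -
  let ?K = "{R \<in> F_class S F Q. fully_normalized S F R}" and ?N = "normalizer S Q"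
  have N: "subgroup ?N S" by (rule normalizer_subgroup[OF Q])
  have fibre: "{R \<in> ?K. normalizer S R = N'} = fn_conjugates Q N'" for N'
    by (auto simp: fn_conjugates_def)
  have card: "card (fn_conjugates Q N') = card (fn_conjugates Q ?N)" if "F_conj S F ?N N'" for N'
    using fn_conjugates_le that F_conj_sym by (metis order_antisym)
  have "Q \<in> fn_conjugates Q ?N" using fn F_conj_refl[OF Q] by (simp add: fn_conjugates_def mem_F_class)
  then have pos: "card (fn_conjugates Q ?N) > 0"
    using finite_F_class by (auto simp: card_gt_0_iff fn_conjugates_def)
  have im: "normalizer S ` ?K = F_class S F ?N"
  proof (intro equalityI subsetI)
    fix N' assume "N' \<in> normalizer S ` ?K"
    then obtain R where R: "F_conj S F Q R" "fully_normalized S F R" "N' = normalizer S R"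
      by (auto simp: mem_F_class)
    obtain \<phi> where "\<phi> \<in> F ?N (carrier S)" "\<phi> ` Q = R" "\<phi> ` ?N = normalizer S R"
      by (rule normalizers_of_fn_conjugates[OF fn R(1,2)])
    then show "N' \<in> F_class S F ?N" using F_conjI[OF N] R(3) by (metis mem_F_class)
  next
    fix N' assume "N' \<in> F_class S F ?N"
    then have "card (fn_conjugates Q N') > 0" using card pos by (simp add: mem_F_class)
    then obtain R where "R \<in> fn_conjugates Q N'" by (metis card.empty equals0I less_irrefl)
    then show "N' \<in> normalizer S ` ?K" by (auto simp: fn_conjugates_def)
  qed
  have "card ?K = card (normalizer S ` ?K) * card (fn_conjugates Q ?N)"
  proof (rule card_fibres)
    show "finite ?K" using finite_F_class by simp
    show "card {R \<in> ?K. normalizer S R = N'} = card (fn_conjugates Q ?N)" if "N' \<in> normalizer S ` ?K" for N'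
      unfolding fibre using that card im by (simp add: mem_F_class[symmetric])
  qed
  then show ?thesis unfolding im .
qed

text \<open>The group $\mathrm{Aut}_{\mathcal F}(N)$ permutes the fully normalized conjugates of \<open>Q\<close> with
  normalizer \<open>N\<close> transitively, and the stabilizer of \<open>Q\<close> contains the inner automorphisms.\<close>

lemma card_fn_conjugates:
  assumes Q: "subgroup Q S" and fn: "fully_normalized S F Q" and N_def: "N = normalizer S Q"
  shows "\<exists>l. card (fn_conjugates Q N) * (card ((\<lambda>g. restrict (conj_map S g) N) ` N) * l) = order (Aut_F F N)"
proof -
  have N: "subgroup N S" unfolding N_def by (rule normalizer_subgroup[OF Q])
  have QN: "Q \<subseteq> N" unfolding N_def by (rule subgroup_le_normalizer[OF Q])
  let ?A = "Aut_F F N" and ?X = "(Pow N, \<lambda>(\<alpha> :: 'g \<Rightarrow> 'g) R. \<alpha> ` R)"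
  interpret A: finite_group ?A by (rule Aut_F_group[OF N])
  have act: "acts ?A ?X"
  proof -
    have one: "(\<lambda>x\<in>N. x) ` R = R" if "R \<subseteq> N" for R using that by force
    have mult: "compose N \<alpha> \<beta> ` R = \<alpha> ` \<beta> ` R" if "R \<subseteq> N" for \<alpha> \<beta> :: "'g \<Rightarrow> 'g" and R
      unfolding image_image by (rule image_cong) (use that in \<open>auto simp: compose_def\<close>)
    have closed: "\<alpha> ` R \<subseteq> N" if "\<alpha> \<in> F N N" "R \<subseteq> N" for \<alpha> R
      using morphismD(4)[OF N N that(1)] that(2) by blast
    show ?thesis
      unfolding acts_def by (simp add: Aut_F_carrier Aut_F_mult N Aut_F_one one mult closed)
  qed
  let ?a = "\<lambda>\<alpha>. restrict (snd ?X \<alpha>) (fst ?X)"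
  interpret ga: group_action ?A "fst ?X" ?a by (rule A.acts_group_action[OF act])
  let ?L = "{\<alpha> \<in> carrier ?A. snd ?X \<alpha> Q = Q}"
  have L: "subgroup ?L ?A" by (rule A.point_stabilizer[OF act]) (use QN in simp)
  have stab: "stabilizer ?A ?a Q = ?L" using QN by (auto simp: stabilizer_def)
  have orb: "orbit ?A ?a Q = fn_conjugates Q N"
  proof (intro equalityI subsetI)
    fix R assume "R \<in> orbit ?A ?a Q"
    then obtain \<alpha> where \<alpha>: "\<alpha> \<in> F N N" "R = \<alpha> ` Q" using QN by (auto simp: orbit_def Aut_F_carrier)
    have "\<alpha> \<in> F (normalizer S Q) (carrier S)" unfolding N_def[symmetric]
      by (rule morphism_codomain[OF N N \<alpha>(1) carrier_subgroup])
        (use morphismD(4)[OF N N \<alpha>(1)] subgroup.subset[OF N] in blast)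
    note im = normalizer_of_image[OF Q fn this]
    have "\<alpha> ` N = N" using Aut_F_Bij[OF N] \<alpha>(1) by (auto simp: Bij_def bij_betw_def)
    then show "R \<in> fn_conjugates Q N"
      using im \<alpha>(2) by (simp add: fn_conjugates_def mem_F_class N_def)
  next
    fix R assume "R \<in> fn_conjugates Q N"
    then have R: "F_conj S F Q R" "fully_normalized S F R" "normalizer S R = N"
      by (auto simp: fn_conjugates_def mem_F_class)
    obtain \<phi> where \<phi>: "\<phi> \<in> F N (carrier S)" "\<phi> ` Q = R" "\<phi> ` N = N"
      using normalizers_of_fn_conjugates[OF fn R(1,2)] R(3) N_def by metis
    then have "\<phi> \<in> F N N" using morphism_codomain[OF N carrier_subgroup \<phi>(1) N] by simp
    then show "R \<in> orbit ?A ?a Q" using \<phi>(2) QN by (auto simp: orbit_def Aut_F_carrier)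
  qed
  have orbstab: "card (fn_conjugates Q N) * card ?L = order ?A"
    using ga.orbit_stabilizer_theorem[of Q] QN unfolding orb stab by simp
  let ?c = "\<lambda>g. restrict (conj_map S g) N"
  have NN: "subgroup (normalizer S N) S" "N \<subseteq> normalizer S N"
    using N by (auto intro: normalizer_subgroup dest: subgroup_le_normalizer)
  interpret c: group_hom "S\<lparr>carrier := normalizer S N\<rparr>" ?A ?c
    using conj_hom_Aut_F[OF N] subgroup_imp_group[OF NN(1)] A.is_group
    by (simp add: group_hom_def group_hom_axioms_def)
  have Inn: "subgroup (?c ` N) ?A"
    by (rule c.subgroup_img_is_subgroup[OF subgroup_incl[OF N NN]])
  have "?c ` N \<subseteq> ?L"
  proof
    fix \<alpha> assume "\<alpha> \<in> ?c ` N"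
    then obtain g where g: "g \<in> N" "\<alpha> = ?c g" by blast
    have "conj_map S g ` Q = Q" using g(1) by (auto simp: N_def normalizer_eq subgroup.subset[OF Q])
    moreover have "\<alpha> ` Q = conj_map S g ` Q" using QN by (auto simp: g(2))
    ultimately show "\<alpha> \<in> ?L" using c.hom_closed[of g] g NN(2) by auto
  qed
  then have "card (?c ` N) dvd card ?L" by (rule A.subgroup_card_dvd[OF Inn L])
  then obtain l where "card ?L = card (?c ` N) * l" by (auto simp: dvd_def)
  then show ?thesis using orbstab by (intro exI[of _ l]) simp
qed

end

context saturated_fusion_system
begin

text \<open>Put $N = N_S(Q)$. The lengths of the \<open>S\<close>-orbits on the class of \<open>Q\<close> are divisible by $|S : N|$, and for
  members that are not fully normalized by $p\,|S : N|$. So it suffices to bound from above the \<open>p\<close>-part of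
  the number of fully normalized members. That number is the product of the number of conjugates of
  \<open>N\<close> and the index in $\mathrm{Aut}_{\mathcal F}(N)$ of the stabilizer of \<open>Q\<close>. For \<open>N\<close> fully normalized, which
  can be arranged, the first factor has \<open>p\<close>-part $|S : N_S(N)|$ by induction. In the second, the Sylow
  subgroup $\mathrm{Aut}_S(N) \cong N_S(N)/C_S(N)$ gives the \<open>p\<close>-part of the group, and the stabilizer contains
  the group $N/C_S(N)$ of inner automorphisms. The product is at most $|S : N|$.\<close>

lemma card_F_class_unit:
  assumes "subgroup Q S" "fully_normalized S F Q"
  shows "\<exists>w\<in>p_int p.
    of_nat (card (F_class S F Q)) * of_nat (card (normalizer S Q)) / of_nat (order S) * w = 1"
  using assms
proof (induction "order S - card Q" arbitrary: Q rule: less_induct)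
  case less
  note Q0 = less.prems
  have ordS: "order S > 0" using subgroup_card_pos[OF carrier_subgroup] by (simp add: order_def)
  show ?case
  proof (cases "Q = carrier S")
    case True
    have "R = carrier S" if "F_conj S F Q R" for R
    proof -
      have "subgroup R S" using that by (simp add: F_conj_def)
      then show ?thesis
        using F_conj_card[OF that] True card_subset_eq[OF finite_carrier subgroup.subset] by blast
    qed
    then have "F_class S F Q = {carrier S}"
      using True F_conj_refl[OF Q0(1)] by (auto simp: F_class_def)
    moreover have "normalizer S Q = carrier S"
      using subgroup_le_normalizer[OF Q0(1)] subgroup.subset[OF normalizer_subgroup[OF Q0(1)]] True by blast
    ultimately show ?thesis
      using ordS p_int_1[OF prime_p] by (intro bexI[of _ 1]) (simp_all add: order_def)
  next
    case False
    obtain R where R: "F_conj S F Q R" "fully_normalized S F R" "fully_normalized S F (normalizer S R)"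
      using exists_fully_normalized_normalizer[OF Q0(1)] by blast
    define N where "N = normalizer S R"
    have Rs: "subgroup R S" using R(1) by (simp add: F_conj_def)
    have N: "subgroup N S" unfolding N_def by (rule normalizer_subgroup[OF Rs])
    have RN: "R \<subseteq> N" unfolding N_def by (rule subgroup_le_normalizer[OF Rs])
    have cls: "F_class S F Q = F_class S F R" by (rule F_class_eq[OF R(1)])
    have cardN: "card (normalizer S Q) = card N"
      unfolding N_def using fully_normalized_le[OF Q0(2) R(1)] fully_normalized_le[OF R(2) F_conj_sym[OF R(1)]]
      by simp
    obtain n where n: "order S = p ^ n" using p_group by blast
    have "R \<noteq> carrier S"
      using False F_conj_card[OF R(1)] card_subset_eq[OF finite_carrier subgroup.subset[OF Q0(1)]] by auto
    then have grow: "card R < card N"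
      unfolding N_def by (rule p_group_normalizer_grows[OF prime_p n Rs])
    moreover have "card N \<le> order S" unfolding order_def by (intro card_mono finite_carrier subgroup.subset N)
    ultimately have "order S - card N < order S - card Q" using F_conj_card[OF R(1)] by linarith
    then obtain v where v: "v \<in> p_int p"
      "of_nat (card (F_class S F N)) * of_nat (card (normalizer S N)) / of_nat (order S) * v = 1"
      using less.hyps[OF _ N] R(3) N_def by blast

    let ?c = "\<lambda>g. restrict (conj_map S g) N" and ?A = "Aut_F F N"
    interpret A: finite_group ?A by (rule Aut_F_group[OF N])
    obtain l where l: "card (fn_conjugates R N) * (card (?c ` N) * l) = order ?A"
      using card_fn_conjugates[OF Rs R(2) N_def] by blast
    have Nc: "N \<subseteq> carrier S" by (rule subgroup.subset[OF N])
    have NN: "subgroup (normalizer S N) S" "N \<subseteq> normalizer S N"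
      using N by (auto intro: normalizer_subgroup dest: subgroup_le_normalizer)
    have central: "conj_map S g ` P = P" if "g \<in> centralizer S P" "P \<subseteq> carrier S" for g P
    proof -
      have "conj_map S g x = x" if "x \<in> P" for x
        using that \<open>g \<in> centralizer S P\<close> \<open>P \<subseteq> carrier S\<close>
        by (auto simp: centralizer_def conj_map_def m_assoc subset_iff)
      then show ?thesis by simp
    qed
    have CN: "centralizer S N \<subseteq> N"
    proof
      fix g assume g: "g \<in> centralizer S N"
      then have "g \<in> centralizer S R" using RN by (auto simp: centralizer_def)
      then have "conj_map S g ` R = R" by (rule central[OF _ subgroup.subset[OF Rs]])
      then show "g \<in> N" using g by (simp add: N_def normalizer_eq subgroup.subset[OF Rs] centralizer_def)
    qed
    let ?C = "card (centralizer S N)"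
    have inn: "card (?c ` N) * ?C = card N" by (rule card_conj_restrictions[OF Nc N CN])
    have aut: "card (Aut_S S N) * ?C = card (normalizer S N)"
      unfolding Aut_S_def using CN NN by (intro card_conj_restrictions[OF Nc]) auto
    have "card (Aut_S S N) = p ^ multiplicity p (order ?A)"
      using fully_normalized_imp[OF N] R(3) by (simp add: sylow_subgroup_def N_def)
    moreover have "order ?A > 0" using A.subgroup_card_pos[OF A.subgroup_self] by (simp add: order_def)
    moreover obtain u where "order ?A = p ^ multiplicity p (order ?A) * u" "\<not> p dvd u"
    proof (rule multiplicity_decompose')
      show "order ?A \<noteq> 0" using \<open>order ?A > 0\<close> by simp
      show "\<not> is_unit p" using prime_p not_prime_unit by blast
    qed
    ultimately have u: "order ?A = card (Aut_S S N) * u" "\<not> p dvd u" by simp_all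
    have "u \<noteq> 0" using u(2) by (metis dvd_0_right)

    \<comment> \<open>The fully normalized members: \<open>r\<close> is integral, and it divides a unit.\<close>
    let ?K = "{P \<in> F_class S F R. fully_normalized S F P}"
    define r :: rat where "r = of_nat (card ?K) * of_nat (card N) / of_nat (order S)"
    have "card ?K * card N * l * card (centralizer S N)
        = card (F_class S F N) * (card (fn_conjugates R N) * (card (?c ` N) * l)) * ?C * ?C"
      unfolding card_fully_normalized_conjugates[OF Rs R(2)] N_def[symmetric] inn[symmetric]
      by (simp add: mult_ac)
    also have "\<dots> = card (F_class S F N) * card (normalizer S N) * u * ?C"
      unfolding l u(1) aut[symmetric] by (simp add: mult_ac)
    finally have "card ?K * card N * l = card (F_class S F N) * card (normalizer S N) * u"
      using inn subgroup_card_pos[OF N] by (auto simp del: mult.assoc)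
    then have "(of_nat (card ?K * card N * l) :: rat) = of_nat (card (F_class S F N) * card (normalizer S N) * u)"
      by (simp only:)
    then have rl: "r * of_nat l = of_nat (card (F_class S F N)) * of_nat (card (normalizer S N)) / of_nat (order S) * of_nat u"
      by (simp add: r_def)
    have "r * (of_nat l * v / of_nat u) = (r * of_nat l) * v / of_nat u" by simp
    also have "\<dots> = of_nat (card (F_class S F N)) * of_nat (card (normalizer S N)) / of_nat (order S) * v"
      unfolding rl using \<open>u \<noteq> 0\<close> by simp
    finally have unit: "r * (of_nat l * v / of_nat u) = 1" by (rule trans[OF _ v(2)])
    have "of_nat l * v / of_nat u \<in> p_int p"
      using p_int_mult[OF prime_p p_int_fraction[of p "int u" "int l"] v(1)] u(2) by (simp add: int_dvd_int_iff)

    have sub: "subgroup P S" if "P \<in> F_class S F R" for P using that by (simp add: mem_F_class F_conj_def)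
    have fn_iff: "fully_normalized S F P \<longleftrightarrow> card (normalizer S P) = card N" if "P \<in> F_class S F R" for P
    proof -
      have c: "F_conj S F R P" using that by (simp add: mem_F_class)
      show ?thesis
        using fully_normalized_transfer[OF R(2) c] fully_normalized_le[OF R(2) c]
          fully_normalized_le[OF _ F_conj_sym[OF c]] N_def by fastforce
    qed
    have closed: "conj_map S g ` P \<in> F_class S F R \<and> card (normalizer S (conj_map S g ` P)) = card (normalizer S P)"
      if "P \<in> F_class S F R" "g \<in> carrier S" for P g
      using that F_conj_trans[OF _ F_conj_conj] card_normalizer_conj sub by (simp add: mem_F_class)
    have "(\<Sum>P\<in>?K. of_nat (card (normalizer S P)) * 1) / of_nat (order S) \<in> p_int p"
      by (rule conj_closed_sum[OF prime_p]) (use sub closed fn_iff p_int_1[OF prime_p] in auto)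
    moreover have "(\<Sum>P\<in>?K. of_nat (card (normalizer S P)) * 1) = (\<Sum>P\<in>?K. of_nat (card N) :: rat)"
      by (rule sum.cong) (use fn_iff in auto)
    ultimately have rp: "r \<in> p_int p" by (simp add: r_def)

    \<comment> \<open>The other members contribute a multiple of \<open>p\<close>, since their normalizers are smaller.\<close>
    let ?K' = "F_class S F R - ?K"
    let ?z = "\<lambda>P. of_nat (card N) / (of_nat p * of_nat (card (normalizer S P))) :: rat"
    define t where "t = (\<Sum>P\<in>?K'. of_nat (card (normalizer S P)) * ?z P) / of_nat (order S)"
    have p0: "p > 0" using prime_p prime_gt_0_nat by blast
    have "t \<in> p_int p" unfolding t_def
    proof (rule conj_closed_sum[OF prime_p])
      fix P assume P: "P \<in> ?K'"
      show "subgroup P S" using sub P by blast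
      have lt: "card (normalizer S P) < card N"
        using P fn_iff fully_normalized_le[OF R(2), of P] N_def by (fastforce simp: mem_F_class)
      obtain i j where ij: "card (normalizer S P) = p ^ i" "card N = p ^ j"
        using p_subgroup_card[OF N] p_subgroup_card[OF normalizer_subgroup[OF sub]] P by blast
      have "i < j"
        by (rule power_less_imp_less_exp[OF prime_gt_1_nat[OF prime_p]]) (use lt in \<open>simp add: ij\<close>)
      then have "p ^ j = p ^ (Suc i + (j - Suc i))" by simp
      also have "\<dots> = p ^ Suc i * p ^ (j - Suc i)" by (rule power_add)
      finally have "card N = p * card (normalizer S P) * p ^ (j - Suc i)" unfolding ij by simp
      then have "?z P = of_nat (p ^ (j - Suc i))"
        using p0 subgroup_card_pos[OF normalizer_subgroup[OF \<open>subgroup P S\<close>]] by simp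
      then show "?z P \<in> p_int p" using p_int_of_nat[OF prime_p] by metis
      fix g assume g: "g \<in> carrier S"
      show "?z (conj_map S g ` P) = ?z P" "conj_map S g ` P \<in> ?K'"
        using closed[of P g] P g fn_iff by auto
    qed
    have "of_nat p * (of_nat (card (normalizer S P)) * ?z P) = of_nat (card N)" if "P \<in> ?K'" for P
      using p0 subgroup_card_pos[OF normalizer_subgroup[OF sub]] that by simp
    then have "of_nat p * t = of_nat (card ?K') * of_nat (card N) / of_nat (order S)"
      unfolding t_def times_divide_eq_right sum_distrib_left by simp
    moreover have "card (F_class S F R) = card ?K + card ?K'"
      using finite_F_class by (subst card_Un_disjoint[symmetric]) (auto intro!: arg_cong[where f = card])
    ultimately have "of_nat (card (F_class S F Q)) * of_nat (card (normalizer S Q)) / of_nat (order S)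
        = r + of_nat p * t"
      by (simp add: cls cardN r_def distrib_right add_divide_distrib)
    then show ?thesis
      using p_int_unit_perturb[OF prime_p rp _ unit \<open>t \<in> p_int p\<close>] \<open>of_nat l * v / of_nat u \<in> p_int p\<close>
      by simp
  qed
qed

end

section \<open>Averaging over conjugacy classes\<close>

lemma (in fusion_system) generate_image:
  assumes "subgroup R S" "\<phi> \<in> F R (carrier S)" "B \<subseteq> R"
  shows "\<phi> ` generate S B = generate S (\<phi> ` B)"
  using group_hom.generate_img[OF morphism_group_hom[OF assms(1) carrier_subgroup assms(2)], of B]
    generate_consistent[OF assms(3,1)] assms(3) by simp

context fusion_system
begin

text \<open>On the mark function of \<open>x\<close>, these are the marks that \<open>\<pi>(x)\<close> must have.\<close>

definition class_average :: "('g set \<Rightarrow> rat) \<Rightarrow> 'g set \<Rightarrow> rat" where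
  "class_average f Q = (\<Sum>R\<in>F_class S F Q. f R) / of_nat (card (F_class S F Q))"

lemma class_average_conj: "F_conj S F Q R \<Longrightarrow> class_average f Q = class_average f R"
  by (simp add: class_average_def F_class_eq)

lemma class_average_invariant:
  assumes "subgroup Q S" "\<And>R. F_conj S F Q R \<Longrightarrow> f R = f Q"
  shows "class_average f Q = f Q"
proof -
  have "(\<Sum>R\<in>F_class S F Q. f R) = (\<Sum>R\<in>F_class S F Q. f Q)"
    by (rule sum.cong) (auto simp: mem_F_class assms(2))
  then show ?thesis using F_class_card_pos[OF assms(1)] by (simp add: class_average_def)
qed

text \<open>Averaging over classes is self-adjoint and fixes class functions, so a sum weighted by a class
  function does not notice it.\<close>

lemma class_average_weighted_sum:
  assumes n: "\<And>Q R. F_conj S F Q R \<Longrightarrow> n R = n Q"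
  shows "(\<Sum>R | subgroup R S. n R * class_average f R) = (\<Sum>R | subgroup R S. n R * f R)"
proof -
  let ?U = "{R. subgroup R S}"
  have cls: "F_class S F R = {T \<in> ?U. F_conj S F R T}" for R by (auto simp: F_class_def F_conj_def)
  let ?w = "\<lambda>R. n R / of_nat (card (F_class S F R))"
  have "(\<Sum>R\<in>?U. n R * class_average f R) = (\<Sum>R\<in>?U. \<Sum>T\<in>?U. if F_conj S F R T then ?w R * f T else 0)"
  proof (rule sum.cong[OF refl])
    fix R
    have "n R * class_average f R = (\<Sum>T\<in>F_class S F R. ?w R * f T)"
      by (simp add: class_average_def sum_distrib_left sum_divide_distrib)
    also have "\<dots> = (\<Sum>T\<in>?U. if F_conj S F R T then ?w R * f T else 0)"
      unfolding cls[of R] by (rule sum.inter_filter[OF finite_subgroups])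
    finally show "n R * class_average f R = (\<Sum>T\<in>?U. if F_conj S F R T then ?w R * f T else 0)" .
  qed
  also have "\<dots> = (\<Sum>T\<in>?U. \<Sum>R\<in>?U. if F_conj S F R T then ?w R * f T else 0)" by (rule sum.swap)
  also have "\<dots> = (\<Sum>T\<in>?U. n T * f T)"
  proof (rule sum.cong[OF refl])
    fix T assume T: "T \<in> ?U"
    have "(\<Sum>R\<in>?U. if F_conj S F R T then ?w R * f T else 0)
        = (\<Sum>R\<in>?U. if F_conj S F T R then ?w T * f T else 0)"
    proof (rule sum.cong[OF refl])
      fix R
      show "(if F_conj S F R T then ?w R * f T else 0) = (if F_conj S F T R then ?w T * f T else 0)"
      proof (cases "F_conj S F R T")
        case True
        then show ?thesis using F_conj_sym[OF True] n[OF True] F_class_eq[OF True] by simp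
      next
        case False
        then have "\<not> F_conj S F T R" using F_conj_sym by blast
        then show ?thesis using False by simp
      qed
    qed
    also have "\<dots> = (\<Sum>R\<in>F_class S F T. ?w T * f T)"
      unfolding cls[of T] by (rule sum.inter_filter[OF finite_subgroups, symmetric])
    also have "\<dots> = n T * f T" using F_class_card_pos[of T] T by simp
    finally show "(\<Sum>R\<in>?U. if F_conj S F R T then ?w R * f T else 0) = n T * f T" .
  qed
  finally show ?thesis .
qed

lemma generate_in_normalizer:
  assumes "subgroup Q S" "s \<in> normalizer S Q"
  shows "subgroup (adjoin s Q) S" "adjoin s Q \<subseteq> normalizer S Q"
    "Q \<subseteq> adjoin s Q" "s \<in> adjoin s Q"
proof -
  have sub: "insert s Q \<subseteq> normalizer S Q" using assms subgroup_le_normalizer by blast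
  then show "subgroup (adjoin s Q) S"
    using subgroup.subset[OF normalizer_subgroup[OF assms(1)]] by (intro generate_is_subgroup) auto
  show "adjoin s Q \<subseteq> normalizer S Q"
    by (rule generate_subgroup_incl[OF sub normalizer_subgroup[OF assms(1)]])
  show "Q \<subseteq> adjoin s Q" "s \<in> adjoin s Q"
    by (auto intro: generate.incl)
qed

text \<open>The pairs $(Q', s)$ with $Q' \in [Q]_{\mathcal F}$ and $s \in N_S(Q')$ that generate a given subgroup \<open>R\<close> are
  carried along by every isomorphism out of \<open>R\<close>, and so their number is a class function of \<open>R\<close>.\<close>

definition generating_pairs :: "'g set \<Rightarrow> 'g set \<Rightarrow> ('g set \<times> 'g) set" where
  "generating_pairs Q R = {(Q', s). Q' \<in> F_class S F Q \<and> s \<in> normalizer S Q' \<and> adjoin s Q' = R}"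

lemma finite_generating_pairs: "finite (generating_pairs Q R)"
proof (rule finite_subset)
  show "generating_pairs Q R \<subseteq> F_class S F Q \<times> carrier S"
  proof
    fix x assume "x \<in> generating_pairs Q R"
    then obtain Q' s where x: "x = (Q', s)" "Q' \<in> F_class S F Q" "s \<in> normalizer S Q'"
      by (auto simp: generating_pairs_def)
    have "subgroup Q' S" using x(2) by (simp add: mem_F_class F_conj_def)
    then show "x \<in> F_class S F Q \<times> carrier S"
      using x subgroup.subset[OF normalizer_subgroup] by auto
  qed
qed (simp add: finite_F_class finite_carrier)

lemma generating_pairs_le:
  assumes "F_conj S F R R'" shows "card (generating_pairs Q R) \<le> card (generating_pairs Q R')"
proof -
  obtain \<phi> where R: "subgroup R S" and \<phi>: "\<phi> \<in> F R (carrier S)" "\<phi> ` R = R'"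
    using assms unfolding F_conj_iff by blast
  let ?g = "\<lambda>(Q', s). (\<phi> ` Q', \<phi> s)"
  have inR: "subgroup Q' S" "Q' \<subseteq> R" "s \<in> R" "R \<subseteq> normalizer S Q'" if "(Q', s) \<in> generating_pairs Q R" for Q' s
    using that generate_in_normalizer[of Q' s] by (auto simp: generating_pairs_def mem_F_class F_conj_def)
  have inj: "inj_on \<phi> R" by (rule morphismD(3)[OF R carrier_subgroup \<phi>(1)])
  have "inj_on ?g (generating_pairs Q R)"
  proof (rule inj_onI)
    fix a b assume ab: "a \<in> generating_pairs Q R" "b \<in> generating_pairs Q R" "?g a = ?g b"
    obtain Q1 s1 Q2 s2 where [simp]: "a = (Q1, s1)" "b = (Q2, s2)" by fastforce
    have "Q1 = Q2" using ab inR inj_on_image_eq_iff[OF inj, of Q1 Q2] by auto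
    moreover have "s1 = s2" using ab inR inj_onD[OF inj, of s1 s2] by auto
    ultimately show "a = b" by simp
  qed
  moreover have "?g a \<in> generating_pairs Q R'" if "a \<in> generating_pairs Q R" for a
  proof -
    obtain Q1 s where a: "a = (Q1, s)" by fastforce
    note in1 = inR[OF that[unfolded a]]
    have Q1: "F_conj S F Q Q1" and gen: "adjoin s Q1 = R"
      using that a by (auto simp: generating_pairs_def mem_F_class)
    have "F_conj S F Q1 (restrict \<phi> Q1 ` Q1)"
      by (rule F_conjI[OF in1(1) morphism_restrict[OF R carrier_subgroup \<phi>(1) in1(1,2)]])
    then have "F_conj S F Q (\<phi> ` Q1)" using F_conj_trans[OF Q1] by simp
    moreover have "\<phi> s \<in> normalizer S (\<phi> ` Q1)"
      using normalizer_morphism[OF R \<phi>(1) in1(1,2,4)] in1(3) by blast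
    moreover have "adjoin (\<phi> s) (\<phi> ` Q1) = R'"
      using generate_image[OF R \<phi>(1), of "insert s Q1"] in1(2,3) gen \<phi>(2) by simp
    ultimately show ?thesis by (simp add: a generating_pairs_def mem_F_class)
  qed
  ultimately show ?thesis by (intro card_inj_on_le[OF _ _ finite_generating_pairs]) auto
qed

lemma sum_over_pairs:
  fixes h :: "'g set \<Rightarrow> rat"
  shows "(\<Sum>Q'\<in>F_class S F Q. \<Sum>s\<in>normalizer S Q'. h (adjoin s Q'))
    = (\<Sum>R | subgroup R S. of_nat (card (generating_pairs Q R)) * h R)"
proof -
  let ?T = "SIGMA Q':F_class S F Q. normalizer S Q'" and ?gen = "\<lambda>(Q', s). adjoin s Q'"
  have sub: "subgroup Q' S" if "Q' \<in> F_class S F Q" for Q' using that by (simp add: mem_F_class F_conj_def)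
  have fin: "finite (normalizer S Q')" if "Q' \<in> F_class S F Q" for Q'
    using sub[OF that] by (intro finite_subgroup normalizer_subgroup)
  have finT: "finite ?T" using fin by (intro finite_SigmaI finite_F_class)
  have "(\<Sum>Q'\<in>F_class S F Q. \<Sum>s\<in>normalizer S Q'. h (adjoin s Q')) = (\<Sum>x\<in>?T. h (?gen x))"
    using fin by (subst sum.Sigma) (auto simp: finite_F_class split_def)
  also have "\<dots> = (\<Sum>R | subgroup R S. \<Sum>x\<in>{x \<in> ?T. ?gen x = R}. h (?gen x))"
    using generate_in_normalizer(1) sub
    by (intro sum.group[symmetric] finT finite_subgroups) auto
  also have "\<dots> = (\<Sum>R | subgroup R S. of_nat (card (generating_pairs Q R)) * h R)"
  proof (rule sum.cong[OF refl])
    fix R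
    have "{x \<in> ?T. ?gen x = R} = generating_pairs Q R" by (auto simp: generating_pairs_def)
    moreover have "(\<Sum>x\<in>{x \<in> ?T. ?gen x = R}. h (?gen x)) = (\<Sum>x\<in>{x \<in> ?T. ?gen x = R}. h R)"
      by (rule sum.cong) auto
    ultimately show "(\<Sum>x\<in>{x \<in> ?T. ?gen x = R}. h (?gen x)) = of_nat (card (generating_pairs Q R)) * h R"
      by simp
  qed
  finally show ?thesis .
qed

lemma class_average_sum_over_pairs:
  "(\<Sum>Q'\<in>F_class S F Q. \<Sum>s\<in>normalizer S Q'. class_average f (adjoin s Q'))
    = (\<Sum>Q'\<in>F_class S F Q. \<Sum>s\<in>normalizer S Q'. f (adjoin s Q'))"
  unfolding sum_over_pairs
proof (rule class_average_weighted_sum)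
  show "rat_of_nat (card (generating_pairs Q R')) = of_nat (card (generating_pairs Q R))"
    if "F_conj S F R R'" for R R'
    using generating_pairs_le that F_conj_sym by (metis order_antisym)
qed

text \<open>The congruence at $Q'$ holds modulo $|N_S(Q')|$, and $|S : N_S(Q')|$ conjugates of $Q'$ under \<open>S\<close>
  contribute the same sum.\<close>

lemma lattice_class_congruence:
  assumes f: "f \<in> mark_lattice"
  shows "(\<Sum>Q'\<in>F_class S F Q. \<Sum>s\<in>normalizer S Q'. f (adjoin s Q')) / of_nat (order S) \<in> p_int p"
proof -
  let ?s = "\<lambda>Q'. \<Sum>s\<in>normalizer S Q'. f (adjoin s Q')"
  let ?z = "\<lambda>Q'. ?s Q' / of_nat (card (normalizer S Q'))"
  have sub: "subgroup Q' S" if "Q' \<in> F_class S F Q" for Q' using that by (simp add: mem_F_class F_conj_def)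
  have conj_sum: "?s (conj_map S g ` Q') = ?s Q'" if Q': "subgroup Q' S" and g: "g \<in> carrier S" for Q' g
  proof -
    let ?c = "conj_map S g"
    have N: "normalizer S Q' \<subseteq> carrier S" by (rule subgroup.subset[OF normalizer_subgroup[OF Q']])
    have "?s (?c ` Q') = (\<Sum>s\<in>normalizer S Q'. f (adjoin (?c s) (?c ` Q')))"
      unfolding normalizer_conj[OF Q' g] by (rule sum.reindex_cong[OF conj_map_inj[OF g N]]) auto
    also have "\<dots> = ?s Q'"
    proof (rule sum.cong[OF refl])
      fix s assume s: "s \<in> normalizer S Q'"
      have "generate S (?c ` insert s Q') = ?c ` adjoin s Q'"
        using group_hom.generate_img[OF conj_map_hom[OF g], of "insert s Q'"] s N subgroup.subset[OF Q'] by auto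
      then show "f (adjoin (?c s) (?c ` Q')) = f (adjoin s Q')"
        using lattice_conj[OF f generate_in_normalizer(1)[OF Q' s] g] by simp
    qed
    finally show ?thesis .
  qed
  have "(\<Sum>Q'\<in>F_class S F Q. of_nat (card (normalizer S Q')) * ?z Q') / of_nat (order S) \<in> p_int p"
  proof (rule conj_closed_sum[OF prime_p])
    fix Q' assume Q': "Q' \<in> F_class S F Q"
    show "subgroup Q' S" by (rule sub[OF Q'])
    show "?z Q' \<in> p_int p" by (intro lattice_congruence f sub Q' normalizer_subgroup) simp
    fix g assume g: "g \<in> carrier S"
    show "conj_map S g ` Q' \<in> F_class S F Q"
      using Q' F_conj_trans F_conj_conj[OF sub[OF Q'] g] by (auto simp: mem_F_class)
    show "?z (conj_map S g ` Q') = ?z Q'"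
      by (simp add: conj_sum[OF sub[OF Q'] g] card_normalizer_conj[OF sub[OF Q'] g])
  qed
  moreover have "of_nat (card (normalizer S Q')) * ?z Q' = ?s Q'" if "Q' \<in> F_class S F Q" for Q'
    using subgroup_card_pos[OF normalizer_subgroup[OF sub[OF that]]] by simp
  ultimately show ?thesis by (simp cong: sum.cong)
qed

lemma proper_generate_card:
  assumes "subgroup Q S" "s \<in> normalizer S Q" "s \<notin> Q"
  shows "card Q < card (adjoin s Q)"
  using generate_in_normalizer[OF assms(1,2)] assms(3)
  by (intro psubset_card_mono finite_subgroup) auto

lemma normalizer_sum_difference:
  fixes a b :: "'g \<Rightarrow> rat"
  assumes "subgroup Q S" "\<And>s. s \<in> normalizer S Q \<Longrightarrow> s \<notin> Q \<Longrightarrow> a s = b s"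
    and "\<And>s. s \<in> Q \<Longrightarrow> a s - b s = d"
  shows "(\<Sum>s\<in>normalizer S Q. a s) - (\<Sum>s\<in>normalizer S Q. b s) = of_nat (card Q) * d"
proof -
  have "(\<Sum>s\<in>normalizer S Q. a s) - (\<Sum>s\<in>normalizer S Q. b s) = (\<Sum>s\<in>normalizer S Q. a s - b s)"
    by (simp add: sum_subtractf)
  also have "\<dots> = (\<Sum>s\<in>Q. a s - b s)"
    by (rule sum.mono_neutral_right)
      (use assms subgroup_le_normalizer finite_subgroup normalizer_subgroup in auto)
  also have "\<dots> = of_nat (card Q) * d" using assms(3) by simp
  finally show ?thesis .
qed

end

context saturated_fusion_system
begin

text \<open>Let a mark function \<open>h\<close> be constant on classes above the order of \<open>Q\<close>. Restricting along an
  extension of $Q \cong Q^*$ to $N_S(Q)$ gives a second congruence for the same group, and all terms but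
  those at \<open>Q\<close> and $Q^*$ cancel.\<close>

lemma lattice_conjugate_congruence:
  assumes h: "h \<in> mark_lattice" and conj: "F_conj S F Q Q'" and fn: "fully_normalized S F Q'"
    and top: "\<And>R R'. F_conj S F R R' \<Longrightarrow> card R > card Q \<Longrightarrow> h R' = h R"
  shows "(h Q - h Q') * of_nat (card Q) / of_nat (card (normalizer S Q)) \<in> p_int p"
proof -
  have Q: "subgroup Q S" and Q': "subgroup Q' S" using conj by (auto simp: F_conj_def)
  let ?N = "normalizer S Q"
  have N: "subgroup ?N S" by (rule normalizer_subgroup[OF Q])
  have QN: "Q \<subseteq> ?N" by (rule subgroup_le_normalizer[OF Q])
  obtain \<phi> where \<phi>: "\<phi> \<in> F ?N (carrier S)" "\<phi> ` Q = Q'" "\<phi> ` ?N \<subseteq> normalizer S Q'"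
    by (rule extend_to_normalizer[OF conj fn])
  have inj: "inj_on \<phi> ?N" by (rule morphismD(3)[OF N carrier_subgroup \<phi>(1)])
  have im: "subgroup (\<phi> ` ?N) S" by (rule morphism_image_subgroup[OF N carrier_subgroup \<phi>(1) N]) simp
  let ?a = "\<lambda>s. h (adjoin s Q)" and ?b = "\<lambda>s. h (adjoin (\<phi> s) Q')"
  have "(\<Sum>s\<in>?N. ?a s) / of_nat (card ?N) \<in> p_int p"
    by (rule lattice_congruence[OF h Q N]) simp
  moreover have "(\<Sum>t\<in>\<phi> ` ?N. h (adjoin t Q')) / of_nat (card (\<phi> ` ?N)) \<in> p_int p"
    by (rule lattice_congruence[OF h Q' im \<phi>(3)])
  then have "(\<Sum>s\<in>?N. ?b s) / of_nat (card ?N) \<in> p_int p"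
    by (simp add: sum.reindex[OF inj] card_image[OF inj] o_def)
  ultimately have "((\<Sum>s\<in>?N. ?a s) - (\<Sum>s\<in>?N. ?b s)) / of_nat (card ?N) \<in> p_int p"
    using p_int_diff[OF prime_p] by (simp add: diff_divide_distrib)
  also have "(\<Sum>s\<in>?N. ?a s) - (\<Sum>s\<in>?N. ?b s) = of_nat (card Q) * (h Q - h Q')"
  proof (rule normalizer_sum_difference[OF Q])
    fix s assume s: "s \<in> ?N" "s \<notin> Q"
    let ?R = "adjoin s Q"
    note R = generate_in_normalizer[OF Q s(1)]
    have "\<phi> ` ?R = adjoin (\<phi> s) Q'"
      using generate_image[OF N \<phi>(1), of "insert s Q"] s(1) QN \<phi>(2) by simp
    moreover have "F_conj S F ?R (restrict \<phi> ?R ` ?R)"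
      by (rule F_conjI[OF R(1) morphism_restrict[OF N carrier_subgroup \<phi>(1) R(1,2)]])
    ultimately have "F_conj S F ?R (adjoin (\<phi> s) Q')" by simp
    then show "?a s = ?b s" using top proper_generate_card[OF Q s] by simp
  next
    fix s assume "s \<in> Q"
    then have "\<phi> s \<in> Q'" using \<phi>(2) by blast
    then show "?a s - ?b s = h Q - h Q'"
      by (simp only: generate_of_subgroup[OF Q \<open>s \<in> Q\<close>] generate_of_subgroup[OF Q'])
  qed
  finally show ?thesis by (simp add: mult.commute)
qed

lemma p_int_card_ratio:
  assumes "subgroup H S" "subgroup K S" "card H \<le> card K"
  shows "of_nat (card K) / of_nat (card H) \<in> p_int p"
proof -
  obtain i j where ij: "card H = p ^ i" "card K = p ^ j"
    using p_subgroup_card assms(1,2) by meson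
  have "i \<le> j"
    by (rule power_le_imp_le_exp[OF prime_gt_1_nat[OF prime_p]]) (use assms(3) in \<open>simp add: ij\<close>)
  then have "card H dvd card K" unfolding ij by (rule le_imp_power_dvd)
  then obtain k where k: "card K = card H * k" by (auto simp: dvd_def)
  have "of_nat (card K) / of_nat (card H) = (of_nat k :: rat)"
    unfolding k using subgroup_card_pos[OF assms(1)] by simp
  then show ?thesis by (simp add: p_int_of_nat[OF prime_p])
qed

text \<open>Above the order of \<open>Q\<close> the average $\bar f$ and \<open>h\<close> agree, so the difference of their congruences, summed over the
  class of \<open>Q\<close>, is the sum of $|Q|\,(\bar f(P) - h(P))$. Up to multiples of the modulus $|S|$, each $h(P)$ can be
  replaced by $h(Q)$, and the number of terms is $|S : N_S(Q)|$ up to a factor prime to \<open>p\<close>.\<close>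

lemma class_average_top_congruence:
  assumes f: "f \<in> mark_lattice" and h: "h \<in> mark_lattice"
    and Q: "subgroup Q S" and fn: "fully_normalized S F Q"
    and top: "\<And>R. subgroup R S \<Longrightarrow> card R > card Q \<Longrightarrow> h R = class_average f R"
  shows "(class_average f Q - h Q) * of_nat (card Q) / of_nat (card (normalizer S Q)) \<in> p_int p"
proof -
  let ?K = "F_class S F Q" and ?e = "class_average f" and ?o = "of_nat (order S) :: rat"
  have K: "F_conj S F Q P" "subgroup P S" "card P = card Q" if "P \<in> ?K" for P
    using that F_conj_card by (auto simp: mem_F_class F_conj_def)
  have hconj: "h R' = h R" if "F_conj S F R R'" "card R > card Q" for R R'
  proof -
    have "subgroup R S" "subgroup R' S" "card R' > card Q"
      using that F_conj_card[OF that(1)] by (auto simp: F_conj_def)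
    then show ?thesis using top that class_average_conj[OF that(1)] by metis
  qed
  let ?sum = "\<lambda>u. \<Sum>P\<in>?K. \<Sum>s\<in>normalizer S P. u (adjoin s P) :: rat"
  have "?sum ?e - ?sum h = (\<Sum>P\<in>?K. of_nat (card P) * (?e P - h P))"
    unfolding sum_subtractf[symmetric]
  proof (rule sum.cong[OF refl], unfold sum_subtractf, rule normalizer_sum_difference)
    fix P assume P: "P \<in> ?K"
    show "subgroup P S" by (rule K[OF P])
    show "?e (adjoin s P) = h (adjoin s P)" if "s \<in> normalizer S P" "s \<notin> P" for s
      using top generate_in_normalizer(1)[OF K(2)[OF P] that(1)] proper_generate_card[OF K(2)[OF P] that] K(3)[OF P]
      by simp
    show "?e (adjoin s P) - h (adjoin s P) = ?e P - h P" if "s \<in> P" for s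
      using generate_of_subgroup[OF K(2)[OF P] that] by simp
  qed
  moreover have "?sum ?e = ?sum f" by (rule class_average_sum_over_pairs)
  ultimately have diff: "?sum f - ?sum h = (\<Sum>P\<in>?K. of_nat (card P) * (?e P - h P))" by (simp only:)
  have "(?sum f - ?sum h) / ?o \<in> p_int p"
    unfolding diff_divide_distrib
    by (rule p_int_diff[OF prime_p lattice_class_congruence[OF f] lattice_class_congruence[OF h]])
  then have 1: "(\<Sum>P\<in>?K. of_nat (card P) * (?e P - h P)) / ?o \<in> p_int p" unfolding diff .
  let ?y = "\<lambda>P. (h P - h Q) * of_nat (card P) / of_nat (card (normalizer S P)) :: rat"
  have "(\<Sum>P\<in>?K. of_nat (card (normalizer S P)) * ?y P) / ?o \<in> p_int p"
  proof (rule conj_closed_sum[OF prime_p])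
    fix P assume P: "P \<in> ?K"
    show "subgroup P S" by (rule K[OF P])
    show "?y P \<in> p_int p"
      by (rule lattice_conjugate_congruence[OF h F_conj_sym[OF K(1)[OF P]] fn]) (use hconj K(3)[OF P] in simp)
    fix g assume g: "g \<in> carrier S"
    show "conj_map S g ` P \<in> ?K"
      using F_conj_trans[OF K(1)[OF P] F_conj_conj[OF K(2)[OF P] g]] by (simp add: mem_F_class)
    show "?y (conj_map S g ` P) = ?y P"
      using lattice_conj[OF h K(2)[OF P] g] card_normalizer_conj[OF K(2)[OF P] g]
        conj_image_card[OF g subgroup.subset[OF K(2)[OF P]]] by simp
  qed
  moreover have "of_nat (card (normalizer S P)) * ?y P = of_nat (card P) * (h P - h Q)" if "P \<in> ?K" for P
    using subgroup_card_pos[OF normalizer_subgroup[OF K(2)[OF that]]] by simp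
  ultimately have 2: "(\<Sum>P\<in>?K. of_nat (card P) * (h P - h Q)) / ?o \<in> p_int p" by (simp cong: sum.cong)
  have "(\<Sum>P\<in>?K. of_nat (card P) * (?e P - h P)) + (\<Sum>P\<in>?K. of_nat (card P) * (h P - h Q))
      = (\<Sum>P\<in>?K. of_nat (card Q) * (?e Q - h Q))"
    unfolding sum.distrib[symmetric]
  proof (rule sum.cong[OF refl])
    fix P assume P: "P \<in> ?K"
    show "of_nat (card P) * (?e P - h P) + of_nat (card P) * (h P - h Q) = of_nat (card Q) * (?e Q - h Q)"
      using class_average_conj[OF K(1)[OF P], of f] K(3)[OF P] by (simp add: algebra_simps)
  qed
  moreover have "((\<Sum>P\<in>?K. of_nat (card P) * (?e P - h P)) + (\<Sum>P\<in>?K. of_nat (card P) * (h P - h Q))) / ?o \<in> p_int p"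
    unfolding add_divide_distrib by (rule p_int_add[OF prime_p 1 2])
  ultimately have 3: "of_nat (card ?K) * (of_nat (card Q) * (?e Q - h Q)) / ?o \<in> p_int p" by simp
  obtain w where w: "w \<in> p_int p" "of_nat (card ?K) * of_nat (card (normalizer S Q)) / ?o * w = 1"
    using card_F_class_unit[OF Q fn] by blast
  have "card (normalizer S Q) > 0" by (intro subgroup_card_pos normalizer_subgroup Q)
  then have "(?e Q - h Q) * of_nat (card Q) / of_nat (card (normalizer S Q))
      = (?e Q - h Q) * of_nat (card Q) / of_nat (card (normalizer S Q))
        * (of_nat (card ?K) * of_nat (card (normalizer S Q)) / ?o * w)"
    unfolding w(2) by simp
  also have "\<dots> = of_nat (card ?K) * (of_nat (card Q) * (?e Q - h Q)) / ?o * w"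
    using \<open>card (normalizer S Q) > 0\<close> by simp
  finally show ?thesis using p_int_mult[OF prime_p 3 w(1)] by simp
qed

text \<open>For any \<open>Q\<close>, compare with a fully normalized conjugate $Q'$: the average takes the same value there, and
  \<open>h\<close> takes a congruent one.\<close>

theorem class_average_in_lattice:
  assumes f: "f \<in> mark_lattice"
  shows "class_average f \<in> mark_lattice"
proof (rule lattice_criterion)
  show "class_average f (conj_map S g ` Q) = class_average f Q" if "subgroup Q S" "g \<in> carrier S" for Q g
    using class_average_conj[OF F_conj_conj[OF that]] by simp
next
  fix Q h assume Q: "subgroup Q S" and h: "h \<in> mark_lattice"
    and top: "\<And>R. subgroup R S \<Longrightarrow> card R > card Q \<Longrightarrow> h R = class_average f R"
  obtain Q' where Q': "F_conj S F Q Q'" "fully_normalized S F Q'" using exists_fully_normalized[OF Q] by blast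
  have Qs: "subgroup Q' S" and card: "card Q' = card Q" using Q'(1) F_conj_card by (auto simp: F_conj_def)
  let ?e = "class_average f" and ?n = "\<lambda>P. of_nat (card (normalizer S P)) :: rat" and ?c = "of_nat (card Q) :: rat"
  have e: "?e Q = ?e Q'" by (rule class_average_conj[OF Q'(1)])
  have "(?e Q' - h Q') * ?c / ?n Q' \<in> p_int p"
    using class_average_top_congruence[OF f h Qs Q'(2)] top card by simp
  moreover have "?n Q' / ?n Q \<in> p_int p"
    using fully_normalized_le[OF Q'(2) F_conj_sym[OF Q'(1)]]
    by (intro p_int_card_ratio normalizer_subgroup Q Qs)
  ultimately have "(?e Q' - h Q') * ?c / ?n Q' * (?n Q' / ?n Q) \<in> p_int p" by (rule p_int_mult[OF prime_p])
  then have "(?e Q' - h Q') * ?c / ?n Q \<in> p_int p"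
    using subgroup_card_pos[OF normalizer_subgroup[OF Qs]] by simp
  moreover have "(h Q - h Q') * ?c / ?n Q \<in> p_int p"
  proof (rule lattice_conjugate_congruence[OF h Q'])
    fix R R' assume R: "F_conj S F R R'" "card R > card Q"
    then have "subgroup R S" "subgroup R' S" "card R' > card Q" using F_conj_card[OF R(1)] by (auto simp: F_conj_def)
    then show "h R' = h R" using top R class_average_conj[OF R(1)] by metis
  qed
  ultimately have "(?e Q' - h Q') * ?c / ?n Q - (h Q - h Q') * ?c / ?n Q \<in> p_int p" by (rule p_int_diff[OF prime_p])
  moreover have "(?e Q' - h Q') * ?c / ?n Q - (h Q - h Q') * ?c / ?n Q = (?e Q - h Q) * ?c / ?n Q"
    unfolding e by (simp add: diff_divide_distrib[symmetric] left_diff_distrib[symmetric])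
  ultimately show "(?e Q - h Q) * ?c / ?n Q \<in> p_int p" by simp
qed

end

section \<open>Stable elements and the transfer map\<close>

text \<open>The mark at \<open>Q\<close> of the restriction along \<open>\<phi>\<close> is the mark at \<open>\<phi>(Q)\<close>, and restrictions are determined by
  their marks.\<close>

lemma (in fusion_system) F_stable_iff:
  assumes x: "x \<in> carrier Ap"
  shows "F_stable S p F x \<longleftrightarrow> (\<forall>Q R. F_conj S F Q R \<longrightarrow> loc_mark R x = loc_mark Q x)"
proof -
  have fin: "finite_group_at_prime (S\<lparr>carrier := P\<rparr>) p" if "subgroup P S" for P
    using subgroup_imp_group[OF that] finite_subgroup[OF that] prime_p
    by (simp add: finite_group_at_prime_def finite_group_at_prime_axioms_def finite_group_def
        finite_group_axioms_def)
  have hom: "\<phi> \<in> hom (S\<lparr>carrier := P\<rparr>) S" if "subgroup P S" "\<phi> \<in> F P (carrier S)" for P \<phi>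
    using morphismD(2)[OF that(1) carrier_subgroup that(2)] by (simp add: hom_def)
  have incl: "(\<lambda>u\<in>P. u) \<in> F P (carrier S)" if "subgroup P S" for P
    by (rule inclusion[OF that carrier_subgroup subgroup.subset[OF that]])
  note res = loc_res[OF finite_group_at_prime_axioms fin hom x]
  show ?thesis
  proof
    assume st: "F_stable S p F x"
    show "\<forall>Q R. F_conj S F Q R \<longrightarrow> loc_mark R x = loc_mark Q x"
    proof (intro allI impI)
      fix Q R assume "F_conj S F Q R"
      then obtain \<phi> where Q: "subgroup Q S" and \<phi>: "\<phi> \<in> F Q (carrier S)" "\<phi> ` Q = R"
        unfolding F_conj_iff by blast
      have QQ: "subgroup Q (S\<lparr>carrier := Q\<rparr>)" by (rule subgroup_incl[OF Q Q]) simp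
      have "loc_res p (S\<lparr>carrier := Q\<rparr>) \<phi> x = loc_res p (S\<lparr>carrier := Q\<rparr>) (\<lambda>u\<in>Q. u) x"
        using st Q \<phi>(1) by (simp add: F_stable_def)
      then have "loc_mark (\<phi> ` Q) x = loc_mark ((\<lambda>u\<in>Q. u) ` Q) x"
        using res(2)[OF Q Q \<phi>(1) QQ] res(2)[OF Q Q incl[OF Q] QQ] by simp
      then show "loc_mark R x = loc_mark Q x" using \<phi>(2) by simp
    qed
  next
    assume inv: "\<forall>Q R. F_conj S F Q R \<longrightarrow> loc_mark R x = loc_mark Q x"
    show "F_stable S p F x" unfolding F_stable_def
    proof (intro allI impI)
      fix P \<phi> assume P: "subgroup P S" and \<phi>: "\<phi> \<in> F P (carrier S)"
      interpret P: finite_group_at_prime "S\<lparr>carrier := P\<rparr>" p by (rule fin[OF P])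
      show "loc_res p (S\<lparr>carrier := P\<rparr>) \<phi> x = loc_res p (S\<lparr>carrier := P\<rparr>) (\<lambda>u\<in>P. u) x"
      proof (rule P.loc_eqI)
        fix Q assume Q: "subgroup Q (S\<lparr>carrier := P\<rparr>)"
        have QS: "subgroup Q S" and QP: "Q \<subseteq> P"
          using incl_subgroup[OF P Q] subgroup.subset[OF Q] by auto
        have "F_conj S F Q (restrict \<phi> Q ` Q)"
          by (rule F_conjI[OF QS morphism_restrict[OF P carrier_subgroup \<phi> QS QP]])
        moreover have "(\<lambda>u\<in>P. u) ` Q = Q" using QP by force
        ultimately show "loc_mark Q (loc_res p (S\<lparr>carrier := P\<rparr>) \<phi> x)
            = loc_mark Q (loc_res p (S\<lparr>carrier := P\<rparr>) (\<lambda>u\<in>P. u) x)"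
          using inv res(2)[OF P P \<phi> Q] res(2)[OF P P incl[OF P] Q] by simp
      qed (intro res(1) P \<phi> incl)+
    qed
  qed
qed

context saturated_fusion_system
begin

abbreviation "AF \<equiv> stable_burnside S p F"

lemma AF_carrier:
  "x \<in> carrier AF \<longleftrightarrow> x \<in> carrier Ap \<and> (\<forall>Q R. F_conj S F Q R \<longrightarrow> loc_mark R x = loc_mark Q x)"
  using F_stable_iff by (auto simp: stable_burnside_def)

lemma AF_I:
  assumes "x \<in> carrier Ap"
    and "\<And>Q R. subgroup Q S \<Longrightarrow> subgroup R S \<Longrightarrow> F_conj S F Q R \<Longrightarrow> loc_mark R x = loc_mark Q x"
  shows "x \<in> carrier AF"
  using assms F_conj_subgroups by (simp add: AF_carrier)

lemma AF_eqI:
  assumes "x \<in> carrier AF" "y \<in> carrier AF" "\<And>Q. subgroup Q S \<Longrightarrow> loc_mark Q x = loc_mark Q y"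
  shows "x = y"
  using assms by (intro loc_eqI) (simp_all add: AF_carrier)

lemma AF_add:
  assumes "x \<in> carrier AF" "y \<in> carrier AF"
  shows "x \<oplus>\<^bsub>AF\<^esub> y \<in> carrier AF"
    and "subgroup Q S \<Longrightarrow> loc_mark Q (x \<oplus>\<^bsub>AF\<^esub> y) = loc_mark Q x + loc_mark Q y"
proof -
  have op: "x \<oplus>\<^bsub>AF\<^esub> y = x \<oplus>\<^bsub>Ap\<^esub> y" by (simp add: stable_burnside_def)
  show "subgroup Q S \<Longrightarrow> loc_mark Q (x \<oplus>\<^bsub>AF\<^esub> y) = loc_mark Q x + loc_mark Q y"
    using assms by (simp add: op loc_add AF_carrier)
  show "x \<oplus>\<^bsub>AF\<^esub> y \<in> carrier AF"
    by (rule AF_I) (use assms in \<open>simp_all add: AF_carrier op loc_add\<close>)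
qed

lemma AF_zero:
  shows "\<zero>\<^bsub>AF\<^esub> \<in> carrier AF" and "subgroup Q S \<Longrightarrow> loc_mark Q \<zero>\<^bsub>AF\<^esub> = 0"
proof -
  have op: "\<zero>\<^bsub>AF\<^esub> = \<zero>\<^bsub>Ap\<^esub>" by (simp add: stable_burnside_def)
  show "subgroup Q S \<Longrightarrow> loc_mark Q \<zero>\<^bsub>AF\<^esub> = 0" by (simp add: op loc_zero)
  show "\<zero>\<^bsub>AF\<^esub> \<in> carrier AF" by (rule AF_I) (simp_all add: op loc_zero)
qed

lemma AF_smult:
  assumes "r \<in> p_int p" "x \<in> carrier AF"
  shows "r \<odot>\<^bsub>AF\<^esub> x \<in> carrier AF"
    and "subgroup Q S \<Longrightarrow> loc_mark Q (r \<odot>\<^bsub>AF\<^esub> x) = r * loc_mark Q x"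
proof -
  have op: "r \<odot>\<^bsub>AF\<^esub> x = r \<odot>\<^bsub>Ap\<^esub> x" by (simp add: stable_burnside_def)
  show "subgroup Q S \<Longrightarrow> loc_mark Q (r \<odot>\<^bsub>AF\<^esub> x) = r * loc_mark Q x"
    using assms by (simp add: op loc_smult AF_carrier)
  show "r \<odot>\<^bsub>AF\<^esub> x \<in> carrier AF"
    by (rule AF_I) (use assms in \<open>simp_all add: AF_carrier op loc_smult\<close>)
qed

lemma AF_abelian_monoid: "abelian_monoid AF"
proof (rule abelian_monoidI)
  fix x y z assume xyz: "x \<in> carrier AF" "y \<in> carrier AF"
  show "x \<oplus>\<^bsub>AF\<^esub> y \<in> carrier AF" using xyz by (rule AF_add)
  show "x \<oplus>\<^bsub>AF\<^esub> y = y \<oplus>\<^bsub>AF\<^esub> x" by (rule AF_eqI) (simp_all add: AF_add xyz)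
  show "\<zero>\<^bsub>AF\<^esub> \<oplus>\<^bsub>AF\<^esub> x = x" by (rule AF_eqI) (simp_all add: AF_add AF_zero xyz)
  show "x \<oplus>\<^bsub>AF\<^esub> y \<oplus>\<^bsub>AF\<^esub> z = x \<oplus>\<^bsub>AF\<^esub> (y \<oplus>\<^bsub>AF\<^esub> z)" if "z \<in> carrier AF"
    by (rule AF_eqI) (simp_all add: AF_add xyz that)
qed (rule AF_zero)

lemma AF_finsum:
  assumes "finite I" "x \<in> I \<rightarrow> carrier AF"
  shows "(\<Oplus>\<^bsub>AF\<^esub>i\<in>I. x i) \<in> carrier AF"
    and "subgroup Q S \<Longrightarrow> loc_mark Q (\<Oplus>\<^bsub>AF\<^esub>i\<in>I. x i) = (\<Sum>i\<in>I. loc_mark Q (x i))"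
proof -
  interpret AF: abelian_monoid AF by (rule AF_abelian_monoid)
  show "(\<Oplus>\<^bsub>AF\<^esub>i\<in>I. x i) \<in> carrier AF" using assms(2) by (rule AF.finsum_closed)
  show "loc_mark Q (\<Oplus>\<^bsub>AF\<^esub>i\<in>I. x i) = (\<Sum>i\<in>I. loc_mark Q (x i))" if Q: "subgroup Q S"
    using assms
  proof (induction I rule: finite_induct)
    case empty
    then show ?case by (simp add: AF_zero Q)
  next
    case (insert i I)
    then have "(\<Oplus>\<^bsub>AF\<^esub>i\<in>I. x i) \<in> carrier AF" by (intro AF.finsum_closed) auto
    then show ?case using insert by (simp add: AF_add Q)
  qed
qed

text \<open>The average of the marks of \<open>x\<close> is a mark function, which gives existence, and a class function, which
  gives stability; uniqueness holds because marks determine an element.\<close>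

lemma transfer:
  assumes x: "x \<in> carrier Ap"
  shows "F_transfer S p F x \<in> carrier AF"
    and "subgroup Q S \<Longrightarrow> loc_mark Q (F_transfer S p F x) = class_average (\<lambda>R. loc_mark R x) Q"
proof -
  let ?e = "class_average (\<lambda>R. loc_mark R x)"
  let ?P = "\<lambda>y. y \<in> carrier AF \<and> (\<forall>Q. subgroup Q S \<longrightarrow> loc_mark Q y = ?e Q)"
  have "(\<lambda>R. loc_mark R x) \<in> mark_lattice" using x by (auto simp: mark_lattice_def)
  then have "?e \<in> mark_lattice" by (rule class_average_in_lattice)
  then obtain y where y: "y \<in> carrier Ap" "\<forall>Q. subgroup Q S \<longrightarrow> ?e Q = loc_mark Q y"
    by (auto simp: mark_lattice_def)
  have "y \<in> carrier AF"
  proof (rule AF_I[OF y(1)])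
    fix Q R assume "subgroup Q S" "subgroup R S" "F_conj S F Q R"
    then show "loc_mark R y = loc_mark Q y" using y(2) class_average_conj[of Q R] by metis
  qed
  then have Py: "?P y" using y(2) by simp
  have "?P (THE y. ?P y)"
  proof (rule theI[of ?P, OF Py])
    show "z = y" if "?P z" for z using that Py by (intro AF_eqI) simp_all
  qed
  moreover have eq: "F_transfer S p F x = (THE y. ?P y)" by (simp add: F_transfer_def class_average_def)
  ultimately have "?P (F_transfer S p F x)" unfolding eq by blast
  then show "F_transfer S p F x \<in> carrier AF"
    "subgroup Q S \<Longrightarrow> loc_mark Q (F_transfer S p F x) = ?e Q" by auto
qed

abbreviation "\<beta> \<equiv> beta S p F"

lemma beta_eq: "\<beta> P = F_transfer S p F (coset_class P)"
  by (simp add: beta_def coset_class_def)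

lemma beta_carrier: "subgroup P S \<Longrightarrow> \<beta> P \<in> carrier AF"
  unfolding beta_eq by (intro transfer coset_class)

lemma beta_mark:
  assumes P: "subgroup P S" and Q: "subgroup Q S"
  shows "loc_mark Q (\<beta> P) = class_average (\<lambda>R. of_int (gset_mark R (gset_cosets S P))) Q"
proof -
  have "(\<Sum>R\<in>F_class S F Q. loc_mark R (coset_class P))
      = (\<Sum>R\<in>F_class S F Q. of_int (gset_mark R (gset_cosets S P)))"
    by (rule sum.cong) (auto simp: coset_class P mem_F_class dest: F_conj_subgroups)
  then show ?thesis
    unfolding beta_eq using transfer(2)[OF coset_class(1)[OF P] Q] by (simp add: class_average_def)
qed

lemma card_filter_as_sum: "finite B \<Longrightarrow> int (card {x \<in> B. T x}) = (\<Sum>x\<in>B. if T x then 1 else 0)"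
  using sum.inter_filter[of B "\<lambda>_. 1 :: int" T] by simp

text \<open>Counting the pairs of a conjugate \<open>R\<close> of \<open>Q\<close> and an element \<open>g\<close> with $g^{-1}Rg \le P$ by \<open>g\<close> instead of by
  \<open>R\<close> shows that the marks of $\beta_P$ count the $\mathcal F$-conjugates of \<open>Q\<close> inside \<open>P\<close>.\<close>

lemma beta_mark_count:
  assumes P: "subgroup P S" and Q: "subgroup Q S"
  shows "loc_mark Q (\<beta> P) = of_nat (order S) / of_nat (card P)
    * (of_nat (card {R \<in> F_class S F Q. R \<subseteq> P}) / of_nat (card (F_class S F Q)))"
proof -
  let ?K = "F_class S F Q"
  have sub: "R \<subseteq> carrier S" "subgroup R S" if "R \<in> ?K" for R
    using that subgroup.subset by (auto simp: mem_F_class dest: F_conj_subgroups)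
  let ?c = "\<lambda>g R. conj_map S (inv g) ` R"
  have "(\<Sum>R\<in>?K. gset_mark R (gset_cosets S P) * int (card P))
      = (\<Sum>R\<in>?K. int (card {g \<in> carrier S. ?c g R \<subseteq> P}))"
    by (rule sum.cong) (auto simp: gset_mark_cosets[OF P sub(1)])
  also have "\<dots> = (\<Sum>R\<in>?K. \<Sum>g\<in>carrier S. if ?c g R \<subseteq> P then 1 else 0)"
    by (rule sum.cong) (simp_all add: card_filter_as_sum finite_carrier)
  also have "\<dots> = (\<Sum>g\<in>carrier S. \<Sum>R\<in>?K. if ?c g R \<subseteq> P then 1 else 0)" by (rule sum.swap)
  also have "\<dots> = (\<Sum>g\<in>carrier S. int (card {R \<in> ?K. R \<subseteq> P}))"
  proof (rule sum.cong[OF refl])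
    fix g assume g: "g \<in> carrier S"
    have cl: "conj_map S h ` R \<in> ?K" if "R \<in> ?K" "h \<in> carrier S" for R h
      using that F_conj_trans F_conj_conj[OF sub(2)[OF that(1)] that(2)] by (auto simp: mem_F_class)
    have id: "?c g (conj_map S g ` R) = R" "conj_map S g ` ?c g R = R" if "R \<in> ?K" for R
      using conj_image_mult[of "inv g" g R] conj_image_mult[of g "inv g" R] conj_image_one[of R] g sub(1)[OF that]
      by simp_all
    have "bij_betw (?c g) {R \<in> ?K. ?c g R \<subseteq> P} {R \<in> ?K. R \<subseteq> P}"
      by (rule bij_betwI[where g = "\<lambda>R. conj_map S g ` R"]) (use id cl g in auto)
    then have "card {R \<in> ?K. ?c g R \<subseteq> P} = card {R \<in> ?K. R \<subseteq> P}" by (rule bij_betw_same_card)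
    moreover have "(\<Sum>R\<in>?K. if ?c g R \<subseteq> P then 1 else 0) = int (card {R \<in> ?K. ?c g R \<subseteq> P})"
      by (simp add: card_filter_as_sum finite_F_class)
    ultimately show "(\<Sum>R\<in>?K. if ?c g R \<subseteq> P then 1 else 0) = int (card {R \<in> ?K. R \<subseteq> P})" by simp
  qed
  also have "\<dots> = int (order S * card {R \<in> ?K. R \<subseteq> P})" by (simp add: order_def)
  finally have "(\<Sum>R\<in>?K. gset_mark R (gset_cosets S P)) * int (card P) = int (order S * card {R \<in> ?K. R \<subseteq> P})"
    by (simp add: sum_distrib_right)
  then have "rat_of_int ((\<Sum>R\<in>?K. gset_mark R (gset_cosets S P)) * int (card P))
      = rat_of_int (int (order S * card {R \<in> ?K. R \<subseteq> P}))" by (simp only:)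
  then have "(\<Sum>R\<in>?K. rat_of_int (gset_mark R (gset_cosets S P))) * of_nat (card P)
      = of_nat (order S) * of_nat (card {R \<in> ?K. R \<subseteq> P})" by simp
  then have "(\<Sum>R\<in>?K. rat_of_int (gset_mark R (gset_cosets S P)))
      = of_nat (order S) * of_nat (card {R \<in> ?K. R \<subseteq> P}) / of_nat (card P)"
    using subgroup_card_pos[OF P] by (simp add: eq_divide_eq)
  then show ?thesis unfolding beta_mark[OF P Q] class_average_def by simp
qed

lemma conjugates_inside_le:
  assumes "F_conj S F P P'"
  shows "card {R \<in> F_class S F Q. R \<subseteq> P} \<le> card {R \<in> F_class S F Q. R \<subseteq> P'}"
proof -
  obtain \<phi> where P: "subgroup P S" and \<phi>: "\<phi> \<in> F P (carrier S)" "\<phi> ` P = P'"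
    using assms unfolding F_conj_iff by blast
  have "inj_on ((`) \<phi>) {R \<in> F_class S F Q. R \<subseteq> P}"
    by (rule inj_on_subset[OF inj_on_image_Pow[OF morphismD(3)[OF P carrier_subgroup \<phi>(1)]]]) auto
  moreover have "\<phi> ` R \<in> {R \<in> F_class S F Q. R \<subseteq> P'}" if "R \<in> F_class S F Q" "R \<subseteq> P" for R
  proof -
    have R: "F_conj S F Q R" "subgroup R S" using that(1) by (auto simp: mem_F_class dest: F_conj_subgroups)
    have "F_conj S F R (restrict \<phi> R ` R)"
      by (rule F_conjI[OF R(2) morphism_restrict[OF P carrier_subgroup \<phi>(1) R(2) that(2)]])
    then show ?thesis using F_conj_trans[OF R(1)] that(2) \<phi>(2) by (auto simp: mem_F_class)
  qed
  ultimately show ?thesis by (intro card_inj_on_le) (auto simp: finite_F_class)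
qed

lemma beta_conj:
  assumes "F_conj S F P P'" shows "\<beta> P = \<beta> P'"
proof (rule AF_eqI)
  have P: "subgroup P S" and P': "subgroup P' S" using assms by (auto dest: F_conj_subgroups)
  then show "\<beta> P \<in> carrier AF" "\<beta> P' \<in> carrier AF" by (auto intro: beta_carrier)
  fix Q assume Q: "subgroup Q S"
  have "card {R \<in> F_class S F Q. R \<subseteq> P} = card {R \<in> F_class S F Q. R \<subseteq> P'}"
    using conjugates_inside_le[OF assms, of Q] conjugates_inside_le[OF F_conj_sym[OF assms], of Q] by simp
  then show "loc_mark Q (\<beta> P) = loc_mark Q (\<beta> P')"
    using F_conj_card[OF assms] by (simp add: beta_mark_count P P' Q)
qed

lemma beta_mark_zero:
  assumes P: "subgroup P S" and Q: "subgroup Q S" and "card P \<le> card Q" "\<not> F_conj S F Q P"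
  shows "loc_mark Q (\<beta> P) = 0"
proof -
  have "{R \<in> F_class S F Q. R \<subseteq> P} = {}"
  proof (rule ccontr)
    assume "{R \<in> F_class S F Q. R \<subseteq> P} \<noteq> {}"
    then obtain R where R: "F_conj S F Q R" "R \<subseteq> P" by (auto simp: mem_F_class)
    then have "R = P" using assms(3) F_conj_card[OF R(1)] by (intro card_seteq finite_subgroup P) auto
    then show False using R(1) assms(4) by simp
  qed
  then show ?thesis unfolding beta_mark_count[OF P Q] by (simp only: card.empty of_nat_0 div_0 mult_zero_right)
qed

lemma beta_mark_self: assumes P: "subgroup P S" shows "loc_mark P (\<beta> P) \<noteq> 0"
proof -
  have "P \<in> {R \<in> F_class S F P. R \<subseteq> P}" using F_conj_refl[OF P] by (simp add: mem_F_class)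
  then have "card {R \<in> F_class S F P. R \<subseteq> P} \<noteq> 0" using finite_F_class by (auto simp: card_eq_0_iff)
  then show ?thesis
    using subgroup_card_pos[OF P] subgroup_card_pos[OF carrier_subgroup] F_class_card_pos[OF P]
    by (simp add: beta_mark_count P order_def)
qed

end


section \<open>The basis\<close>

locale fusion_class_representatives = saturated_fusion_system S p F
  for S :: "('g, 'm) monoid_scheme" (structure) and p F +
  fixes reps :: "'g set set"
  assumes reps: "reps \<subseteq> {P. subgroup P S}"
    and reps_unique: "\<And>P. subgroup P S \<Longrightarrow> \<exists>!R. R \<in> reps \<and> F_conj S F P R"
begin

lemma finite_reps: "finite reps"
  using reps finite_subgroups by (rule finite_subset)

lemma reps_subgroup: "R \<in> reps \<Longrightarrow> subgroup R S"
  using reps by blast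

abbreviation beta_sum :: "('g set \<Rightarrow> rat) \<Rightarrow> 'g burnside loc" where
  "beta_sum c \<equiv> \<Oplus>\<^bsub>AF\<^esub>i\<in>{i \<in> reps. c i \<noteq> 0}. c i \<odot>\<^bsub>AF\<^esub> \<beta> i"

lemma beta_combination:
  assumes c: "c \<in> reps \<rightarrow> p_int p"
  shows "beta_sum c \<in> carrier AF" "subgroup Q S \<Longrightarrow> loc_mark Q (beta_sum c) = (\<Sum>i\<in>reps. c i * loc_mark Q (\<beta> i))"
proof -
  let ?I = "{i \<in> reps. c i \<noteq> 0}"
  have fin: "finite ?I" using finite_reps by simp
  have cl: "(\<lambda>i. c i \<odot>\<^bsub>AF\<^esub> \<beta> i) \<in> ?I \<rightarrow> carrier AF"
    using c by (auto intro!: AF_smult beta_carrier reps_subgroup)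
  show "beta_sum c \<in> carrier AF" by (rule AF_finsum[OF fin cl])
  assume Q: "subgroup Q S"
  have "loc_mark Q (beta_sum c) = (\<Sum>i\<in>?I. loc_mark Q (c i \<odot>\<^bsub>AF\<^esub> \<beta> i))"
    by (rule AF_finsum(2)[OF fin cl Q])
  also have "\<dots> = (\<Sum>i\<in>?I. c i * loc_mark Q (\<beta> i))"
    using c by (intro sum.cong refl AF_smult Q) (auto intro: beta_carrier reps_subgroup)
  also have "\<dots> = (\<Sum>i\<in>reps. c i * loc_mark Q (\<beta> i))"
    by (rule sum.mono_neutral_left) (auto simp: finite_reps)
  finally show "loc_mark Q (beta_sum c) = (\<Sum>i\<in>reps. c i * loc_mark Q (\<beta> i))" .
qed

text \<open>A stable element is its own transfer, and the transfer is linear; so an expansion in the orbits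
  $[S/P]$ becomes one in the $\beta_P$.\<close>

lemma beta_spanning:
  assumes x: "x \<in> carrier AF"
  shows "\<exists>c\<in>reps \<rightarrow> p_int p. x = beta_sum c"
proof -
  let ?m = "\<lambda>P R. of_int (gset_mark R (gset_cosets S P)) :: rat"
  have xc: "x \<in> carrier Ap" and inv: "\<And>Q R. F_conj S F Q R \<Longrightarrow> loc_mark R x = loc_mark Q x"
    using x by (auto simp: AF_carrier)
  have "(\<lambda>Q. loc_mark Q x) \<in> mark_lattice" using xc by (auto simp: mark_lattice_def)
  then obtain d where d: "\<And>P. d P \<in> p_int p"
    "\<And>Q. subgroup Q S \<Longrightarrow> loc_mark Q x = (\<Sum>P | subgroup P S. d P * ?m P Q)"
    using lattice_decomposition[of "\<lambda>Q. loc_mark Q x"] by auto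
  define c where "c R = (\<Sum>P\<in>F_class S F R. d P)" for R
  have c: "c \<in> reps \<rightarrow> p_int p" unfolding c_def by (auto intro: p_int_sum[OF prime_p] d(1))
  define rep where "rep P = (THE R. R \<in> reps \<and> F_conj S F P R)" for P
  have rep: "rep P \<in> reps" "F_conj S F P (rep P)" if "subgroup P S" for P
    using theI'[OF reps_unique[OF that]] by (auto simp: rep_def)
  have fibre: "{P \<in> {P. subgroup P S}. rep P = R} = F_class S F R" if R: "R \<in> reps" for R
  proof (intro equalityI subsetI)
    fix P assume "P \<in> {P \<in> {P. subgroup P S}. rep P = R}"
    then show "P \<in> F_class S F R" using rep F_conj_sym by (auto simp: mem_F_class)
  next
    fix P assume "P \<in> F_class S F R"
    then have P: "F_conj S F P R" "subgroup P S" by (auto simp: mem_F_class intro: F_conj_sym dest: F_conj_subgroups)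
    then show "P \<in> {P \<in> {P. subgroup P S}. rep P = R}" using rep[OF P(2)] reps_unique[OF P(2)] R by auto
  qed
  have "x = beta_sum c"
  proof (rule AF_eqI[OF x beta_combination(1)[OF c]])
    fix Q assume Q: "subgroup Q S"
    have "loc_mark Q x = class_average (\<lambda>R. loc_mark R x) Q"
      by (rule class_average_invariant[symmetric]) (use Q inv in auto)
    also have "\<dots> = (\<Sum>R\<in>F_class S F Q. \<Sum>P | subgroup P S. d P * ?m P R) / of_nat (card (F_class S F Q))"
      unfolding class_average_def by (intro arg_cong2[where f = "(/)"] sum.cong refl) (auto simp: d(2) mem_F_class dest: F_conj_subgroups)
    also have "\<dots> = (\<Sum>P | subgroup P S. d P * class_average (?m P) Q)"
      unfolding class_average_def
      by (subst sum.swap) (simp add: sum_distrib_left sum_divide_distrib)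
    also have "\<dots> = (\<Sum>P | subgroup P S. d P * loc_mark Q (\<beta> P))"
      by (rule sum.cong) (simp_all add: beta_mark Q)
    also have "\<dots> = (\<Sum>R\<in>reps. \<Sum>P\<in>{P \<in> {P. subgroup P S}. rep P = R}. d P * loc_mark Q (\<beta> P))"
      by (rule sum.group[symmetric]) (use finite_subgroups finite_reps rep in auto)
    also have "\<dots> = (\<Sum>R\<in>reps. c R * loc_mark Q (\<beta> R))"
    proof (rule sum.cong[OF refl])
      fix R assume R: "R \<in> reps"
      have "(\<Sum>P\<in>F_class S F R. d P * loc_mark Q (\<beta> P)) = (\<Sum>P\<in>F_class S F R. d P * loc_mark Q (\<beta> R))"
        by (rule sum.cong) (auto simp: mem_F_class beta_conj)
      then show "(\<Sum>P\<in>{P \<in> {P. subgroup P S}. rep P = R}. d P * loc_mark Q (\<beta> P)) = c R * loc_mark Q (\<beta> R)"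
        unfolding fibre[OF R] c_def by (simp add: sum_distrib_right)
    qed
    also have "\<dots> = loc_mark Q (beta_sum c)"
      by (rule beta_combination(2)[OF c Q, symmetric])
    finally show "loc_mark Q x = loc_mark Q (beta_sum c)" .
  qed
  then show ?thesis using c by blast
qed

text \<open>The matrix of the marks of the $\beta_P$ is triangular with respect to the order of subgroups.\<close>

lemma beta_independent:
  assumes c: "c \<in> reps \<rightarrow> p_int p"
    and zero: "beta_sum c = \<zero>\<^bsub>AF\<^esub>"
  shows "\<forall>i\<in>reps. c i = 0"
proof (rule ccontr)
  assume "\<not> (\<forall>i\<in>reps. c i = 0)"
  let ?I = "{i \<in> reps. c i \<noteq> 0}"
  have fin: "finite ?I" and ne: "?I \<noteq> {}" using finite_reps \<open>\<not> (\<forall>i\<in>reps. c i = 0)\<close> by auto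
  then have "Max (card ` ?I) \<in> card ` ?I" by (intro Max_in) auto
  then obtain Q where Q: "Q \<in> reps" "c Q \<noteq> 0" "card Q = Max (card ` ?I)" by auto
  have max: "card P \<le> card Q" if "P \<in> ?I" for P using that fin unfolding Q(3) by (intro Max_ge) auto
  have Qs: "subgroup Q S" by (rule reps_subgroup[OF Q(1)])
  have "c P * loc_mark Q (\<beta> P) = 0" if P: "P \<in> reps" "P \<noteq> Q" for P
  proof (cases "c P = 0")
    case False
    have "\<not> F_conj S F Q P" using reps_unique[OF Qs] F_conj_refl[OF Qs] P Q(1) by blast
    then show ?thesis
      using beta_mark_zero[OF reps_subgroup[OF P(1)] Qs] max[of P] P(1) False by simp
  qed simp
  then have "(\<Sum>P\<in>reps. c P * loc_mark Q (\<beta> P)) = c Q * loc_mark Q (\<beta> Q)"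
    using sum.mono_neutral_right[OF finite_reps, of "{Q}" "\<lambda>P. c P * loc_mark Q (\<beta> P)"] Q(1) by auto
  moreover have "(\<Sum>P\<in>reps. c P * loc_mark Q (\<beta> P)) = 0"
    using beta_combination(2)[OF c Qs] zero AF_zero(2)[OF Qs] by simp
  ultimately show False using Q(2) beta_mark_self[OF Qs] by simp
qed

end

theorem proposition4p10:
  fixes S :: "('g, 'm) monoid_scheme"
    and p :: nat
    and F :: "'g set \<Rightarrow> 'g set \<Rightarrow> ('g \<Rightarrow> 'g) set"
    and reps :: "'g set set"
  assumes "saturated_fusion_system S p F"
    and "reps \<subseteq> {P. subgroup P S}"
    and "\<And>P. subgroup P S \<Longrightarrow> \<exists>!R. R \<in> reps \<and> F_conj S F P R"
  shows "module_basis (Zloc p) (stable_burnside S p F) reps (beta S p F)"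
proof -
  interpret fusion_class_representatives S p F reps
    using assms unfolding fusion_class_representatives_def fusion_class_representatives_axioms_def by blast
  have zero: "\<zero>\<^bsub>Zloc p\<^esub> = 0" by (simp add: Zloc_def)
  show ?thesis
    unfolding module_basis_def zero
  proof (intro conjI ballI impI)
    show "\<beta> \<in> reps \<rightarrow> carrier AF" by (intro funcsetI beta_carrier reps_subgroup)
  next
    fix x assume "x \<in> carrier AF"
    then obtain c where "c \<in> reps \<rightarrow> p_int p"
      "x = beta_sum c"
      using beta_spanning by blast
    then show "\<exists>c\<in>reps \<rightarrow> p_int p. finite {i \<in> reps. c i \<noteq> 0} \<and>
        x = beta_sum c"
      using finite_reps by (intro bexI[of _ c]) simp_all
  next
    fix c i assume "c \<in> reps \<rightarrow> p_int p" "i \<in> reps"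
      and "beta_sum c = \<zero>\<^bsub>AF\<^esub>"
    then show "c i = 0" using beta_independent by blast
  qed
qed

end
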